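(* Each typical module $V_\mu$ of the category $\mathscr{C}^{H}$ is an ambidextrous module, i.e. $V_\mu$ is simple and for every $f\in\mathrm{End}_{\mathscr{C}^H}(V_\mu\otimes V_\mu)$ one has $\mathrm{ptr}_L(f)=\mathrm{ptr}_R(f)$.
   Context: Let $\ell\ge 3$ be an odd integer, $\xi=\exp(2\pi i/\ell)$, and $\xi^{x}:=\exp(2\pi i x/\ell)$ for $x\in\mathbb{C}$. Let $a_{11}=2$, $a_{12}=a_{21}=-1$, $a_{22}=0$. $\mathcal{U}_\xi\mathfrak{sl}(2|1)$ is the associative $\mathbb{C}$-superalgebra with generators $k_1^{\pm1},k_2^{\pm1},e_1,e_2,f_1,f_2$ ($e_2,f_2$ odd, the others even) and relations $k_1k_2=k_2k_1$, $k_ik_i^{-1}=k_i^{-1}k_i=1$, $k_ie_jk_i^{-1}=\xi^{a_{ij}}e_j$, $k_if_jk_i^{-1}=\xi^{-a_{ij}}f_j$, $e_1f_1-f_1e_1=\frac{k_1-k_1^{-1}}{\xi-\xi^{-1}}$, $e_2f_2+f_2e_2=\frac{k_2-k_2^{-1}}{\xi-\xi^{-1}}$, $e_1f_2=f_2e_1$, $e_2f_1=f_1e_2$, $e_2^2=f_2^2=0$, $e_1^2e_2-(\xi+\xi^{-1})e_1e_2e_1+e_2e_1^2=0$, $f_1^2f_2-(\xi+\xi^{-1})f_1f_2f_1+f_2f_1^2=0$. $\mathcal{U}^H=\mathcal{U}_\xi^H\mathfrak{sl}(2|1)$ is obtained by adding even generators $h_1,h_2$ with $[h_i,e_j]=a_{ij}e_j$,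 $[h_i,f_j]=-a_{ij}f_j$, $[h_i,h_j]=[h_i,k_j]=0$. It is a Hopf superalgebra with $\Delta(e_i)=e_i\otimes1+k_i^{-1}\otimes e_i$, $\Delta(f_i)=f_i\otimes k_i+1\otimes f_i$, $\Delta(k_i)=k_i\otimes k_i$, $\Delta(h_i)=h_i\otimes1+1\otimes h_i$, $S(e_i)=-k_ie_i$, $S(f_i)=-f_ik_i^{-1}$, $S(k_i)=k_i^{-1}$, $S(h_i)=-h_i$, $\epsilon(k_i)=1$, $\epsilon(e_i)=\epsilon(f_i)=\epsilon(h_i)=0$. $\mathscr{C}^H$ is the monoidal category whose objects are finite dimensional ($\mathbb{Z}/2$-graded) $\mathcal{U}^H$-modules on which $e_1^\ell=f_1^\ell=0$, $h_1,h_2$ act diagonalizably and $k_i=\xi^{h_i}$; morphisms are the even $\mathcal{U}^H$-linear maps. The dual of $V$ is $V^*=\mathrm{Hom}_{\mathbb C}(V,\mathbb C)$ with $u\varphi=(-1)^{\deg u\deg\varphi}\varphi\circ S(u)$. With $\phi_0=k_1^{-\ell}k_2^{-2}$ and a homogeneous basis $(v_i)$ of $V$ with dual basis $(v_i^* )$, the pivotal structure is: $\overrightarrow{\mathrm{ev}}_V(v_i^*\otimes v_j)=v_i^*(v_j)$, $\overrightarrow{\mathrm{coev}}_V(1)=\sum_i v_i\otimes v_i^*$, $\overleftarrow{\mathrm{ev}}_V(v_j\otimes v_i^* )=(-1)^{\deg v_j}v_i^*(\phi_0v_j)$, $\overleftarrow{\mathrm{coev}}_V(1)=\sum_i(-1)^{\deg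 v_i}v_i^*\otimes\phi_0^{-1}v_i$. For $\mu=(\mu_1,\mu_2)\in\mathbb{C}^2$, $V_\mu$ is the simple module in $\mathscr{C}^H$ generated by an even highest weight vector $w$: $e_1w=e_2w=0$, $h_iw=\mu_iw$. It is called typical if it is of dimension $4\ell$. For $f\in\mathrm{End}(V\otimes V)$: $\mathrm{ptr}_{R}(f)=(\mathrm{Id}_{V}\otimes \overleftarrow{\mathrm{ev}}_{V})(f \otimes \mathrm{Id}_{V^{*}})(\mathrm{Id}_{V} \otimes \overrightarrow{\mathrm{coev}}_{V})\in\mathrm{End}(V)$ and $\mathrm{ptr}_{L}(f)=(\overrightarrow{\mathrm{ev}}_{V}\otimes \mathrm{Id}_{V})(\mathrm{Id}_{V^{*}} \otimes f)(\overleftarrow{\mathrm{coev}}_{V} \otimes \mathrm{Id}_{V})\in\mathrm{End}(V)$. *)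

theory Defs
  imports Complex_Main "HOL-Library.Z2" "HOL-Library.Poly_Mapping"
begin

section \<open>Complex vector spaces, duals and tensor products\<close>

class complex_vspace = ab_group_add +
  fixes scaleC :: "complex \<Rightarrow> 'a \<Rightarrow> 'a" (infixr "*\<^sub>C" 75)
  assumes scaleC_add_right: "c *\<^sub>C (x + y) = c *\<^sub>C x + c *\<^sub>C y"
    and scaleC_add_left: "(c + d) *\<^sub>C x = c *\<^sub>C x + d *\<^sub>C x"
    and scaleC_scaleC: "c *\<^sub>C d *\<^sub>C x = (c * d) *\<^sub>C x"
    and scaleC_one: "1 *\<^sub>C x = x"

global_interpretation cvs: vector_space "scaleC :: complex \<Rightarrow> 'a \<Rightarrow> 'a::complex_vspace"
  by unfold_locales (fact scaleC_add_right scaleC_add_left scaleC_scaleC scaleC_one)+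

global_interpretation cvs_pair: vector_space_pair
  "scaleC :: complex \<Rightarrow> 'a \<Rightarrow> 'a::complex_vspace" "scaleC :: complex \<Rightarrow> 'b \<Rightarrow> 'b::complex_vspace"
  by unfold_locales

abbreviation clinear :: "('a::complex_vspace \<Rightarrow> 'b::complex_vspace) \<Rightarrow> bool" where
  "clinear \<equiv> Vector_Spaces.linear scaleC scaleC"

lemma clinear_iff:
  "clinear f \<longleftrightarrow> (\<forall>x y. f (x + y) = f x + f y) \<and> (\<forall>c x. f (c *\<^sub>C x) = c *\<^sub>C f x)"
  by (simp add: Vector_Spaces.linear_iff cvs.vector_space_axioms)

definition cbilinear :: "('a::complex_vspace \<Rightarrow> 'b::complex_vspace \<Rightarrow> 'c::complex_vspace) \<Rightarrow> bool" where
  "cbilinear h \<longleftrightarrow> (\<forall>y. clinear (\<lambda>x. h x y)) \<and> (\<forall>x. clinear (h x))"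

instantiation complex :: complex_vspace
begin
definition scaleC_complex_def [simp]: "c *\<^sub>C (z::complex) = c * z"
instance by standard (auto simp: algebra_simps)
end

typedef (overloaded) 'a dual = "{\<phi> :: 'a::complex_vspace \<Rightarrow> complex. clinear \<phi>}"
  morphisms dual_apply Dual
  by (rule exI[of _ "\<lambda>_. 0"]) (simp add: clinear_iff)

setup_lifting type_definition_dual

instantiation dual :: (complex_vspace) complex_vspace
begin
lift_definition zero_dual :: "'a dual" is "\<lambda>_. 0" by (simp add: clinear_iff)
lift_definition plus_dual :: "'a dual \<Rightarrow> 'a dual \<Rightarrow> 'a dual" is "\<lambda>f g x. f x + g x"
  by (simp add: clinear_iff algebra_simps)
lift_definition minus_dual :: "'a dual \<Rightarrow> 'a dual \<Rightarrow> 'a dual" is "\<lambda>f g x. f x - g x"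
  by (simp add: clinear_iff algebra_simps)
lift_definition uminus_dual :: "'a dual \<Rightarrow> 'a dual" is "\<lambda>f x. - f x"
  by (simp add: clinear_iff algebra_simps)
lift_definition scaleC_dual :: "complex \<Rightarrow> 'a dual \<Rightarrow> 'a dual" is "\<lambda>c f x. c * f x"
  by (simp add: clinear_iff algebra_simps)
instance by standard (transfer; force simp: algebra_simps)+
end

instantiation poly_mapping :: (type, complex_vspace) complex_vspace
begin
lift_definition scaleC_poly_mapping :: "complex \<Rightarrow> ('a \<Rightarrow>\<^sub>0 'b) \<Rightarrow> ('a \<Rightarrow>\<^sub>0 'b)"
  is "\<lambda>c p k. c *\<^sub>C p k"
  by (erule rev_finite_subset) auto
instance
  by standard (transfer; simp add: fun_eq_iff scaleC_add_right scaleC_add_left scaleC_scaleC scaleC_one)+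
end

text \<open>
  The tensor product of two vector spaces is the free vector space on pairs modulo the
  bilinearity relations.
\<close>

definition tensor_relations :: "('a::complex_vspace \<times> 'b::complex_vspace \<Rightarrow>\<^sub>0 complex) set" where
  "tensor_relations =
     {Poly_Mapping.single (x + x', y) 1 - Poly_Mapping.single (x, y) 1 - Poly_Mapping.single (x', y) 1 | x x' y. True}
   \<union> {Poly_Mapping.single (x, y + y') 1 - Poly_Mapping.single (x, y) 1 - Poly_Mapping.single (x, y') 1 | x y y'. True}
   \<union> {Poly_Mapping.single (c *\<^sub>C x, y) 1 - c *\<^sub>C Poly_Mapping.single (x, y) 1 | c x y. True}
   \<union> {Poly_Mapping.single (x, c *\<^sub>C y) 1 - c *\<^sub>C Poly_Mapping.single (x, y) 1 | c x y. True}"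

definition tensor_equiv ::
  "('a::complex_vspace \<times> 'b::complex_vspace \<Rightarrow>\<^sub>0 complex) \<Rightarrow> ('a \<times> 'b \<Rightarrow>\<^sub>0 complex) \<Rightarrow> bool" where
  "tensor_equiv p q \<longleftrightarrow> p - q \<in> cvs.span tensor_relations"

lemma tensor_equiv_refl: "tensor_equiv p p"
  by (simp add: tensor_equiv_def cvs.span_zero)

lemma tensor_equiv_equivp: "equivp tensor_equiv"
proof (rule equivpI)
  show "reflp tensor_equiv" by (simp add: reflp_def tensor_equiv_refl)
  show "symp tensor_equiv" unfolding symp_def tensor_equiv_def
    using cvs.span_neg by (metis minus_diff_eq)
  show "transp tensor_equiv"
  proof (rule transpI)
    fix p q r
    assume "tensor_equiv p q" "tensor_equiv q r"
    moreover have "p - r = (p - q) + (q - r)" by simp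
    ultimately show "tensor_equiv p r" unfolding tensor_equiv_def using cvs.span_add by metis
  qed
qed

quotient_type (overloaded) ('a, 'b) tensor =
  "'a::complex_vspace \<times> 'b::complex_vspace \<Rightarrow>\<^sub>0 complex" / tensor_equiv
  by (rule tensor_equiv_equivp)

instantiation tensor :: (complex_vspace, complex_vspace) complex_vspace
begin
lift_definition zero_tensor :: "('a, 'b) tensor" is "0" .
lift_definition plus_tensor :: "('a, 'b) tensor \<Rightarrow> ('a, 'b) tensor \<Rightarrow> ('a, 'b) tensor" is "(+)"
proof -
  fix p p' q q' :: "'a \<times> 'b \<Rightarrow>\<^sub>0 complex"
  assume "tensor_equiv p p'" "tensor_equiv q q'"
  moreover have "p + q - (p' + q') = (p - p') + (q - q')" by simp
  ultimately show "tensor_equiv (p + q) (p' + q')"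
    unfolding tensor_equiv_def using cvs.span_add by metis
qed
lift_definition minus_tensor :: "('a, 'b) tensor \<Rightarrow> ('a, 'b) tensor \<Rightarrow> ('a, 'b) tensor" is "(-)"
proof -
  fix p p' q q' :: "'a \<times> 'b \<Rightarrow>\<^sub>0 complex"
  assume "tensor_equiv p p'" "tensor_equiv q q'"
  moreover have "p - q - (p' - q') = (p - p') - (q - q')" by simp
  ultimately show "tensor_equiv (p - q) (p' - q')"
    unfolding tensor_equiv_def using cvs.span_diff by metis
qed
lift_definition uminus_tensor :: "('a, 'b) tensor \<Rightarrow> ('a, 'b) tensor" is "uminus"
proof -
  fix p p' :: "'a \<times> 'b \<Rightarrow>\<^sub>0 complex"
  assume "tensor_equiv p p'"
  moreover have "- p - - p' = - (p - p')" by simp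
  ultimately show "tensor_equiv (- p) (- p')"
    unfolding tensor_equiv_def using cvs.span_neg by metis
qed
lift_definition scaleC_tensor :: "complex \<Rightarrow> ('a, 'b) tensor \<Rightarrow> ('a, 'b) tensor" is "scaleC"
  by (simp add: tensor_equiv_def cvs.span_scale flip: cvs.scale_right_diff_distrib)
instance
proof
  fix s t u :: "('a, 'b) tensor" and c d :: complex
  show "s + t + u = s + (t + u)" by transfer (simp add: tensor_equiv_refl add.assoc)
  show "s + t = t + s" by transfer (simp add: tensor_equiv_refl add.commute)
  show "0 + s = s" by transfer (simp add: tensor_equiv_refl)
  show "- s + s = 0" by transfer (simp add: tensor_equiv_refl)
  show "s - t = s + - t" by transfer (simp add: tensor_equiv_refl)
  show "c *\<^sub>C (s + t) = c *\<^sub>C s + c *\<^sub>C t" by transfer (simp add: tensor_equiv_refl scaleC_add_right)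
  show "(c + d) *\<^sub>C s = c *\<^sub>C s + d *\<^sub>C s" by transfer (simp add: tensor_equiv_refl scaleC_add_left)
  show "c *\<^sub>C d *\<^sub>C s = (c * d) *\<^sub>C s" by transfer (simp add: tensor_equiv_refl scaleC_scaleC)
  show "1 *\<^sub>C s = s" by transfer (simp add: tensor_equiv_refl scaleC_one)
qed
end

lift_definition tensor_pure :: "'a::complex_vspace \<Rightarrow> 'b::complex_vspace \<Rightarrow> ('a, 'b) tensor"
  (infixr "\<otimes>\<^sub>C" 70) is "\<lambda>x y. Poly_Mapping.single (x, y) 1" .

text \<open>The linear map induced by a bilinear one (see \<open>tensor_lift_pure\<close> below).\<close>

definition tensor_lift ::
  "('a::complex_vspace \<Rightarrow> 'b::complex_vspace \<Rightarrow> 'c::complex_vspace) \<Rightarrow> ('a, 'b) tensor \<Rightarrow> 'c" where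
  "tensor_lift h = (THE L. clinear L \<and> (\<forall>x y. L (x \<otimes>\<^sub>C y) = h x y))"

lemma cbilinear_tensor_pure: "cbilinear (tensor_pure :: 'a::complex_vspace \<Rightarrow> 'b::complex_vspace \<Rightarrow> _)"
proof -
  let ?R = "tensor_relations :: ('a \<times> 'b \<Rightarrow>\<^sub>0 complex) set"
  have 1: "(x + x') \<otimes>\<^sub>C y = x \<otimes>\<^sub>C y + x' \<otimes>\<^sub>C y" for x x' :: 'a and y :: 'b
  proof (transfer)
    fix x x' :: 'a and y :: 'b
    have "Poly_Mapping.single (x + x', y) 1 - Poly_Mapping.single (x, y) 1 - Poly_Mapping.single (x', y) 1 \<in> ?R"
      unfolding tensor_relations_def by blast
    then show "tensor_equiv (Poly_Mapping.single (x + x', y) 1)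
        (Poly_Mapping.single (x, y) 1 + Poly_Mapping.single (x', y) 1)"
      by (simp add: tensor_equiv_def cvs.span_base diff_diff_eq)
  qed
  have 2: "x \<otimes>\<^sub>C (y + y') = x \<otimes>\<^sub>C y + x \<otimes>\<^sub>C y'" for x :: 'a and y y' :: 'b
  proof (transfer)
    fix x :: 'a and y y' :: 'b
    have "Poly_Mapping.single (x, y + y') 1 - Poly_Mapping.single (x, y) 1 - Poly_Mapping.single (x, y') 1 \<in> ?R"
      unfolding tensor_relations_def by blast
    then show "tensor_equiv (Poly_Mapping.single (x, y + y') 1)
        (Poly_Mapping.single (x, y) 1 + Poly_Mapping.single (x, y') 1)"
      by (simp add: tensor_equiv_def cvs.span_base diff_diff_eq)
  qed
  have 3: "(c *\<^sub>C x) \<otimes>\<^sub>C y = c *\<^sub>C (x \<otimes>\<^sub>C y)" for c and x :: 'a and y :: 'b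
  proof (transfer)
    fix c and x :: 'a and y :: 'b
    have "Poly_Mapping.single (c *\<^sub>C x, y) 1 - c *\<^sub>C Poly_Mapping.single (x, y) 1 \<in> ?R"
      unfolding tensor_relations_def by blast
    then show "tensor_equiv (Poly_Mapping.single (c *\<^sub>C x, y) 1) (c *\<^sub>C Poly_Mapping.single (x, y) 1)"
      by (simp add: tensor_equiv_def cvs.span_base)
  qed
  have 4: "x \<otimes>\<^sub>C (c *\<^sub>C y) = c *\<^sub>C (x \<otimes>\<^sub>C y)" for c and x :: 'a and y :: 'b
  proof (transfer)
    fix c and x :: 'a and y :: 'b
    have "Poly_Mapping.single (x, c *\<^sub>C y) 1 - c *\<^sub>C Poly_Mapping.single (x, y) 1 \<in> ?R"
      unfolding tensor_relations_def by blast
    then show "tensor_equiv (Poly_Mapping.single (x, c *\<^sub>C y) 1) (c *\<^sub>C Poly_Mapping.single (x, y) 1)"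
      by (simp add: tensor_equiv_def cvs.span_base)
  qed
  show ?thesis by (simp add: cbilinear_def clinear_iff 1 2 3 4)
qed

definition free_extension :: "('k \<Rightarrow> 'c::complex_vspace) \<Rightarrow> ('k \<Rightarrow>\<^sub>0 complex) \<Rightarrow> 'c" where
  "free_extension h p = (\<Sum>k\<in>Poly_Mapping.keys p. Poly_Mapping.lookup p k *\<^sub>C h k)"

lemma free_extension_superset:
  assumes "finite K" "Poly_Mapping.keys p \<subseteq> K"
  shows "free_extension h p = (\<Sum>k\<in>K. Poly_Mapping.lookup p k *\<^sub>C h k)"
  unfolding free_extension_def using assms
  by (intro sum.mono_neutral_left) (auto simp: in_keys_iff)

lemma clinear_free_extension: "clinear (free_extension h)"
proof -
  have "free_extension h (p + q) = free_extension h p + free_extension h q" for p q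
  proof -
    let ?K = "Poly_Mapping.keys p \<union> Poly_Mapping.keys q"
    have "Poly_Mapping.keys (p + q) \<subseteq> ?K" by (rule keys_add)
    then show ?thesis
      by (simp add: free_extension_superset[of ?K] lookup_add scaleC_add_left sum.distrib)
  qed
  moreover have "free_extension h (c *\<^sub>C p) = c *\<^sub>C free_extension h p" for c p
  proof -
    have l: "Poly_Mapping.lookup (c *\<^sub>C p) k = c * Poly_Mapping.lookup p k" for k
      by transfer simp
    then have "Poly_Mapping.keys (c *\<^sub>C p) \<subseteq> Poly_Mapping.keys p"
      by (auto simp: in_keys_iff)
    then show ?thesis
      by (simp add: free_extension_superset[of "Poly_Mapping.keys p"] l cvs.scale_sum_right)
  qed
  ultimately show ?thesis by (simp add: clinear_iff)
qed

lemma free_extension_single [simp]: "free_extension h (Poly_Mapping.single k 1) = h k"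
  by (simp add: free_extension_def scaleC_one)

lemma span_tensor_pure: "cvs.span {x \<otimes>\<^sub>C y | x y. True} = (UNIV :: ('a::complex_vspace, 'b::complex_vspace) tensor set)"
proof -
  let ?S = "cvs.span {x \<otimes>\<^sub>C y | x y. True} :: ('a, 'b) tensor set"
  have *: "abs_tensor p \<in> ?S" if "finite K" "Poly_Mapping.keys p = K" for p :: "'a \<times> 'b \<Rightarrow>\<^sub>0 complex" and K
    using that
  proof (induction K arbitrary: p rule: finite_induct)
    case empty
    then have "p = 0" by simp
    then show ?case by (metis cvs.span_zero zero_tensor.abs_eq)
  next
    case (insert k K)
    obtain x y where k: "k = (x, y)" by (cases k)
    let ?v = "Poly_Mapping.lookup p k"
    define q where "q = p - Poly_Mapping.single k ?v"
    have "Poly_Mapping.keys q = K"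
      using insert.hyps insert.prems
      by (auto simp: q_def in_keys_iff lookup_minus lookup_single when_def set_eq_iff split: if_splits)
    then have q: "abs_tensor q \<in> ?S" by (rule insert.IH)
    have "Poly_Mapping.single k ?v = ?v *\<^sub>C Poly_Mapping.single k (1::complex)"
      by (rule poly_mapping_eqI) (simp add: scaleC_poly_mapping.rep_eq lookup_single when_def)
    then have "abs_tensor (Poly_Mapping.single k ?v) = ?v *\<^sub>C (x \<otimes>\<^sub>C y)"
      by (simp add: k scaleC_tensor.abs_eq tensor_pure.abs_eq)
    then have "abs_tensor (Poly_Mapping.single k ?v) \<in> ?S"
      by (simp only:) (intro cvs.span_scale cvs.span_base, blast)
    moreover have "abs_tensor p = abs_tensor q + abs_tensor (Poly_Mapping.single k ?v)"
      by (simp add: plus_tensor.abs_eq q_def)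
    ultimately show ?case using q by (simp add: cvs.span_add)
  qed
  have "abs_tensor p \<in> ?S" for p :: "'a \<times> 'b \<Rightarrow>\<^sub>0 complex"
    by (rule *[OF finite_keys refl])
  then have "t \<in> ?S" for t by (subst Quotient_abs_rep[OF Quotient_tensor, symmetric])
  then show ?thesis by blast
qed

lemma tensor_lift_unique:
  fixes L L' :: "('a::complex_vspace, 'b::complex_vspace) tensor \<Rightarrow> 'c::complex_vspace"
  assumes "clinear L" "clinear L'" "\<And>x y. L (x \<otimes>\<^sub>C y) = L' (x \<otimes>\<^sub>C y)"
  shows "L = L'"
proof
  fix t :: "('a, 'b) tensor"
  have "t \<in> cvs.span {x \<otimes>\<^sub>C y | x y. True}" unfolding span_tensor_pure by (rule UNIV_I)
  then show "L t = L' t"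
    by (rule cvs_pair.linear_eq_on[OF assms(1,2)]) (auto simp: assms(3))
qed

lemma tensor_lift_exists:
  fixes h :: "'a::complex_vspace \<Rightarrow> 'b::complex_vspace \<Rightarrow> 'c::complex_vspace"
  assumes "cbilinear h"
  shows "\<exists>L. clinear L \<and> (\<forall>x y. L (x \<otimes>\<^sub>C y) = h x y)"
proof -
  let ?F = "free_extension (\<lambda>(x, y). h x y)"
  interpret F: Vector_Spaces.linear scaleC scaleC ?F by (rule clinear_free_extension)
  have bil: "h (x + x') y = h x y + h x' y" "h x (y + y') = h x y + h x y'"
    "h (c *\<^sub>C x) y = c *\<^sub>C h x y" "h x (c *\<^sub>C y) = c *\<^sub>C h x y" for x x' y y' c
    using assms by (auto simp: cbilinear_def clinear_iff)
  have "?F r = 0" if "r \<in> tensor_relations" for r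
    using that unfolding tensor_relations_def by (auto simp: F.diff F.scale bil)
  then have "?F r = 0" if "r \<in> cvs.span tensor_relations" for r
    using F.eq_0_on_span that by blast
  then have resp: "?F p = ?F q" if "tensor_equiv p q" for p q
    using that F.diff[of p q] by (simp add: tensor_equiv_def)
  define L where "L t = ?F (rep_tensor t)" for t
  have L: "L (abs_tensor p) = ?F p" for p
    unfolding L_def by (rule resp) (rule Quotient_rep_abs[OF Quotient_tensor tensor_equiv_refl])
  have ex: "\<exists>p. t = abs_tensor p" for t :: "('a, 'b) tensor"
    by (rule exI[of _ "rep_tensor t"]) (rule Quotient_abs_rep[OF Quotient_tensor, symmetric])
  have "L (s + t) = L s + L t" for s t
  proof -
    obtain p q where "s = abs_tensor p" "t = abs_tensor q" using ex by metis
    then show ?thesis by (simp only: plus_tensor.abs_eq L F.add)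
  qed
  moreover have "L (c *\<^sub>C t) = c *\<^sub>C L t" for c t
  proof -
    obtain p where "t = abs_tensor p" using ex by metis
    then show ?thesis by (simp only: scaleC_tensor.abs_eq L F.scale)
  qed
  moreover have "L (x \<otimes>\<^sub>C y) = h x y" for x y
    by (simp add: tensor_pure.abs_eq L)
  ultimately show ?thesis by (intro exI[of _ L]) (simp add: clinear_iff)
qed

lemma tensor_lift:
  assumes "cbilinear h"
  shows "clinear (tensor_lift h) \<and> (\<forall>x y. tensor_lift h (x \<otimes>\<^sub>C y) = h x y)"
proof -
  obtain L where L: "clinear L" "\<forall>x y. L (x \<otimes>\<^sub>C y) = h x y"
    using tensor_lift_exists[OF assms] by blast
  show ?thesis
    unfolding tensor_lift_def
  proof (rule theI[of _ L])
    show "clinear L \<and> (\<forall>x y. L (x \<otimes>\<^sub>C y) = h x y)" using L by blast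
    fix L' assume "clinear L' \<and> (\<forall>x y. L' (x \<otimes>\<^sub>C y) = h x y)"
    then show "L' = L" by (intro tensor_lift_unique) (simp_all add: L)
  qed
qed

lemmas clinear_tensor_lift = tensor_lift[THEN conjunct1]
lemmas tensor_lift_pure = tensor_lift[THEN conjunct2, rule_format]

definition tensor_map ::
  "('a::complex_vspace \<Rightarrow> 'c::complex_vspace) \<Rightarrow> ('b::complex_vspace \<Rightarrow> 'd::complex_vspace)
   \<Rightarrow> ('a, 'b) tensor \<Rightarrow> ('c, 'd) tensor" where
  "tensor_map f g = tensor_lift (\<lambda>x y. f x \<otimes>\<^sub>C g y)"

definition tensor_assoc ::
  "(('a::complex_vspace, 'b::complex_vspace) tensor, 'c::complex_vspace) tensor \<Rightarrow> ('a, ('b, 'c) tensor) tensor" where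
  "tensor_assoc = tensor_lift (\<lambda>t z. tensor_lift (\<lambda>x y. x \<otimes>\<^sub>C (y \<otimes>\<^sub>C z)) t)"

definition tensor_assoc_inv ::
  "('a::complex_vspace, ('b::complex_vspace, 'c::complex_vspace) tensor) tensor \<Rightarrow> (('a, 'b) tensor, 'c) tensor" where
  "tensor_assoc_inv = tensor_lift (\<lambda>x t. tensor_lift (\<lambda>y z. (x \<otimes>\<^sub>C y) \<otimes>\<^sub>C z) t)"

definition tensor_lunit :: "(complex, 'a::complex_vspace) tensor \<Rightarrow> 'a" where
  "tensor_lunit = tensor_lift (\<lambda>c x. c *\<^sub>C x)"

definition tensor_lunit_inv :: "'a::complex_vspace \<Rightarrow> (complex, 'a) tensor" where
  "tensor_lunit_inv x = 1 \<otimes>\<^sub>C x"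

definition tensor_runit :: "('a::complex_vspace, complex) tensor \<Rightarrow> 'a" where
  "tensor_runit = tensor_lift (\<lambda>x c. c *\<^sub>C x)"

definition tensor_runit_inv :: "'a::complex_vspace \<Rightarrow> ('a, complex) tensor" where
  "tensor_runit_inv x = x \<otimes>\<^sub>C 1"


lemma tensor_pure_simps:
  "(x + x') \<otimes>\<^sub>C y = x \<otimes>\<^sub>C y + x' \<otimes>\<^sub>C y"
  "x \<otimes>\<^sub>C (y + y') = x \<otimes>\<^sub>C y + x \<otimes>\<^sub>C y'"
  "(c *\<^sub>C x) \<otimes>\<^sub>C y = c *\<^sub>C (x \<otimes>\<^sub>C y)"
  "x \<otimes>\<^sub>C (c *\<^sub>C y) = c *\<^sub>C (x \<otimes>\<^sub>C y)"
  for x x' :: "'a::complex_vspace" and y y' :: "'b::complex_vspace"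
proof -
  have "cbilinear (tensor_pure :: 'a \<Rightarrow> 'b \<Rightarrow> _)" by (rule cbilinear_tensor_pure)
  then show "(x + x') \<otimes>\<^sub>C y = x \<otimes>\<^sub>C y + x' \<otimes>\<^sub>C y"
    "x \<otimes>\<^sub>C (y + y') = x \<otimes>\<^sub>C y + x \<otimes>\<^sub>C y'"
    "(c *\<^sub>C x) \<otimes>\<^sub>C y = c *\<^sub>C (x \<otimes>\<^sub>C y)"
    "x \<otimes>\<^sub>C (c *\<^sub>C y) = c *\<^sub>C (x \<otimes>\<^sub>C y)"
    by (auto simp: cbilinear_def clinear_iff)
qed

lemma cbilinear_tensor_map:
  "clinear f \<Longrightarrow> clinear g \<Longrightarrow> cbilinear (\<lambda>x y. f x \<otimes>\<^sub>C g y)"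
  by (simp add: cbilinear_def clinear_iff tensor_pure_simps)

lemma
  assumes "clinear f" "clinear g"
  shows clinear_tensor_map: "clinear (tensor_map f g)"
    and tensor_map_pure: "tensor_map f g (x \<otimes>\<^sub>C y) = f x \<otimes>\<^sub>C g y"
  using tensor_lift[OF cbilinear_tensor_map[OF assms]] by (auto simp: tensor_map_def)

lemma tensor_lift_add_scale:
  assumes "cbilinear h" "cbilinear h'"
  shows "tensor_lift (\<lambda>x y. h x y + h' x y) t = tensor_lift h t + tensor_lift h' t"
    and "tensor_lift (\<lambda>x y. c *\<^sub>C h x y) t = c *\<^sub>C tensor_lift h t"
proof -
  have 1: "cbilinear (\<lambda>x y. h x y + h' x y)" and 2: "cbilinear (\<lambda>x y. c *\<^sub>C h x y)"
    using assms by (auto simp: cbilinear_def clinear_iff scaleC_add_right scaleC_scaleC mult.commute)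
  have "tensor_lift (\<lambda>x y. h x y + h' x y) = (\<lambda>t. tensor_lift h t + tensor_lift h' t)"
    by (rule tensor_lift_unique)
      (use tensor_lift[OF 1] tensor_lift[OF assms(1)] tensor_lift[OF assms(2)] in
        \<open>auto simp: clinear_iff scaleC_add_right\<close>)
  then show "tensor_lift (\<lambda>x y. h x y + h' x y) t = tensor_lift h t + tensor_lift h' t" by simp
  have "tensor_lift (\<lambda>x y. c *\<^sub>C h x y) = (\<lambda>t. c *\<^sub>C tensor_lift h t)"
    by (rule tensor_lift_unique)
      (use tensor_lift[OF 2] tensor_lift[OF assms(1)] in
        \<open>auto simp: clinear_iff scaleC_add_right scaleC_scaleC mult.commute\<close>)
  then show "tensor_lift (\<lambda>x y. c *\<^sub>C h x y) t = c *\<^sub>C tensor_lift h t" by simp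
qed

lemma cbilinear_assoc:
  fixes h :: "'a::complex_vspace \<Rightarrow> 'b::complex_vspace \<Rightarrow> 'c::complex_vspace \<Rightarrow> 'd::complex_vspace"
  assumes "\<And>z. cbilinear (\<lambda>x y. h x y z)" "\<And>x y. clinear (h x y)"
  shows "cbilinear (\<lambda>t z. tensor_lift (\<lambda>x y. h x y z) t)"
proof -
  have "tensor_lift (\<lambda>x y. h x y (z + z')) t
      = tensor_lift (\<lambda>x y. h x y z) t + tensor_lift (\<lambda>x y. h x y z') t" for z z' t
  proof -
    have "(\<lambda>x y. h x y (z + z')) = (\<lambda>x y. h x y z + h x y z')"
      using assms(2) by (simp add: clinear_iff)
    then show ?thesis using tensor_lift_add_scale(1)[OF assms(1)[of z] assms(1)[of z']] by simp
  qed
  moreover have "tensor_lift (\<lambda>x y. h x y (c *\<^sub>C z)) t = c *\<^sub>C tensor_lift (\<lambda>x y. h x y z) t" for c z t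
  proof -
    have "(\<lambda>x y. h x y (c *\<^sub>C z)) = (\<lambda>x y. c *\<^sub>C h x y z)"
      using assms(2) by (simp add: clinear_iff)
    then show ?thesis using tensor_lift_add_scale(2)[OF assms(1)[of z] assms(1)[of z]] by simp
  qed
  ultimately show ?thesis
    using clinear_tensor_lift[OF assms(1)] by (simp add: cbilinear_def clinear_iff)
qed

lemma cbilinear_assoc_inv:
  fixes h :: "'a::complex_vspace \<Rightarrow> 'b::complex_vspace \<Rightarrow> 'c::complex_vspace \<Rightarrow> 'd::complex_vspace"
  assumes "\<And>x. cbilinear (h x)" "\<And>y z. clinear (\<lambda>x. h x y z)"
  shows "cbilinear (\<lambda>x t. tensor_lift (h x) t)"
proof -
  have "cbilinear (\<lambda>t x. tensor_lift (\<lambda>y z. h x y z) t)"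
    by (rule cbilinear_assoc) (use assms in auto)
  then show ?thesis by (simp add: cbilinear_def)
qed

lemma
  fixes x :: "'a::complex_vspace" and y :: "'b::complex_vspace" and z :: "'c::complex_vspace"
  shows clinear_tensor_assoc:
      "clinear (tensor_assoc :: (('a, 'b) tensor, 'c) tensor \<Rightarrow> ('a, ('b, 'c) tensor) tensor)"
    and tensor_assoc_pure: "tensor_assoc ((x \<otimes>\<^sub>C y) \<otimes>\<^sub>C z) = x \<otimes>\<^sub>C (y \<otimes>\<^sub>C z)"
proof -
  have h: "cbilinear (\<lambda>(x::'a) (y::'b). x \<otimes>\<^sub>C (y \<otimes>\<^sub>C z))" for z :: 'c
    by (simp add: cbilinear_def clinear_iff tensor_pure_simps)
  have "cbilinear (\<lambda>t (z::'c). tensor_lift (\<lambda>(x::'a) (y::'b). x \<otimes>\<^sub>C (y \<otimes>\<^sub>C z)) t)"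
    by (rule cbilinear_assoc[OF h]) (simp add: clinear_iff tensor_pure_simps)
  note L = tensor_lift[OF this]
  show "clinear (tensor_assoc :: (('a, 'b) tensor, 'c) tensor \<Rightarrow> ('a, ('b, 'c) tensor) tensor)"
    unfolding tensor_assoc_def by (rule L[THEN conjunct1])
  show "tensor_assoc ((x \<otimes>\<^sub>C y) \<otimes>\<^sub>C z) = x \<otimes>\<^sub>C (y \<otimes>\<^sub>C z)"
    unfolding tensor_assoc_def using L[THEN conjunct2, rule_format, of "x \<otimes>\<^sub>C y" z] tensor_lift_pure[OF h, of z x y]
    by (rule trans)
qed

lemma
  fixes x :: "'a::complex_vspace" and y :: "'b::complex_vspace" and z :: "'c::complex_vspace"
  shows clinear_tensor_assoc_inv:
      "clinear (tensor_assoc_inv :: ('a, ('b, 'c) tensor) tensor \<Rightarrow> (('a, 'b) tensor, 'c) tensor)"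
    and tensor_assoc_inv_pure: "tensor_assoc_inv (x \<otimes>\<^sub>C (y \<otimes>\<^sub>C z)) = (x \<otimes>\<^sub>C y) \<otimes>\<^sub>C z"
proof -
  have h: "cbilinear (\<lambda>(y::'b) (z::'c). (x \<otimes>\<^sub>C y) \<otimes>\<^sub>C z)" for x :: 'a
    by (simp add: cbilinear_def clinear_iff tensor_pure_simps)
  have "cbilinear (\<lambda>(x::'a) t. tensor_lift (\<lambda>(y::'b) (z::'c). (x \<otimes>\<^sub>C y) \<otimes>\<^sub>C z) t)"
    by (rule cbilinear_assoc_inv[OF h]) (simp add: clinear_iff tensor_pure_simps)
  note L = tensor_lift[OF this]
  show "clinear (tensor_assoc_inv :: ('a, ('b, 'c) tensor) tensor \<Rightarrow> (('a, 'b) tensor, 'c) tensor)"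
    unfolding tensor_assoc_inv_def by (rule L[THEN conjunct1])
  show "tensor_assoc_inv (x \<otimes>\<^sub>C (y \<otimes>\<^sub>C z)) = (x \<otimes>\<^sub>C y) \<otimes>\<^sub>C z"
    unfolding tensor_assoc_inv_def using L[THEN conjunct2, rule_format, of x "y \<otimes>\<^sub>C z"] tensor_lift_pure[OF h, of x y z]
    by (rule trans)
qed

lemma
  fixes x :: "'a::complex_vspace"
  shows clinear_tensor_lunit: "clinear (tensor_lunit :: (complex, 'a) tensor \<Rightarrow> 'a)"
    and tensor_lunit_pure: "tensor_lunit (c \<otimes>\<^sub>C x) = c *\<^sub>C x"
proof -
  have "cbilinear (\<lambda>c (x::'a). c *\<^sub>C x)"
    by (simp add: cbilinear_def clinear_iff scaleC_add_left scaleC_add_right scaleC_scaleC mult.commute)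
  note L = tensor_lift[OF this]
  show "clinear (tensor_lunit :: (complex, 'a) tensor \<Rightarrow> 'a)" "tensor_lunit (c \<otimes>\<^sub>C x) = c *\<^sub>C x"
    using L by (simp_all add: tensor_lunit_def)
qed

lemma
  fixes x :: "'a::complex_vspace"
  shows clinear_tensor_runit: "clinear (tensor_runit :: ('a, complex) tensor \<Rightarrow> 'a)"
    and tensor_runit_pure: "tensor_runit (x \<otimes>\<^sub>C c) = c *\<^sub>C x"
proof -
  have "cbilinear (\<lambda>(x::'a) c. c *\<^sub>C x)"
    by (simp add: cbilinear_def clinear_iff scaleC_add_left scaleC_add_right scaleC_scaleC mult.commute)
  note L = tensor_lift[OF this]
  show "clinear (tensor_runit :: ('a, complex) tensor \<Rightarrow> 'a)" "tensor_runit (x \<otimes>\<^sub>C c) = c *\<^sub>C x"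
    using L by (simp_all add: tensor_runit_def)
qed


section \<open>Gradings\<close>

text \<open>Parities are elements of \<open>bit\<close>, the integers mod 2; \<open>G p\<close> is the homogeneous part of parity \<open>p\<close>.\<close>

definition koszul_sign :: "bit \<Rightarrow> complex" where
  "koszul_sign p = (if p = 1 then -1 else 1)"

definition grading :: "(bit \<Rightarrow> 'v::complex_vspace set) \<Rightarrow> bool" where
  "grading G \<longleftrightarrow> (\<forall>p. cvs.subspace (G p)) \<and> G 0 \<inter> G 1 = {0} \<and> (\<forall>v. \<exists>x\<in>G 0. \<exists>y\<in>G 1. v = x + y)"

definition hom_part :: "(bit \<Rightarrow> 'v::complex_vspace set) \<Rightarrow> bit \<Rightarrow> 'v \<Rightarrow> 'v" where
  "hom_part G p v = (THE x. x \<in> G p \<and> v - x \<in> G (p + 1))"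

text \<open>The linear extension of \<open>v \<mapsto> (-1)\<^bsup>p deg v\<^esup> v\<close>.\<close>

definition parity_twist :: "(bit \<Rightarrow> 'v::complex_vspace set) \<Rightarrow> bit \<Rightarrow> 'v \<Rightarrow> 'v" where
  "parity_twist G p v = hom_part G 0 v + koszul_sign p *\<^sub>C hom_part G 1 v"

lemma hom_part:
  assumes "grading G"
  shows "hom_part G p v \<in> G p" "v - hom_part G p v \<in> G (p + 1)"
    and hom_part_unique: "x \<in> G p \<Longrightarrow> v - x \<in> G (p + 1) \<Longrightarrow> hom_part G p v = x"
proof -
  have sub: "cvs.subspace (G q)" for q using assms by (simp add: grading_def)
  have int: "G p \<inter> G (p + 1) = {0}" using assms by (cases p) (auto simp: grading_def)
  have ex: "\<exists>x. x \<in> G p \<and> v - x \<in> G (p + 1)"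
  proof -
    obtain x y where "x \<in> G 0" "y \<in> G 1" "v = x + y" using assms by (meson grading_def)
    then show ?thesis by (cases p) (auto intro: exI[of _ x] exI[of _ y])
  qed
  have uniq: "x = y" if "x \<in> G p" "v - x \<in> G (p + 1)" "y \<in> G p" "v - y \<in> G (p + 1)" for x y
  proof -
    have "x - y \<in> G p" using cvs.subspace_diff[OF sub] that by blast
    moreover have "(v - y) - (v - x) \<in> G (p + 1)" using cvs.subspace_diff[OF sub] that by blast
    then have "x - y \<in> G (p + 1)" by simp
    ultimately have "x - y \<in> G p \<inter> G (p + 1)" by blast
    then have "x - y = 0" unfolding int by blast
    then show ?thesis by simp
  qed
  show "hom_part G p v \<in> G p" "v - hom_part G p v \<in> G (p + 1)"
    using theI'[of "\<lambda>x. x \<in> G p \<and> v - x \<in> G (p + 1)"] ex uniq unfolding hom_part_def by blast+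
  show "hom_part G p v = x" if "x \<in> G p" "v - x \<in> G (p + 1)"
    unfolding hom_part_def using that uniq by (intro the_equality) auto
qed

lemma clinear_hom_part:
  assumes "grading G"
  shows "clinear (hom_part G p)"
proof -
  have sub: "cvs.subspace (G q)" for q using assms by (simp add: grading_def)
  note hp = hom_part[OF assms]
  have "hom_part G p (x + y) = hom_part G p x + hom_part G p y" for x y
  proof (rule hp(3))
    show "hom_part G p x + hom_part G p y \<in> G p" using hp(1) cvs.subspace_add[OF sub] by blast
    have "(x - hom_part G p x) + (y - hom_part G p y) \<in> G (p + 1)"
      using hp(2) cvs.subspace_add[OF sub] by blast
    then show "x + y - (hom_part G p x + hom_part G p y) \<in> G (p + 1)" by (simp add: algebra_simps)
  qed
  moreover have "hom_part G p (c *\<^sub>C x) = c *\<^sub>C hom_part G p x" for c x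
  proof (rule hp(3))
    show "c *\<^sub>C hom_part G p x \<in> G p" using hp(1) cvs.subspace_scale[OF sub] by blast
    show "c *\<^sub>C x - c *\<^sub>C hom_part G p x \<in> G (p + 1)"
      using cvs.subspace_scale[OF sub hp(2)] by (simp flip: cvs.scale_right_diff_distrib)
  qed
  ultimately show ?thesis by (simp add: clinear_iff)
qed

lemma clinear_parity_twist: "grading G \<Longrightarrow> clinear (parity_twist G p)"
  using clinear_hom_part[of G 0] clinear_hom_part[of G 1]
  by (simp add: clinear_iff parity_twist_def scaleC_add_right scaleC_scaleC mult.commute)

lemma parity_twist_homogeneous:
  assumes "grading G" "v \<in> G q"
  shows "parity_twist G p v = koszul_sign (p * q) *\<^sub>C v"
proof -
  have sub: "cvs.subspace (G r)" for r using assms by (simp add: grading_def)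
  have *: "hom_part G q v = v" "hom_part G (q + 1) v = 0"
    by (rule hom_part_unique[OF assms(1)]; cases q; use assms(2) cvs.subspace_0[OF sub] in simp)+
  show ?thesis
    by (cases q) (use * in \<open>auto simp: parity_twist_def koszul_sign_def scaleC_one\<close>)
qed

definition homogeneous_basis :: "(bit \<Rightarrow> 'v::complex_vspace set) \<Rightarrow> 'v set \<Rightarrow> bool" where
  "homogeneous_basis G B \<longleftrightarrow> cvs.independent B \<and> cvs.span B = UNIV \<and> B \<subseteq> G 0 \<union> G 1"

definition dual_basis :: "'v::complex_vspace set \<Rightarrow> 'v \<Rightarrow> 'v dual" where
  "dual_basis B b = Dual (\<lambda>x. cvs.representation B x b)"


section \<open>Modules over the unrolled quantum superalgebra of sl(2|1) at a root of unity\<close>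

datatype node = N1 | N2

fun cartan :: "node \<Rightarrow> node \<Rightarrow> int" where
  "cartan N1 N1 = 2"
| "cartan N1 N2 = -1"
| "cartan N2 N1 = -1"
| "cartan N2 N2 = 0"

datatype gen = GE node | GF node | GK node | GKinv node | GH node

fun gen_parity :: "gen \<Rightarrow> bit" where
  "gen_parity (GE N2) = 1"
| "gen_parity (GF N2) = 1"
| "gen_parity _ = 0"

definition xi_pow :: "nat \<Rightarrow> complex \<Rightarrow> complex" where
  "xi_pow l x = exp (2 * complex_of_real pi * \<i> * x / of_nat l)"

definition xi :: "nat \<Rightarrow> complex" where
  "xi l = exp (2 * complex_of_real pi * \<i> / of_nat l)"

text \<open>
  A module over the algebra presented by generators and relations is given by a grading and
  the operators by which the generators act. Words in the generators stand for monomials.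
\<close>

record 'v smodule =
  gr :: "bit \<Rightarrow> 'v set"
  act :: "gen \<Rightarrow> 'v \<Rightarrow> 'v"

definition act_word :: "'v smodule \<Rightarrow> gen list \<Rightarrow> 'v \<Rightarrow> 'v" where
  "act_word M w v = foldr (act M) w v"

definition word_parity :: "gen list \<Rightarrow> bit" where
  "word_parity w = (\<Sum>g\<leftarrow>w. gen_parity g)"

definition UH_relations :: "nat \<Rightarrow> ('v::complex_vspace) smodule \<Rightarrow> bool" where
  "UH_relations l M \<longleftrightarrow>
    (let q = xi l; e = (\<lambda>i. act M (GE i)); f = (\<lambda>i. act M (GF i));
         k = (\<lambda>i. act M (GK i)); k' = (\<lambda>i. act M (GKinv i)); h = (\<lambda>i. act M (GH i)) in
     \<forall>v.
      k N1 (k N2 v) = k N2 (k N1 v) \<and>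
      (\<forall>i. k i (k' i v) = v \<and> k' i (k i v) = v) \<and>
      (\<forall>i j. k i (e j (k' i v)) = xi_pow l (of_int (cartan i j)) *\<^sub>C e j v) \<and>
      (\<forall>i j. k i (f j (k' i v)) = xi_pow l (of_int (- cartan i j)) *\<^sub>C f j v) \<and>
      e N1 (f N1 v) - f N1 (e N1 v) = (1 / (q - inverse q)) *\<^sub>C (k N1 v - k' N1 v) \<and>
      e N2 (f N2 v) + f N2 (e N2 v) = (1 / (q - inverse q)) *\<^sub>C (k N2 v - k' N2 v) \<and>
      e N1 (f N2 v) = f N2 (e N1 v) \<and>
      e N2 (f N1 v) = f N1 (e N2 v) \<and>
      e N2 (e N2 v) = 0 \<and>
      f N2 (f N2 v) = 0 \<and>
      e N1 (e N1 (e N2 v)) - (q + inverse q) *\<^sub>C e N1 (e N2 (e N1 v)) + e N2 (e N1 (e N1 v)) = 0 \<and>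
      f N1 (f N1 (f N2 v)) - (q + inverse q) *\<^sub>C f N1 (f N2 (f N1 v)) + f N2 (f N1 (f N1 v)) = 0 \<and>
      (\<forall>i j. h i (e j v) - e j (h i v) = of_int (cartan i j) *\<^sub>C e j v) \<and>
      (\<forall>i j. h i (f j v) - f j (h i v) = - of_int (cartan i j) *\<^sub>C f j v) \<and>
      (\<forall>i j. h i (h j v) = h j (h i v)) \<and>
      (\<forall>i j. h i (k j v) = k j (h i v)))"

definition UH_module :: "nat \<Rightarrow> ('v::complex_vspace) smodule \<Rightarrow> bool" where
  "UH_module l M \<longleftrightarrow>
     grading (gr M) \<and>
     (\<forall>g. clinear (act M g)) \<and>
     (\<forall>g p. act M g ` gr M p \<subseteq> gr M (p + gen_parity g)) \<and>
     UH_relations l M"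

text \<open>
  Since \<open>h\<^sub>i\<close> is diagonalizable, \<open>\<xi>\<^bsup>h\<^sub>i\<^esup>\<close> is the operator acting as \<open>\<xi>\<^bsup>x\<^esup>\<close> on the
  \<open>x\<close>-eigenspace of \<open>h\<^sub>i\<close>.
\<close>

definition CH_object :: "nat \<Rightarrow> ('v::complex_vspace) smodule \<Rightarrow> bool" where
  "CH_object l M \<longleftrightarrow>
     UH_module l M \<and>
     (\<exists>B. finite B \<and> cvs.span B = (UNIV :: 'v set)) \<and>
     (\<forall>v. (act M (GE N1) ^^ l) v = 0 \<and> (act M (GF N1) ^^ l) v = 0) \<and>
     (\<forall>i. cvs.span {v. \<exists>x. act M (GH i) v = x *\<^sub>C v} = UNIV) \<and>
     (\<forall>i v x. act M (GH i) v = x *\<^sub>C v \<longrightarrow> act M (GK i) v = xi_pow l x *\<^sub>C v)"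

definition CH_hom ::
  "('v::complex_vspace) smodule \<Rightarrow> ('w::complex_vspace) smodule \<Rightarrow> ('v \<Rightarrow> 'w) set" where
  "CH_hom M N = {f. clinear f \<and> (\<forall>p. f ` gr M p \<subseteq> gr N p) \<and> (\<forall>g v. f (act M g v) = act N g (f v))}"

text \<open>
  The coproduct of a generator as a list of pairs of monomials. A tensor \<open>a \<otimes> b\<close> acts by
  \<open>(a \<otimes> b) (x \<otimes> y) = (-1)\<^bsup>deg b deg x\<^esup> a x \<otimes> b y\<close>.
\<close>

fun coproduct :: "gen \<Rightarrow> (gen list \<times> gen list) list" where
  "coproduct (GE i) = [([GE i], []), ([GKinv i], [GE i])]"
| "coproduct (GF i) = [([GF i], [GK i]), ([], [GF i])]"
| "coproduct (GK i) = [([GK i], [GK i])]"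
| "coproduct (GKinv i) = [([GKinv i], [GKinv i])]"
| "coproduct (GH i) = [([GH i], []), ([], [GH i])]"

definition tensor_module ::
  "('v::complex_vspace) smodule \<Rightarrow> ('w::complex_vspace) smodule \<Rightarrow> ('v, 'w) tensor smodule" where
  "tensor_module M N =
    \<lparr> gr = (\<lambda>p. cvs.span {x \<otimes>\<^sub>C y | x y r s. x \<in> gr M r \<and> y \<in> gr N s \<and> r + s = p}),
      act = (\<lambda>g t. \<Sum>(a, b)\<leftarrow>coproduct g.
        tensor_map (\<lambda>x. act_word M a (parity_twist (gr M) (word_parity b) x)) (act_word N b) t) \<rparr>"

definition submodule :: "('v::complex_vspace) smodule \<Rightarrow> 'v set \<Rightarrow> bool" where
  "submodule M W \<longleftrightarrow>
     cvs.subspace W \<and> (\<forall>g. act M g ` W \<subseteq> W) \<and> (\<forall>p. hom_part (gr M) p ` W \<subseteq> W)"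

definition CH_simple :: "nat \<Rightarrow> ('v::complex_vspace) smodule \<Rightarrow> bool" where
  "CH_simple l M \<longleftrightarrow>
     CH_object l M \<and> (UNIV :: 'v set) \<noteq> {0} \<and> (\<forall>W. submodule M W \<longrightarrow> W = {0} \<or> W = UNIV)"

text \<open>
  \<open>M\<close> is (a model of) \<open>V\<^sub>\<mu>\<close>, which is determined up to isomorphism.
\<close>

definition is_V :: "nat \<Rightarrow> complex \<times> complex \<Rightarrow> ('v::complex_vspace) smodule \<Rightarrow> bool" where
  "is_V l \<mu> M \<longleftrightarrow>
     CH_simple l M \<and>
     (\<exists>w. w \<noteq> 0 \<and> w \<in> gr M 0 \<and>
        (\<forall>W. submodule M W \<and> w \<in> W \<longrightarrow> W = UNIV) \<and>
        act M (GE N1) w = 0 \<and> act M (GE N2) w = 0 \<and>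
        act M (GH N1) w = fst \<mu> *\<^sub>C w \<and> act M (GH N2) w = snd \<mu> *\<^sub>C w)"

definition typical :: "nat \<Rightarrow> ('v::complex_vspace) smodule \<Rightarrow> bool" where
  "typical l M \<longleftrightarrow> cvs.dim (UNIV :: 'v set) = 4 * l"


section \<open>Pivotal structure and partial traces\<close>

definition phi0 :: "nat \<Rightarrow> 'v smodule \<Rightarrow> 'v \<Rightarrow> 'v" where
  "phi0 l M = act_word M (replicate l (GKinv N1) @ replicate 2 (GKinv N2))"

definition phi0_inv :: "nat \<Rightarrow> 'v smodule \<Rightarrow> 'v \<Rightarrow> 'v" where
  "phi0_inv l M = act_word M (replicate 2 (GK N2) @ replicate l (GK N1))"

definition ev_right :: "('v::complex_vspace dual, 'v) tensor \<Rightarrow> complex" where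
  "ev_right = tensor_lift dual_apply"

definition coev_right :: "'v::complex_vspace set \<Rightarrow> complex \<Rightarrow> ('v, 'v dual) tensor" where
  "coev_right B c = c *\<^sub>C (\<Sum>b\<in>B. b \<otimes>\<^sub>C dual_basis B b)"

definition ev_left :: "nat \<Rightarrow> ('v::complex_vspace) smodule \<Rightarrow> ('v, 'v dual) tensor \<Rightarrow> complex" where
  "ev_left l M = tensor_lift (\<lambda>x \<phi>. dual_apply \<phi> (phi0 l M (parity_twist (gr M) 1 x)))"

definition coev_left ::
  "nat \<Rightarrow> ('v::complex_vspace) smodule \<Rightarrow> 'v set \<Rightarrow> complex \<Rightarrow> ('v dual, 'v) tensor" where
  "coev_left l M B c = c *\<^sub>C (\<Sum>b\<in>B. dual_basis B b \<otimes>\<^sub>C phi0_inv l M (parity_twist (gr M) 1 b))"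

lemma clinear_act_word: "UH_module l M \<Longrightarrow> clinear (act_word M w)"
  by (induction w) (simp_all add: act_word_def UH_module_def clinear_iff)

lemma ev_right_pure: "ev_right (\<phi> \<otimes>\<^sub>C x) = dual_apply \<phi> x"
proof -
  have "cbilinear (dual_apply :: 'a dual \<Rightarrow> 'a \<Rightarrow> complex)"
    using dual_apply by (auto simp: cbilinear_def clinear_iff plus_dual.rep_eq scaleC_dual.rep_eq)
  from tensor_lift_pure[OF this] show ?thesis for x :: 'a and \<phi>
    by (simp add: ev_right_def)
qed

lemma ev_left_pure:
  assumes "UH_module l M" "x \<in> gr M p"
  shows "ev_left l M (x \<otimes>\<^sub>C \<phi>) = koszul_sign p * dual_apply \<phi> (phi0 l M x)"
proof -
  have G: "grading (gr M)" using assms by (simp add: UH_module_def)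
  have lin: "clinear (phi0 l M)" unfolding phi0_def by (rule clinear_act_word[OF assms(1)])
  have d: "clinear (dual_apply \<phi>)" for \<phi> :: "'a dual" using dual_apply[of \<phi>] by simp
  have "cbilinear (\<lambda>x \<phi>. dual_apply \<phi> (phi0 l M (parity_twist (gr M) 1 x)))"
    using clinear_parity_twist[OF G, of 1] lin d
    by (simp add: cbilinear_def clinear_iff plus_dual.rep_eq scaleC_dual.rep_eq)
  from tensor_lift_pure[OF this] show ?thesis
    using lin d by (simp add: ev_left_def parity_twist_homogeneous[OF G assms(2)] clinear_iff)
qed

definition ptr_R ::
  "nat \<Rightarrow> ('v::complex_vspace) smodule \<Rightarrow> 'v set \<Rightarrow> (('v, 'v) tensor \<Rightarrow> ('v, 'v) tensor) \<Rightarrow> 'v \<Rightarrow> 'v" where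
  "ptr_R l M B f = tensor_runit \<circ> tensor_map id (ev_left l M) \<circ> tensor_assoc
     \<circ> tensor_map f id \<circ> tensor_assoc_inv \<circ> tensor_map id (coev_right B) \<circ> tensor_runit_inv"

definition ptr_L ::
  "nat \<Rightarrow> ('v::complex_vspace) smodule \<Rightarrow> 'v set \<Rightarrow> (('v, 'v) tensor \<Rightarrow> ('v, 'v) tensor) \<Rightarrow> 'v \<Rightarrow> 'v" where
  "ptr_L l M B f = tensor_lunit \<circ> tensor_map ev_right id \<circ> tensor_assoc_inv
     \<circ> tensor_map id f \<circ> tensor_assoc \<circ> tensor_map (coev_left l M B) id \<circ> tensor_lunit_inv"

text \<open>The partial traces do not depend on the homogeneous basis; the condition is imposed for each one.\<close>

definition ambidextrous :: "nat \<Rightarrow> ('v::complex_vspace) smodule \<Rightarrow> bool" where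
  "ambidextrous l M \<longleftrightarrow>
     CH_simple l M \<and>
     (\<forall>B. homogeneous_basis (gr M) B \<longrightarrow>
        (\<forall>f \<in> CH_hom (tensor_module M M) (tensor_module M M). ptr_L l M B f = ptr_R l M B f))"

end

theory Submission
  imports Defs
begin

text \<open>
  Let \<open>w\<close> and \<open>u\<close> be a highest and a lowest weight vector of \<open>V\<close>, with dual functionals \<open>\<omega>\<close> and
  \<open>\<upsilon>\<close> vanishing on the other weight spaces. Both partial traces of \<open>f\<close> are the scalar
  \<open>\<gamma> = (\<upsilon> \<otimes> \<omega>) (f (w \<otimes> u))\<close>. Indeed, if \<open>x\<close> has top degree in the positive part and
  \<open>x u = w\<close>, then \<open>x (u \<otimes> \<omega>)\<close> is invariant under the positive part and of weight \<open>0\<close>, so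
  it is the coevaluation. As \<open>w\<close> is killed by the positive part, \<open>w \<otimes> x (u \<otimes> \<omega>)\<close> is a
  multiple of \<open>x (w \<otimes> u \<otimes> \<omega>)\<close>, and \<open>x\<close> can be pulled through \<open>f\<close> and the evaluation: the right
  partial trace maps \<open>w\<close> to a multiple of \<open>x\<close> applied to the contraction of \<open>f (w \<otimes> u)\<close> with \<open>\<omega>\<close>,
  that is to \<open>\<gamma> w\<close>; the factor is \<open>1\<close> because \<open>\<phi>\<^sub>0 = k\<^sub>1\<^bsup>-l\<^esup> k\<^sub>2\<^bsup>-2\<^esup>\<close> matches the degree
  \<open>(l, 2)\<close> of \<open>x\<close>. The left partial trace is treated in the same way with the negative part.
\<close>

section \<open>Complex algebras and algebras of endomorphisms\<close>

text \<open>Typicality enters once: dimension \<open>4 * l\<close> forces the top PBW monomial of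
  the negative part, of degree (l, 2), not to kill \<open>w\<close>. Hence \<open>u\<close> lies
  exactly that degree below \<open>w\<close>, and simplicity brings \<open>w\<close> back as a
  combination of words of degree (l, 2) applied to \<open>u\<close>. The invariance of x (u
  \<otimes> \<omega>) holds because the positive part acts on End(V) by operators satisfying the
  same Serre and nilpotency relations, so every word of degree beyond (l, 2) acts by zero. The
  delicate relation is the vanishing of the l-th power: each generator acts as a sum of two
  q-commuting operators, and the middle q-binomial coefficients vanish at a root of unity. An
  invariant of weight 0 commutes with the positive part and with the h; since the weight space of
  \<open>u\<close> is a line and \<open>u\<close> generates V, it is a scalar, and its value at
  \<open>w\<close> makes it the identity. To stay within ordinary algebras, the parity operator is
  merged into the group-like elements, so that odd generators obey plain commutation rules with a
  sign in \<open>qtwist\<close>.\<close>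

class complex_alg = complex_vspace + ring + monoid_mult +
  assumes scaleC_mult_left: "(c *\<^sub>C x) * y = c *\<^sub>C (x * y)"
    and scaleC_mult_right: "x * (c *\<^sub>C y) = c *\<^sub>C (x * y)"

lemmas scaleC_mult = scaleC_mult_left scaleC_mult_right scaleC_scaleC

text \<open>Bundling linear maps into a type gives an instance of \<open>complex_alg\<close>, so the
  lemmas on relations and powers below apply to operators on V and again, through
  \<open>'v cend cend\<close>, to operators on End(V).\<close>

typedef (overloaded) 'a cend = "{f :: 'a::complex_vspace \<Rightarrow> 'a. clinear f}"
  morphisms cend_apply Cend
  by (rule exI[of _ "\<lambda>_. 0"]) (simp add: clinear_iff)

notation cend_apply (infixr "\<bullet>" 72)

setup_lifting type_definition_cend

instantiation cend :: (complex_vspace) complex_alg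
begin
lift_definition zero_cend :: "'a cend" is "\<lambda>_. 0" by (simp add: clinear_iff)
lift_definition one_cend :: "'a cend" is "\<lambda>x. x" by (simp add: clinear_iff)
lift_definition plus_cend :: "'a cend \<Rightarrow> 'a cend \<Rightarrow> 'a cend" is "\<lambda>f g x. f x + g x"
  by (simp add: clinear_iff scaleC_add_right)
lift_definition minus_cend :: "'a cend \<Rightarrow> 'a cend \<Rightarrow> 'a cend" is "\<lambda>f g x. f x - g x"
  by (simp add: clinear_iff cvs.scale_right_diff_distrib)
lift_definition uminus_cend :: "'a cend \<Rightarrow> 'a cend" is "\<lambda>f x. - f x"
  by (simp add: clinear_iff)
lift_definition times_cend :: "'a cend \<Rightarrow> 'a cend \<Rightarrow> 'a cend" is "\<lambda>f g x. f (g x)"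
  by (simp add: clinear_iff)
lift_definition scaleC_cend :: "complex \<Rightarrow> 'a cend \<Rightarrow> 'a cend" is "\<lambda>c f x. c *\<^sub>C f x"
  by (simp add: clinear_iff scaleC_add_right scaleC_scaleC mult.commute)
instance
  by standard
    (transfer; simp add: clinear_iff fun_eq_iff scaleC_add_right scaleC_add_left scaleC_scaleC scaleC_one)+
end

lemma clinear_cend_apply: "clinear (cend_apply A)"
  using cend_apply[of A] by simp

lemma cend_eqI: "(\<And>x. A \<bullet> x = B \<bullet> x) \<Longrightarrow> A = B"
  by (simp add: cend_apply_inject[symmetric] fun_eq_iff)

lemma Cend_apply: "clinear f \<Longrightarrow> Cend f \<bullet> x = f x"
  by (simp add: Cend_inverse)

lemma cend_simps [simp]:
  "(A + B) \<bullet> x = A \<bullet> x + B \<bullet> x" "(A - B) \<bullet> x = A \<bullet> x - B \<bullet> x" "(- A) \<bullet> x = - (A \<bullet> x)"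
  "(c *\<^sub>C A) \<bullet> x = c *\<^sub>C (A \<bullet> x)" "(A * B) \<bullet> x = A \<bullet> B \<bullet> x" "1 \<bullet> x = x" "0 \<bullet> x = 0"
  by (transfer; simp)+

lemma cend_apply_simps [simp]:
  "A \<bullet> (x + y) = A \<bullet> x + A \<bullet> y" "A \<bullet> (x - y) = A \<bullet> x - A \<bullet> y" "A \<bullet> (- x) = - (A \<bullet> x)"
  "A \<bullet> (c *\<^sub>C x) = c *\<^sub>C (A \<bullet> x)" "A \<bullet> 0 = 0"
  using clinear_cend_apply[of A]
  by (simp_all add: cvs_pair.linear_add cvs_pair.linear_diff cvs_pair.linear_neg
      cvs_pair.linear_scale cvs_pair.linear_0)

lemma cend_apply_sum: "A \<bullet> (\<Sum>i\<in>I. g i) = (\<Sum>i\<in>I. A \<bullet> g i)"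
  by (rule cvs_pair.linear_sum[OF clinear_cend_apply])

lift_definition lmul :: "'a::complex_alg \<Rightarrow> 'a cend" is "\<lambda>a x. a * x"
  by (simp add: clinear_iff algebra_simps scaleC_mult)

lift_definition rmul :: "'a::complex_alg \<Rightarrow> 'a cend" is "\<lambda>a x. x * a"
  by (simp add: clinear_iff algebra_simps scaleC_mult)

lemma lmul_apply [simp]: "lmul a \<bullet> x = a * x" and rmul_apply [simp]: "rmul a \<bullet> x = x * a"
  by (transfer; simp)+

section \<open>The \<open>q\<close>-binomial theorem at a root of unity\<close>

text \<open>The Gaussian binomial by its Pascal recursion; the usual quotient formula has zero
  denominators at a root of unity.\<close>

fun qbinom :: "complex \<Rightarrow> nat \<Rightarrow> nat \<Rightarrow> complex" where
  "qbinom z n 0 = 1"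
| "qbinom z 0 (Suc k) = 0"
| "qbinom z (Suc n) (Suc k) = qbinom z n k + z ^ Suc k * qbinom z n (Suc k)"

lemma qbinom_eq_0: "n < k \<Longrightarrow> qbinom z n k = 0"
  by (induction z n k rule: qbinom.induct) auto

lemma qbinom_self: "qbinom z n n = 1"
  by (induction n) (auto simp: qbinom_eq_0)

text \<open>Replaces the quotient formula: at \<open>z ^ Suc n = 1\<close> the right side vanishes,
  which kills the coefficient on the left as long as \<open>1 - z ^ Suc k\<close> is
  nonzero.\<close>

lemma qbinom_absorb: "(1 - z ^ Suc k) * qbinom z (Suc n) (Suc k) = (1 - z ^ Suc n) * qbinom z n k"
proof (induction n arbitrary: k)
  case 0
  then show ?case by (cases k) auto
next
  case (Suc n)
  show ?case
  proof (cases k)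
    case 0
    have "(1 - z) * (1 + z * qbinom z (Suc n) 1) = (1 - z) + z * (1 - z ^ Suc n)"
      using Suc.IH[of 0] by (simp add: distrib_left mult.left_commute del: qbinom.simps(3))
    then show ?thesis using 0 by (simp add: algebra_simps del: qbinom.simps(3))
      (simp add: algebra_simps)?
  next
    case (Suc j)
    have "(1 - z ^ Suc k) * qbinom z (Suc (Suc n)) (Suc k)
        = (1 - z ^ Suc k) * qbinom z (Suc n) k + z ^ Suc k * ((1 - z ^ Suc k) * qbinom z (Suc n) (Suc k))"
      by (simp add: algebra_simps)
    also have "\<dots> = (1 - z ^ Suc k) * qbinom z (Suc n) k + z ^ Suc k * ((1 - z ^ Suc n) * qbinom z n k)"
      by (simp only: Suc.IH)
    also have "\<dots> = (1 - z ^ Suc k) * qbinom z (Suc n) k + z * (z ^ k * ((1 - z ^ Suc n) * qbinom z n k))"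
      by simp
    also have "\<dots> = (1 - z) * qbinom z (Suc n) k + z * ((1 - z ^ k) * qbinom z (Suc n) k)
        + z * (z ^ k * ((1 - z ^ Suc n) * qbinom z n k))"
      by (simp add: left_diff_distrib right_diff_distrib)
    also have "(1 - z ^ k) * qbinom z (Suc n) k = (1 - z ^ Suc n) * qbinom z n j"
      using Suc.IH[of j] Suc by simp
    also have "(1 - z) * qbinom z (Suc n) k + z * ((1 - z ^ Suc n) * qbinom z n j)
        + z * (z ^ k * ((1 - z ^ Suc n) * qbinom z n k))
        = (1 - z ^ Suc (Suc n)) * qbinom z (Suc n) k"
      by (simp add: Suc algebra_simps)
    finally show ?thesis .
  qed
qed

lemma qbinom_root_of_unity:
  assumes "z ^ n = 1" "\<And>j. 0 < j \<Longrightarrow> j < n \<Longrightarrow> z ^ j \<noteq> 1" "0 < k" "k < n"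
  shows "qbinom z n k = 0"
  using qbinom_absorb[of z "k - 1" "n - 1"] assms by auto

lemma power_qcommute:
  fixes X Y :: "'a::complex_alg"
  assumes "Y * X = z *\<^sub>C (X * Y)"
  shows "Y * X ^ n = z ^ n *\<^sub>C (X ^ n * Y)"
proof (induction n)
  case (Suc n)
  have "Y * X ^ Suc n = z *\<^sub>C (X * (Y * X ^ n))"
    by (simp add: assms scaleC_mult mult.assoc flip: mult.assoc[of Y])
  then show ?case by (simp add: Suc scaleC_mult mult.assoc)
qed (simp add: scaleC_one)

lemma qbinomial:
  fixes X Y :: "'a::complex_alg"
  assumes "Y * X = z *\<^sub>C (X * Y)"
  shows "(X + Y) ^ n = (\<Sum>k\<le>n. qbinom z n k *\<^sub>C (X ^ k * Y ^ (n - k)))"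
proof (induction n)
  case (Suc n)
  have Y: "Y * (X ^ k * Y ^ (n - k)) = z ^ k *\<^sub>C (X ^ k * Y ^ (Suc n - k))" if "k \<le> n" for k
    using that
    by (simp add: Suc_diff_le scaleC_mult power_qcommute[OF assms] flip: mult.assoc)
  have "(X + Y) ^ Suc n = (\<Sum>k\<le>n. qbinom z n k *\<^sub>C (X ^ Suc k * Y ^ (n - k)))
      + (\<Sum>k\<le>n. (z ^ k * qbinom z n k) *\<^sub>C (X ^ k * Y ^ (Suc n - k)))"
  proof -
    have "(X + Y) ^ Suc n = (\<Sum>k\<le>n. qbinom z n k *\<^sub>C (X * (X ^ k * Y ^ (n - k)) + Y * (X ^ k * Y ^ (n - k))))"
      by (simp add: Suc sum_distrib_left scaleC_mult distrib_right)
    also have "\<dots> = (\<Sum>k\<le>n. qbinom z n k *\<^sub>C (X ^ Suc k * Y ^ (n - k))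
        + (z ^ k * qbinom z n k) *\<^sub>C (X ^ k * Y ^ (Suc n - k)))"
      by (rule sum.cong) (simp_all add: Y scaleC_add_right scaleC_scaleC mult.assoc mult.commute[of "qbinom z n _"])
    finally show ?thesis by (simp only: sum.distrib)
  qed
  also have "(\<Sum>k\<le>n. (z ^ k * qbinom z n k) *\<^sub>C (X ^ k * Y ^ (Suc n - k)))
      = (\<Sum>k\<le>Suc n. (z ^ k * qbinom z n k) *\<^sub>C (X ^ k * Y ^ (Suc n - k)))"
    by (simp add: qbinom_eq_0)
  also have "\<dots> = Y ^ Suc n + (\<Sum>k\<le>n. (z ^ Suc k * qbinom z n (Suc k)) *\<^sub>C (X ^ Suc k * Y ^ (n - k)))"
    by (subst sum.atMost_Suc_shift) (simp add: scaleC_one)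
  finally have "(X + Y) ^ Suc n = Y ^ Suc n + (\<Sum>k\<le>n. qbinom z (Suc n) (Suc k) *\<^sub>C (X ^ Suc k * Y ^ (n - k)))"
    by (simp add: sum.distrib scaleC_add_left algebra_simps)
  then show ?case by (subst sum.atMost_Suc_shift) (simp add: scaleC_one)
qed (simp add: scaleC_one)

text \<open>All middle coefficients vanish, as in the binomial formula in prime characteristic. This
  makes nilpotency of order \<open>l\<close> survive for a sum of two q-commuting operators.\<close>

lemma power_add_root_of_unity:
  fixes X Y :: "'a::complex_alg"
  assumes "Y * X = z *\<^sub>C (X * Y)" "z ^ n = 1" "\<And>j. 0 < j \<Longrightarrow> j < n \<Longrightarrow> z ^ j \<noteq> 1" "0 < n"
  shows "(X + Y) ^ n = X ^ n + Y ^ n"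
proof -
  have "(X + Y) ^ n = (\<Sum>k\<in>{0, n}. qbinom z n k *\<^sub>C (X ^ k * Y ^ (n - k)))"
    unfolding qbinomial[OF assms(1)]
    by (rule sum.mono_neutral_right) (auto simp: qbinom_root_of_unity[OF assms(2,3)])
  then show ?thesis using assms(4) by (simp add: qbinom_self scaleC_one add.commute)
qed

section \<open>The positive part of the quantum group\<close>

definition word :: "(node \<Rightarrow> 'a::complex_alg) \<Rightarrow> node list \<Rightarrow> 'a" where
  "word E ns = prod_list (map E ns)"

lemma word_simps [simp]: "word E [] = 1" "word E (n # ns) = E n * word E ns"
  by (simp_all add: word_def)

definition nilpotent_serre :: "complex \<Rightarrow> nat \<Rightarrow> (node \<Rightarrow> 'a::complex_alg) \<Rightarrow> bool" where
  "nilpotent_serre q l E \<longleftrightarrow> E N1 ^ l = 0 \<and> E N2 * E N2 = 0 \<and>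
     E N1 * E N1 * E N2 - (q + inverse q) *\<^sub>C (E N1 * E N2 * E N1) + E N2 * E N1 * E N1 = 0"

text \<open>The q-commutator that represents the non-simple positive root. This choice of scalar
  turns the Serre relation into the rule \<open>e1_e3\<close>.\<close>

definition root_e3 :: "complex \<Rightarrow> (node \<Rightarrow> 'a::complex_alg) \<Rightarrow> 'a" where
  "root_e3 q E = E N1 * E N2 - q *\<^sub>C (E N2 * E N1)"

definition pbw :: "complex \<Rightarrow> (node \<Rightarrow> 'a::complex_alg) \<Rightarrow> nat \<Rightarrow> nat \<Rightarrow> nat \<Rightarrow> 'a" where
  "pbw q E a b i = E N2 ^ a * root_e3 q E ^ b * E N1 ^ i"

definition pbw_set :: "complex \<Rightarrow> (node \<Rightarrow> 'a::complex_alg) \<Rightarrow> nat \<Rightarrow> nat \<Rightarrow> 'a set" where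
  "pbw_set q E n2 n1 = {pbw q E a b i | a b i. a + b = n2 \<and> b + i = n1}"

lemma pbw_setI: "a + b = n2 \<Longrightarrow> b + i = n1 \<Longrightarrow> pbw q E a b i \<in> pbw_set q E n2 n1"
  unfolding pbw_set_def by blast

context
  fixes q :: complex and l :: nat and E :: "node \<Rightarrow> 'a::complex_alg"
  assumes E: "nilpotent_serre q l E" and q: "q \<noteq> 0" "q + inverse q \<noteq> 0"
begin

lemma E2_sq: "E N2 * E N2 = 0" and E1_l: "E N1 ^ l = 0"
  using E by (auto simp: nilpotent_serre_def)

lemma serre: "E N1 * E N1 * E N2 = (q + inverse q) *\<^sub>C (E N1 * E N2 * E N1) - E N2 * E N1 * E N1"
  using E by (simp add: nilpotent_serre_def algebra_simps)

lemma e1_e3: "E N1 * root_e3 q E = inverse q *\<^sub>C (root_e3 q E * E N1)"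
proof -
  have "E N1 * root_e3 q E = E N1 * E N1 * E N2 - q *\<^sub>C (E N1 * E N2 * E N1)"
    by (simp add: root_e3_def algebra_simps scaleC_mult)
  also have "\<dots> = inverse q *\<^sub>C (E N1 * E N2 * E N1) - E N2 * E N1 * E N1"
    by (simp add: serre scaleC_add_left)
  finally show ?thesis using q
    by (simp add: root_e3_def algebra_simps scaleC_mult cvs.scale_right_diff_distrib scaleC_one)
qed

text \<open>Multiplying the Serre relation by \<open>E N2\<close> from either side expresses the
  same element in two ways; as \<open>q + inverse q\<close> is nonzero, the words 2121 and 1212
  coincide. The square is then the multiple 1 - q (q + 1/q) + q^2 = 0 of that word.\<close>

lemma e3_sq: "root_e3 q E * root_e3 q E = 0"
proof -
  let ?a = "E N1" and ?b = "E N2"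
  have b0: "?b * (?b * x) = 0" for x using E2_sq by (simp flip: mult.assoc)
  have "?b * (?a * (?a * ?b)) = (q + inverse q) *\<^sub>C (?b * (?a * (?b * ?a)))"
    using arg_cong[OF serre, of "\<lambda>x. ?b * x"] by (simp add: algebra_simps scaleC_mult b0)
  moreover have "?b * (?a * (?a * ?b)) = (q + inverse q) *\<^sub>C (?a * (?b * (?a * ?b)))"
    using arg_cong[OF serre, of "\<lambda>x. x * ?b"]
    by (simp add: algebra_simps scaleC_mult E2_sq)
  ultimately have *: "?b * (?a * (?b * ?a)) = ?a * (?b * (?a * ?b))"
    "?b * (?a * (?a * ?b)) = (q + inverse q) *\<^sub>C (?a * (?b * (?a * ?b)))"
    using cvs.scale_left_imp_eq[OF q(2)] by metis+
  let ?x = "?a * (?b * (?a * ?b))"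
  have "root_e3 q E * root_e3 q E = ?x - q *\<^sub>C (q + inverse q) *\<^sub>C ?x + q *\<^sub>C q *\<^sub>C ?x"
    using b0 E2_sq by (simp add: root_e3_def left_diff_distrib right_diff_distrib mult.assoc
        scaleC_mult_left scaleC_mult_right * cvs.scale_right_diff_distrib)
  also have "\<dots> = (1 - q * (q + inverse q) + q * q) *\<^sub>C ?x"
    by (simp only: scaleC_add_left scaleC_one cvs.scale_left_diff_distrib flip: scaleC_scaleC)
  also have "1 - q * (q + inverse q) + q * q = 0" using q(1) by (simp add: field_simps)
  finally show ?thesis by simp
qed

lemma pbw_eq_0:
  assumes "2 \<le> a \<or> 2 \<le> b \<or> l \<le> i"
  shows "pbw q E a b i = 0"
proof -
  have p: "x ^ n = 0" if "x ^ m = 0" "m \<le> n" for x :: 'a and m n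
    using that by (metis le_add_diff_inverse mult_zero_left power_add)
  show ?thesis using assms p[of "E N2" 2 a] p[of "root_e3 q E" 2 b] p[of "E N1" l i]
    by (auto simp: pbw_def E2_sq E1_l e3_sq power2_eq_square)
qed

text \<open>Straightening rule for the letter that has to travel to the right end. The clause for
  \<open>a = 0\<close> excludes the term in which the truncated \<open>a - 1\<close> would falsify
  the degree.\<close>

lemma e1_pbw: "\<exists>c d. E N1 * pbw q E a b i = c *\<^sub>C pbw q E a b (Suc i) + d *\<^sub>C pbw q E (a - 1) (Suc b) i
    \<and> (a = 0 \<longrightarrow> d = 0)"
proof -
  have e3: "E N1 * (root_e3 q E ^ b * x) = inverse q ^ b *\<^sub>C (root_e3 q E ^ b * (E N1 * x))" for x
    using power_qcommute[OF e1_e3, of b] by (simp add: scaleC_mult flip: mult.assoc)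
  consider "a = 0" | "a = 1" | "2 \<le> a" by linarith
  then show ?thesis
  proof cases
    case 1
    have "E N1 * pbw q E a b i = inverse q ^ b *\<^sub>C pbw q E a b (Suc i) + 0 *\<^sub>C pbw q E (a - 1) (Suc b) i"
      by (simp add: 1 pbw_def e3)
    with 1 show ?thesis by blast
  next
    case 2
    have "E N1 * E N2 = root_e3 q E + q *\<^sub>C (E N2 * E N1)" by (simp add: root_e3_def)
    then have "E N1 * (E N2 * x) = root_e3 q E * x + q *\<^sub>C (E N2 * (E N1 * x))" for x
      by (metis distrib_right mult.assoc scaleC_mult_left)
    then have "E N1 * pbw q E a b i
        = (q * inverse q ^ b) *\<^sub>C pbw q E a b (Suc i) + 1 *\<^sub>C pbw q E (a - 1) (Suc b) i"
      by (simp add: 2 pbw_def e3 mult.assoc scaleC_mult_right scaleC_scaleC scaleC_one add.commute)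
    with 2 show ?thesis by (metis zero_neq_one)
  next
    case 3
    have "E N1 * pbw q E a b i = 0 *\<^sub>C pbw q E a b (Suc i) + 0 *\<^sub>C pbw q E (a - 1) (Suc b) i"
      using 3 by (simp add: pbw_eq_0)
    then show ?thesis by blast
  qed
qed

text \<open>The spanning half of a PBW theorem, kept graded: straightening preserves the number of
  letters of each kind, because \<open>root_e3\<close> counts as one letter of each.\<close>

lemma word_in_span_pbw: "word E ns \<in> cvs.span (pbw_set q E (count_list ns N2) (count_list ns N1))"
proof (induction ns)
  case Nil
  have "pbw q E 0 0 0 \<in> pbw_set q E 0 0" by (rule pbw_setI) simp_all
  then show ?case by (simp add: pbw_def cvs.span_base)
next
  case (Cons n ns)
  let ?S = "\<lambda>ns. pbw_set q E (count_list ns N2) (count_list ns N1)"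
  have "E n * x \<in> cvs.span (?S (n # ns))" if "x \<in> ?S ns" for x
  proof -
    obtain a b i where x: "x = pbw q E a b i" "a + b = count_list ns N2" "b + i = count_list ns N1"
      using \<open>x \<in> ?S ns\<close> by (auto simp: pbw_set_def)
    show ?thesis
    proof (cases n)
      case N1
      obtain c d where cd: "E N1 * x = c *\<^sub>C pbw q E a b (Suc i) + d *\<^sub>C pbw q E (a - 1) (Suc b) i"
        "a = 0 \<longrightarrow> d = 0" using e1_pbw unfolding x by blast
      have 1: "pbw q E a b (Suc i) \<in> ?S (n # ns)" by (rule pbw_setI) (simp_all add: x N1)
      have 2: "pbw q E (a - 1) (Suc b) i \<in> ?S (n # ns)" if "a \<noteq> 0"
        by (rule pbw_setI) (use that x N1 in simp_all)
      have "d *\<^sub>C pbw q E (a - 1) (Suc b) i \<in> cvs.span (?S (n # ns))"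
        using 2 cd(2) by (cases "a = 0") (simp_all add: cvs.span_zero cvs.span_scale cvs.span_base)
      then show ?thesis unfolding N1 cd(1) using 1
        by (simp add: N1 cvs.span_add cvs.span_scale cvs.span_base)
    next
      case N2
      have "E n * x = pbw q E (Suc a) b i" by (simp add: N2 x pbw_def mult.assoc)
      moreover have "pbw q E (Suc a) b i \<in> ?S (n # ns)" by (rule pbw_setI) (simp_all add: x N2)
      ultimately show ?thesis by (simp add: cvs.span_base)
    qed
  qed
  note * = this
  have "E n * x \<in> cvs.span (?S (n # ns))" if "x \<in> cvs.span (?S ns)" for x
    using that
  proof (induction rule: cvs.span_induct_alt)
    case (step c x y)
    then have "c *\<^sub>C (E n * x) + E n * y \<in> cvs.span (?S (n # ns))"
      using * by (blast intro: cvs.span_add cvs.span_scale)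
    then show ?case by (simp only: distrib_left scaleC_mult_right)
  qed (simp add: cvs.span_zero)
  then show ?case using Cons by simp
qed

text \<open>A nonzero monomial has \<open>a\<close> and \<open>b\<close> at most 1 and
  \<open>i < l\<close>, hence \<open>a + b\<close> at most 2 and \<open>b + i\<close> at most
  \<open>l\<close>. The degree (l, 2) of the overview is this maximum.\<close>

lemma word_eq_0:
  assumes "2 < count_list ns N2 \<or> l < count_list ns N1"
  shows "word E ns = 0"
proof -
  have "pbw q E a b i = 0" if "a + b = count_list ns N2" "b + i = count_list ns N1" for a b i
    using that assms by (intro pbw_eq_0) linarith
  then have "pbw_set q E (count_list ns N2) (count_list ns N1) \<subseteq> {0}"
    unfolding pbw_set_def by blast
  from cvs.span_mono[OF this] word_in_span_pbw[of ns] show ?thesis by auto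
qed

end

section \<open>The twisted adjoint action\<close>

text \<open>The scalar q^(-a_ij) picked up when the group-like element of node i passes the
  generator of node j, with an extra sign when both are odd.\<close>

fun qtwist :: "complex \<Rightarrow> node \<Rightarrow> node \<Rightarrow> complex" where
  "qtwist q N1 N1 = inverse q * inverse q"
| "qtwist q N2 N2 = - 1"
| "qtwist q _ _ = q"

text \<open>The pattern of a coproduct: \<open>X\<close> and \<open>Y\<close> stand for E \<otimes>
  1 and S \<otimes> E. The cross terms cancel in the Serre relation, the mixed terms of the odd
  square anticommute away, and the power of order \<open>l\<close> is handled by
  \<open>power_add_root_of_unity\<close> at q^(-2).\<close>

lemma nilpotent_serre_add:
  fixes X Y :: "node \<Rightarrow> 'a::complex_alg"
  assumes X: "nilpotent_serre q l X" and Y: "nilpotent_serre q l Y"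
    and YX: "\<And>i j. Y i * X j = qtwist q i j *\<^sub>C (X j * Y i)"
    and q: "q \<noteq> 0" "q ^ l = 1" "\<And>j. 0 < j \<Longrightarrow> j < l \<Longrightarrow> (q * q) ^ j \<noteq> 1" "0 < l"
  shows "nilpotent_serre q l (\<lambda>i. X i + Y i)"
proof -
  define r where "r = inverse q"
  have qr: "q * r = 1" "r * q = 1" "q * (r * z) = z" "r * (q * z) = z" for z
    using q(1) by (simp_all add: r_def)
  have YX': "Y i * (X j * z) = qtwist q i j *\<^sub>C (X j * (Y i * z))" for i j z
    using YX[of i j] by (metis mult.assoc scaleC_mult_left)
  have "(X N1 + Y N1) ^ l = X N1 ^ l + Y N1 ^ l"
  proof (rule power_add_root_of_unity[OF YX _ _ q(4)])
    show "qtwist q N1 N1 ^ l = 1" using q(2) by (simp add: power_mult_distrib power_inverse)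
    show "qtwist q N1 N1 ^ j \<noteq> 1" if "0 < j" "j < l" for j
      using q(3)[OF that] by (simp add: power_mult_distrib power_inverse field_simps)
  qed
  moreover have "(X N2 + Y N2) * (X N2 + Y N2) = X N2 * X N2 + Y N2 * Y N2"
    by (simp add: algebra_simps YX scaleC_one)
  moreover have "(X N1 + Y N1) * (X N1 + Y N1) * (X N2 + Y N2)
      - (q + inverse q) *\<^sub>C ((X N1 + Y N1) * (X N2 + Y N2) * (X N1 + Y N1))
      + (X N2 + Y N2) * (X N1 + Y N1) * (X N1 + Y N1)
    = (X N1 * X N1 * X N2 - (q + inverse q) *\<^sub>C (X N1 * X N2 * X N1) + X N2 * X N1 * X N1)
    + (Y N1 * Y N1 * Y N2 - (q + inverse q) *\<^sub>C (Y N1 * Y N2 * Y N1) + Y N2 * Y N1 * Y N1)"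
    unfolding r_def[symmetric]
    by (simp add: distrib_left distrib_right mult.assoc YX YX' scaleC_mult scaleC_add_left
        scaleC_add_right qr flip: r_def)
  ultimately show ?thesis using X Y by (simp add: nilpotent_serre_def)
qed

text \<open>The adjoint action on End(V), identified with V tensored with its dual, for the
  coproduct e \<otimes> 1 + s \<otimes> e and the antipode \<open>- s' * e\<close>.\<close>

definition twisted_ad :: "'a::complex_alg \<Rightarrow> 'a \<Rightarrow> 'a \<Rightarrow> 'a cend" where
  "twisted_ad e s s' = lmul e - lmul s * rmul (s' * e)"

lemma twisted_ad_apply: "twisted_ad e s s' \<bullet> a = e * a - s * a * s' * e"
  by (simp add: twisted_ad_def mult.assoc)

text \<open>The adjoint action splits into left multiplication \<open>X\<close> and the conjugating
  part \<open>Y\<close>. Each satisfies the relations, and the two q-commute because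
  \<open>S i\<close> and \<open>E j\<close> do.\<close>

lemma nilpotent_serre_twisted_ad:
  fixes E S S' :: "node \<Rightarrow> 'a::complex_alg"
  assumes E: "nilpotent_serre q l E"
    and S: "\<And>i. S i * S' i = 1" "\<And>i. S' i * S i = 1" "S N1 * S N2 = S N2 * S N1"
    and SE: "\<And>i j. S i * E j = qtwist q i j *\<^sub>C (E j * S i)"
    and q: "q \<noteq> 0" "q ^ l = 1" "\<And>j. 0 < j \<Longrightarrow> j < l \<Longrightarrow> (q * q) ^ j \<noteq> 1" "0 < l"
  shows "nilpotent_serre q l (\<lambda>i. twisted_ad (E i) (S i) (S' i))"
proof -
  define D where "D i = S' i * E i" for i
  define X where "X i = lmul (E i)" for i
  define Y where "Y i = - (lmul (S i) * rmul (D i))" for i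
  have S1: "S i * (S' i * z) = z" "S' i * (S i * z) = z" for i z
    using S(1,2)[of i] by (metis mult.assoc mult_1_left)+
  have ES: "E j * S' i = qtwist q i j *\<^sub>C (S' i * E j)" for i j
  proof -
    have "E j * S' i = S' i * (S i * E j) * S' i" by (simp add: S S1 flip: mult.assoc)
    also have "\<dots> = qtwist q i j *\<^sub>C (S' i * E j)" by (simp add: SE scaleC_mult mult.assoc S)
    finally show ?thesis .
  qed
  then have ES': "E j * (S' i * z) = qtwist q i j *\<^sub>C (S' i * (E j * z))" for i j z
    by (metis mult.assoc scaleC_mult_left)
  have S'S': "S' N2 * S' N1 = S' N1 * S' N2"
  proof -
    have "S' N2 * S' N1 = S' N2 * S' N1 * (S N2 * S N1) * S' N1 * S' N2"
      by (simp add: S(1,2) S1 mult.assoc)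
    also have "\<dots> = S' N1 * S' N2"
      by (subst S(3)[symmetric]) (simp add: S(1,2) S1 mult.assoc)
    finally show ?thesis .
  qed
  have S'S'': "S' N2 * (S' N1 * z) = S' N1 * (S' N2 * z)" for z
    using S'S' by (metis mult.assoc)
  have SS: "S N2 * (S N1 * z) = S N1 * (S N2 * z)" for z
    using S(3) by (metis mult.assoc)
  have qq: "q * inverse q = 1" "inverse q * q = 1" "q * (inverse q * z) = z" "inverse q * (q * z) = z" for z
    using q(1) by simp_all
  have "D N2 * D N2 = 0"
    using E by (simp add: D_def mult.assoc ES' scaleC_mult nilpotent_serre_def)
  then have Y2: "Y N2 * Y N2 = 0"
    by (intro cend_eqI) (simp add: Y_def mult.assoc)
  have D1: "\<exists>c. D N1 ^ n = c *\<^sub>C (S' N1 ^ n * E N1 ^ n)" for n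
  proof (induction n)
    case (Suc n)
    then obtain c where c: "D N1 ^ n = c *\<^sub>C (S' N1 ^ n * E N1 ^ n)" by blast
    have "E N1 * (S' N1 ^ n * z) = qtwist q N1 N1 ^ n *\<^sub>C (S' N1 ^ n * (E N1 * z))" for z
      using power_qcommute[OF ES[of N1 N1], of n] by (metis mult.assoc scaleC_mult_left)
    then have "D N1 ^ Suc n = (c * qtwist q N1 N1 ^ n) *\<^sub>C (S' N1 ^ Suc n * E N1 ^ Suc n)"
      by (simp add: c scaleC_mult) (simp add: D_def scaleC_mult mult.assoc power_commutes)
    then show ?case by blast
  qed (metis mult_1_right power_0 scaleC_one)
  have "Y N1 ^ n \<bullet> a = (- 1) ^ n *\<^sub>C (S N1 ^ n * a * D N1 ^ n)" for n a
  proof (induction n)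
    case (Suc n)
    then show ?case by (simp add: Y_def mult.assoc scaleC_mult power_commutes)
  qed (simp add: scaleC_one)
  then have Y1: "Y N1 ^ l = 0"
    using D1[of l] E by (intro cend_eqI) (auto simp: nilpotent_serre_def)
  let ?s = "S' N1 * (S' N1 * S' N2)"
  \<comment> \<open>Moving the three \<open>S'\<close> to the left produces the scalars q^(-2), q
    and q in each of the words, with product 1, so all three share the prefactor
    \<open>?s\<close>.\<close>
  have D3: "D N1 * (D N1 * D N2) = ?s * (E N1 * (E N1 * E N2))"
    "D N1 * (D N2 * D N1) = ?s * (E N1 * (E N2 * E N1))"
    "D N2 * (D N1 * D N1) = ?s * (E N2 * (E N1 * E N1))"
    by (simp_all add: D_def mult.assoc ES ES' scaleC_mult S'S'' S'S' qq scaleC_one)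
  \<comment> \<open>Right multiplication reverses words, but the Serre relation reads the same
    backwards.\<close>
  have "Y N1 * Y N1 * Y N2 - (q + inverse q) *\<^sub>C (Y N1 * Y N2 * Y N1) + Y N2 * Y N1 * Y N1 = 0"
  proof (rule cend_eqI)
    fix a
    have "(Y N1 * Y N1 * Y N2 - (q + inverse q) *\<^sub>C (Y N1 * Y N2 * Y N1) + Y N2 * Y N1 * Y N1) \<bullet> a
      = - (S N1 * (S N1 * (S N2 * (a * (?s * (E N1 * E N1 * E N2
         - (q + inverse q) *\<^sub>C (E N1 * E N2 * E N1) + E N2 * E N1 * E N1))))))"
      by (simp add: Y_def mult.assoc SS S(3) D3 algebra_simps scaleC_mult)
    also have "\<dots> = 0" using E by (simp add: nilpotent_serre_def)
    finally show "(Y N1 * Y N1 * Y N2 - (q + inverse q) *\<^sub>C (Y N1 * Y N2 * Y N1) + Y N2 * Y N1 * Y N1) \<bullet> a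
      = 0 \<bullet> a" by simp
  qed
  with Y1 Y2 have Y: "nilpotent_serre q l Y" by (simp add: nilpotent_serre_def)
  have X1: "X N1 ^ n \<bullet> a = E N1 ^ n * a" for n a
    by (induction n arbitrary: a) (simp_all add: X_def mult.assoc)
  have "X N1 * X N1 * X N2 - (q + inverse q) *\<^sub>C (X N1 * X N2 * X N1) + X N2 * X N1 * X N1 = 0"
  proof (rule cend_eqI)
    fix a
    have "(X N1 * X N1 * X N2 - (q + inverse q) *\<^sub>C (X N1 * X N2 * X N1) + X N2 * X N1 * X N1) \<bullet> a
      = (E N1 * E N1 * E N2 - (q + inverse q) *\<^sub>C (E N1 * E N2 * E N1) + E N2 * E N1 * E N1) * a"
      by (simp add: X_def mult.assoc algebra_simps scaleC_mult)
    also have "\<dots> = 0" using E by (simp add: nilpotent_serre_def)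
    finally show "(X N1 * X N1 * X N2 - (q + inverse q) *\<^sub>C (X N1 * X N2 * X N1) + X N2 * X N1 * X N1) \<bullet> a
      = 0 \<bullet> a" by simp
  qed
  moreover have "X N1 ^ l = 0"
    using E by (intro cend_eqI) (simp add: X1 nilpotent_serre_def)
  moreover have "X N2 * X N2 = 0"
    using E by (intro cend_eqI) (simp add: X_def nilpotent_serre_def flip: mult.assoc)
  ultimately have X: "nilpotent_serre q l X" by (simp add: nilpotent_serre_def)
  have YX: "Y i * X j = qtwist q i j *\<^sub>C (X j * Y i)" for i j
    by (rule cend_eqI) (simp add: X_def Y_def SE scaleC_mult flip: mult.assoc)
  have "(\<lambda>i. twisted_ad (E i) (S i) (S' i)) = (\<lambda>i. X i + Y i)"
    by (simp add: twisted_ad_def X_def Y_def D_def)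
  with nilpotent_serre_add[OF X Y YX q] show ?thesis by (simp only:)
qed

section \<open>Actions of a Borel half\<close>

lemma clinear_representation:
  assumes "cvs.independent B" "cvs.span B = UNIV"
  shows "clinear (\<lambda>v. cvs.representation B v b)"
  using assms by (simp add: clinear_iff cvs.representation_add cvs.representation_scale)

lemma representation_eigen:
  fixes K :: "'v::complex_vspace cend"
  assumes B: "cvs.independent B" "cvs.span B = UNIV" and K: "\<And>b. b \<in> B \<Longrightarrow> K \<bullet> b = \<kappa> b *\<^sub>C b"
    and b: "b \<in> B"
  shows "cvs.representation B (K \<bullet> v) b = \<kappa> b * cvs.representation B v b"
proof -
  note R = clinear_representation[OF B, of b]
  have "clinear (\<lambda>v. cvs.representation B (K \<bullet> v) b)"
    "clinear (\<lambda>v. \<kappa> b * cvs.representation B v b)"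
    using R by (simp_all add: clinear_iff distrib_left)
  then show ?thesis
  proof (rule cvs_pair.linear_eq_on[where B = B])
    show "v \<in> cvs.span B" by (simp add: B)
    show "cvs.representation B (K \<bullet> x) b = \<kappa> b * cvs.representation B x b" if "x \<in> B" for x
      using that b R by (auto simp: K clinear_iff cvs.representation_basis[OF B(1)])
  qed
qed

lemma cend_scalar_on_span:
  assumes "v \<in> cvs.span B" "\<And>b. b \<in> B \<Longrightarrow> T \<bullet> b = c *\<^sub>C b"
  shows "T \<bullet> v = c *\<^sub>C v"
  using assms(1)
proof (induction rule: cvs.span_induct_alt)
  case (step d x y)
  then show ?case by (simp add: assms(2) scaleC_add_right scaleC_scaleC mult.commute[of d])
qed simp

lift_definition rank_one :: "'v::complex_vspace \<Rightarrow> 'v dual \<Rightarrow> 'v cend" is "\<lambda>u \<phi> v. \<phi> v *\<^sub>C u"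
  by (simp add: clinear_iff scaleC_add_left scaleC_scaleC)

lemma rank_one_apply [simp]: "rank_one u \<phi> \<bullet> v = dual_apply \<phi> v *\<^sub>C u"
  by transfer simp

lemma dual_apply_simps [simp]:
  "dual_apply \<phi> (x + y) = dual_apply \<phi> x + dual_apply \<phi> y"
  "dual_apply \<phi> (c *\<^sub>C x) = c * dual_apply \<phi> x"
  using dual_apply[of \<phi>] by (simp_all add: clinear_iff)

text \<open>
  One half of the quantum group acting on \<open>V\<close>: \<open>u\<close> generates \<open>V\<close> under the \<open>E i\<close>, \<open>w\<close> is killed by
  them, \<open>E i\<close> acts on \<open>V \<otimes> V\<close> as \<open>E i \<otimes> 1 + S i \<otimes> E i\<close>, the antipode sends
  \<open>E i\<close> to \<open>- S' i * E i\<close>, and \<open>Z\<close> is the pivotal element times the parity. The super signs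
  are absorbed into \<open>S\<close> and \<open>Z\<close>. The right partial trace uses \<open>e\<close>; the left one uses \<open>f\<close>
  (with \<open>f\<^sub>2\<close> multiplied by the parity), \<open>u\<close> and \<open>w\<close> exchanged and the tensor factors swapped.
\<close>

locale borel_action =
  fixes q :: complex and l :: nat and E S S' H :: "node \<Rightarrow> 'v::complex_vspace cend" and Z :: "'v cend"
    and \<epsilon> :: complex and u w :: 'v and lam su s :: "node \<Rightarrow> complex" and zu :: complex
  assumes q: "q \<noteq> 0" "q + inverse q \<noteq> 0" "q ^ l = 1" "\<And>j. 0 < j \<Longrightarrow> j < l \<Longrightarrow> (q * q) ^ j \<noteq> 1" "0 < l"
    and E: "nilpotent_serre q l E"
    and S: "\<And>i. S i * S' i = 1" "\<And>i. S' i * S i = 1" "S N1 * S N2 = S N2 * S N1"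
    and SE: "\<And>i j. S i * E j = qtwist q i j *\<^sub>C (E j * S i)"
    and HE: "\<And>i j. H i * E j = E j * H i + (\<epsilon> * of_int (cartan i j)) *\<^sub>C E j" and eps: "\<epsilon> \<noteq> 0"
    and HS: "\<And>i j. H i * S j = S j * H i" "\<And>i j. H i * S' j = S' j * H i"
    and ZE: "\<And>i. E i * Z = qtwist q i i *\<^sub>C (Z * E i)"
    and ZS: "\<And>i. Z * S' i = S' i * Z"
    and ZH: "\<And>i. Z * H i = H i * Z"
    and Hu: "\<And>i. H i \<bullet> u = lam i *\<^sub>C u" and Su: "\<And>i. S i \<bullet> u = su i *\<^sub>C u" and Zu: "Z \<bullet> u = zu *\<^sub>C u"
    and gen: "cvs.span (range (\<lambda>ns. word E ns \<bullet> u)) = UNIV"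
    and w: "w \<noteq> 0" "\<And>i. E i \<bullet> w = 0" "\<And>i. S i \<bullet> w = s i *\<^sub>C w"
    and Zw: "Z \<bullet> w = (s N1 ^ l * s N2 ^ 2) *\<^sub>C w"
    and Hw: "\<And>i. H i \<bullet> w = (lam i + \<epsilon> * (of_nat l * of_int (cartan i N1) + 2 * of_int (cartan i N2))) *\<^sub>C w"
begin

section \<open>Weights of words and a Schur lemma\<close>

definition wt :: "node list \<Rightarrow> node \<Rightarrow> complex" where
  "wt ns i = \<epsilon> * (of_nat (count_list ns N1) * of_int (cartan i N1) + of_nat (count_list ns N2) * of_int (cartan i N2))"

lemma wt_Cons: "wt (n # ns) i = \<epsilon> * of_int (cartan i n) + wt ns i"
  by (cases n) (simp_all add: wt_def algebra_simps)

text \<open>The matrix \<open>cartan\<close> has determinant -1, so weights determine letter counts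
  exactly. The eigenvalues of \<open>S\<close> are insensitive to changes of exponent that q, a root
  of unity, cannot see, which is why \<open>H\<close> is carried along.\<close>

lemma wt_eqD:
  assumes "wt ns N1 = wt ms N1" "wt ns N2 = wt ms N2"
  shows "count_list ns N1 = count_list ms N1" "count_list ns N2 = count_list ms N2"
  using assms eps by (auto simp: wt_def)

lemma H_word: "H i \<bullet> word E ns \<bullet> u = (lam i + wt ns i) *\<^sub>C (word E ns \<bullet> u)"
proof (induction ns)
  case (Cons n ns)
  have "H i \<bullet> E n \<bullet> x = E n \<bullet> H i \<bullet> x + (\<epsilon> * of_int (cartan i n)) *\<^sub>C (E n \<bullet> x)" for x
    using arg_cong[OF HE[of i n], of "\<lambda>A. A \<bullet> x"] by simp
  with Cons show ?case by (simp add: wt_Cons scaleC_add_left)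
qed (simp add: Hu wt_def)

lemma S_word: "S i \<bullet> word E ns \<bullet> u
    = (qtwist q i N1 ^ count_list ns N1 * qtwist q i N2 ^ count_list ns N2 * su i) *\<^sub>C (word E ns \<bullet> u)"
proof (induction ns)
  case (Cons n ns)
  have "S i \<bullet> E n \<bullet> x = qtwist q i n *\<^sub>C (E n \<bullet> S i \<bullet> x)" for x
    using arg_cong[OF SE[of i n], of "\<lambda>A. A \<bullet> x"] by simp
  with Cons show ?case by (cases n) (simp_all add: scaleC_scaleC mult_ac)
qed (simp add: Su)

lemma qtwist_nz: "qtwist q i j \<noteq> 0"
  using q(1) by (cases i; cases j) auto

lemma Z_word: "\<exists>z. Z \<bullet> word E ns \<bullet> u = z *\<^sub>C (word E ns \<bullet> u)"
proof (induction ns)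
  case (Cons n ns)
  have "Z \<bullet> E n \<bullet> x = inverse (qtwist q n n) *\<^sub>C (E n \<bullet> Z \<bullet> x)" for x
    using arg_cong[OF ZE[of n], of "\<lambda>A. A \<bullet> x"] qtwist_nz[of n n] by (simp add: scaleC_scaleC scaleC_one)
  with Cons show ?case by (auto simp: scaleC_scaleC)
qed (use Zu in auto)

text \<open>Words applied to \<open>u\<close> are joint eigenvectors of \<open>H\<close>,
  \<open>S\<close> and \<open>Z\<close>. The set \<open>I\<close> will be empty or
  \<open>{w}\<close>; in the second case \<open>w\<close> becomes a basis vector and its coordinate
  an eigenfunctional.\<close>

lemma eigenbasis:
  assumes "cvs.independent I"
  obtains B where "I \<subseteq> B" "B \<subseteq> I \<union> range (\<lambda>ns. word E ns \<bullet> u)" "cvs.independent B" "cvs.span B = UNIV"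
proof -
  obtain B where B: "I \<subseteq> B" "B \<subseteq> I \<union> range (\<lambda>ns. word E ns \<bullet> u)" "cvs.independent B"
    "I \<union> range (\<lambda>ns. word E ns \<bullet> u) \<subseteq> cvs.span B"
    by (rule cvs.maximal_independent_subset_extend[OF _ assms, of "I \<union> range (\<lambda>ns. word E ns \<bullet> u)"]) auto
  then have "cvs.span (range (\<lambda>ns. word E ns \<bullet> u)) \<subseteq> cvs.span B"
    by (intro cvs.span_minimal) auto
  with gen have "cvs.span B = UNIV" by auto
  then show thesis by (rule that[OF B(1-3)])
qed

text \<open>Expanding \<open>v\<close> in a basis of words and comparing
  \<open>H\<close>-eigenvalues, only words of the weight of \<open>v\<close> can occur;
  \<open>wt_eqD\<close> turns equal weight into equal letter counts.\<close>

lemma weight_vector_in_span: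
  assumes v: "\<And>i. H i \<bullet> v = (lam i + wt ms i) *\<^sub>C v"
  shows "v \<in> cvs.span {word E ns \<bullet> u | ns. count_list ns N1 = count_list ms N1 \<and> count_list ns N2 = count_list ms N2}"
proof -
  obtain B where B: "B \<subseteq> range (\<lambda>ns. word E ns \<bullet> u)" "cvs.independent B" "cvs.span B = UNIV"
    by (rule eigenbasis[of "{}"]) (auto simp: cvs.independent_empty)
  let ?S = "{word E ns \<bullet> u | ns. count_list ns N1 = count_list ms N1 \<and> count_list ns N2 = count_list ms N2}"
  have "\<exists>ns. \<forall>b\<in>B. b = word E (ns b) \<bullet> u" using B(1) by (intro bchoice) blast
  then obtain ns where ns: "\<And>b. b \<in> B \<Longrightarrow> b = word E (ns b) \<bullet> u" by blast
  have b: "b \<in> ?S" if "cvs.representation B v b \<noteq> 0" for b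
  proof -
    have "b \<in> B" using that by (rule cvs.representation_ne_zero)
    have "wt (ns b) i = wt ms i" for i
    proof -
      have "cvs.representation B (H i \<bullet> v) b = (lam i + wt (ns b) i) * cvs.representation B v b"
      proof (rule representation_eigen[OF B(2,3) _ \<open>b \<in> B\<close>, where \<kappa> = "\<lambda>b. lam i + wt (ns b) i"])
        show "H i \<bullet> c = (lam i + wt (ns c) i) *\<^sub>C c" if "c \<in> B" for c
          using H_word[of i "ns c"] ns[OF that] by simp
      qed
      then show ?thesis using that B by (simp add: v cvs.representation_scale)
    qed
    then show ?thesis using wt_eqD[of "ns b" ms] ns[OF \<open>b \<in> B\<close>] by blast
  qed
  have "v = (\<Sum>b | cvs.representation B v b \<noteq> 0. cvs.representation B v b *\<^sub>C b)"
    using cvs.sum_nonzero_representation_eq[OF B(2)] B(3) by simp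
  also have "\<dots> \<in> cvs.span ?S"
    using b by (intro cvs.span_sum cvs.span_scale cvs.span_base) blast
  finally show ?thesis .
qed

text \<open>Only the empty word has no letters, so the weight space of \<open>u\<close> is a
  line.\<close>

lemma lowest_weight_vector:
  assumes "\<And>i. H i \<bullet> v = lam i *\<^sub>C v"
  shows "\<exists>c. v = c *\<^sub>C u"
proof -
  have "{word E ns \<bullet> u | ns. count_list ns N1 = count_list [] N1 \<and> count_list ns N2 = count_list [] N2} \<subseteq> {u}"
  proof clarify
    fix ns assume *: "count_list ns N1 = count_list [] N1" "count_list ns N2 = count_list [] N2"
    have "ns = []" using * by (cases ns; cases "hd ns") auto
    then show "word E ns \<bullet> u = u" by simp
  qed
  from cvs.span_mono[OF this] weight_vector_in_span[of v "[]"] assms have "v \<in> cvs.span {u}"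
    by (auto simp: wt_def)
  then show ?thesis by (auto simp: cvs.span_singleton)
qed

text \<open>A Schur lemma for one Borel half: \<open>T \<bullet> u\<close> has the weight of
  \<open>u\<close>, hence is a multiple of it, and the scalar spreads over V along words.\<close>

lemma commuting_endomorphism_scalar:
  assumes "\<And>i. T * E i = E i * T" "\<And>i. T * H i = H i * T"
  shows "\<exists>c. \<forall>v. T \<bullet> v = c *\<^sub>C v"
proof -
  have "H i \<bullet> T \<bullet> u = lam i *\<^sub>C (T \<bullet> u)" for i
    using arg_cong[OF assms(2)[of i], of "\<lambda>A. A \<bullet> u"] by (simp add: Hu)
  then obtain c where c: "T \<bullet> u = c *\<^sub>C u" using lowest_weight_vector by blast
  have "T \<bullet> word E ns \<bullet> u = c *\<^sub>C (word E ns \<bullet> u)" for ns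
  proof (induction ns)
    case (Cons n ns)
    then show ?case using arg_cong[OF assms(1)[of n], of "\<lambda>A. A \<bullet> word E ns \<bullet> u"] by simp
  qed (simp add: c)
  then have "T \<bullet> v = c *\<^sub>C v" for v
    using cend_scalar_on_span[of v "range (\<lambda>ns. word E ns \<bullet> u)" T c] by (auto simp: gen)
  then show ?thesis by blast
qed

section \<open>The adjoint action and the invariant of top degree\<close>

definition ad :: "node \<Rightarrow> 'v cend cend" where
  "ad i = twisted_ad (E i) (S i) (S' i)"

lemma ad_apply: "ad i \<bullet> A = E i * A - S i * A * S' i * E i"
  by (simp add: ad_def twisted_ad_apply)

lemma ad_serre: "nilpotent_serre q l ad"
  using nilpotent_serre_twisted_ad[OF E S SE q(1,3,4,5)] by (simp add: ad_def[abs_def])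

text \<open>The coordinate functional of \<open>w\<close>. It is described by eigenvalue equations
  rather than by its kernel because these give the weight of \<open>rank_one u \<phi>\<close> and
  let \<open>Z\<close> be absorbed into \<open>\<phi>\<close>.\<close>

definition top_functional :: "'v dual \<Rightarrow> bool" where
  "top_functional \<phi> \<longleftrightarrow> dual_apply \<phi> w = 1
     \<and> (\<forall>i v. dual_apply \<phi> (H i \<bullet> v) = (lam i + \<epsilon> * (of_nat l * of_int (cartan i N1) + 2 * of_int (cartan i N2))) * dual_apply \<phi> v)
     \<and> (\<forall>i v. dual_apply \<phi> (S i \<bullet> v) = s i * dual_apply \<phi> v)
     \<and> (\<forall>v. dual_apply \<phi> (Z \<bullet> v) = (s N1 ^ l * s N2 ^ 2) * dual_apply \<phi> v)"

lemma ex_top_functional: "\<exists>\<phi>. top_functional \<phi>"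
proof -
  have "cvs.independent {w}" using w(1) by simp
  then obtain B where B: "w \<in> B" "B \<subseteq> {w} \<union> range (\<lambda>ns. word E ns \<bullet> u)" "cvs.independent B" "cvs.span B = UNIV"
    by (rule eigenbasis) auto
  define \<phi> where "\<phi> = Dual (\<lambda>v. cvs.representation B v w)"
  have \<phi>: "dual_apply \<phi> v = cvs.representation B v w" for v
    using clinear_representation[OF B(3,4)] by (simp add: \<phi>_def Dual_inverse)
  have K: "dual_apply \<phi> (K \<bullet> v) = k * dual_apply \<phi> v"
    if "K \<bullet> w = k *\<^sub>C w" "\<And>ns. \<exists>k. K \<bullet> word E ns \<bullet> u = k *\<^sub>C (word E ns \<bullet> u)" for K k v
  proof -
    have "\<forall>b\<in>B. \<exists>k. K \<bullet> b = k *\<^sub>C b" using that B(2) by blast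
    then obtain \<kappa> where \<kappa>: "\<And>b. b \<in> B \<Longrightarrow> K \<bullet> b = \<kappa> b *\<^sub>C b" by (metis bchoice)
    have "\<kappa> w = k" using \<kappa>[OF B(1)] that(1) w(1) by simp
    then show ?thesis using representation_eigen[OF B(3,4) \<kappa> B(1), of v] by (simp add: \<phi>)
  qed
  have "dual_apply \<phi> w = 1" using B by (simp add: \<phi> cvs.representation_basis)
  moreover have "dual_apply \<phi> (H i \<bullet> v) = (lam i + \<epsilon> * (of_nat l * of_int (cartan i N1) + 2 * of_int (cartan i N2))) * dual_apply \<phi> v" for i v
    by (rule K[OF Hw]) (use H_word in blast)
  moreover have "dual_apply \<phi> (S i \<bullet> v) = s i * dual_apply \<phi> v" for i v
    by (rule K[OF w(3)]) (use S_word in blast)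
  moreover have "dual_apply \<phi> (Z \<bullet> v) = (s N1 ^ l * s N2 ^ 2) * dual_apply \<phi> v" for v
    by (rule K[OF Zw]) (rule Z_word)
  ultimately show ?thesis unfolding top_functional_def by blast
qed

lemma ad_word_H:
  assumes "\<And>i. H i * A = A * H i + d i *\<^sub>C A"
  shows "H i * (word ad ns \<bullet> A) = (word ad ns \<bullet> A) * H i + (d i + wt ns i) *\<^sub>C (word ad ns \<bullet> A)"
proof (induction ns)
  case Nil
  then show ?case using assms by (simp add: wt_def)
next
  case (Cons n ns)
  define X where "X = word ad ns \<bullet> A"
  have HX: "H i * X = X * H i + (d i + wt ns i) *\<^sub>C X" using Cons by (simp add: X_def)
  have c: "H i * (X * z) = X * (H i * z) + (d i + wt ns i) *\<^sub>C (X * z)"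
    "H i * (E n * z) = E n * (H i * z) + (\<epsilon> * of_int (cartan i n)) *\<^sub>C (E n * z)"
    "H i * (S n * z) = S n * (H i * z)" "H i * (S' n * z) = S' n * (H i * z)" for z
    using HX HE[of i n] HS[of i n] by (metis mult.assoc distrib_right scaleC_mult_left)+
  have "H i * (E n * X - S n * X * S' n * E n) = (E n * X - S n * X * S' n * E n) * H i
      + (d i + (\<epsilon> * of_int (cartan i n) + wt ns i)) *\<^sub>C (E n * X - S n * X * S' n * E n)"
    by (simp add: c HE HX algebra_simps scaleC_mult)
  then show ?case by (simp add: ad_apply wt_Cons flip: X_def)
qed

lemma ad_word_S:
  assumes "\<And>i. S i * A = d i *\<^sub>C (A * S i)"
  shows "S i * (word ad ns \<bullet> A) = (qtwist q i N1 ^ count_list ns N1 * qtwist q i N2 ^ count_list ns N2 * d i)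
    *\<^sub>C ((word ad ns \<bullet> A) * S i)"
proof (induction ns)
  case Nil
  then show ?case using assms by simp
next
  case (Cons n ns)
  define X where "X = word ad ns \<bullet> A"
  define k where "k = qtwist q i N1 ^ count_list ns N1 * qtwist q i N2 ^ count_list ns N2 * d i"
  have SX: "S i * X = k *\<^sub>C (X * S i)" using Cons by (simp add: X_def k_def)
  have SS: "S i * S n = S n * S i" using S(3) by (cases i; cases n) auto
  have S'': "S j * (S' j * z) = z" "S' j * (S j * z) = z" for j z
    using S(1,2)[of j] by (metis mult.assoc mult_1_left)+
  have "S' n * S i = S' n * (S i * S n) * S' n" by (simp add: mult.assoc S(1))
  also have "\<dots> = S i * S' n" unfolding SS by (simp add: mult.assoc S'')
  finally have SS': "S i * S' n = S' n * S i" ..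
  have c: "S i * (X * z) = k *\<^sub>C (X * (S i * z))"
    "S i * (E n * z) = qtwist q i n *\<^sub>C (E n * (S i * z))"
    "S i * (S n * z) = S n * (S i * z)" "S i * (S' n * z) = S' n * (S i * z)" for z
    using SX SE[of i n] SS SS' by (metis mult.assoc scaleC_mult_left)+
  have "S i * (E n * X - S n * X * S' n * E n)
      = (qtwist q i n * k) *\<^sub>C ((E n * X - S n * X * S' n * E n) * S i)"
    by (simp add: c SE SX right_diff_distrib left_diff_distrib mult.assoc scaleC_mult
        cvs.scale_right_diff_distrib)
  moreover have "qtwist q i n * k = qtwist q i N1 ^ count_list (n # ns) N1
      * qtwist q i N2 ^ count_list (n # ns) N2 * d i"
    by (cases n) (simp_all add: k_def)
  ultimately show ?case by (simp add: ad_apply flip: X_def del: count_list.simps)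
qed

text \<open>The subtracted term of \<open>ad i\<close> ends in \<open>E i\<close>, which kills
  \<open>w\<close>; evaluated at \<open>w\<close>, the adjoint action reduces to left
  multiplication.\<close>

lemma ad_word_w: "(word ad ns \<bullet> A) \<bullet> w = word E ns \<bullet> A \<bullet> w"
proof (induction ns)
  case (Cons n ns)
  then show ?case by (simp add: ad_apply w)
qed simp

lemma s_nz: "s i \<noteq> 0"
  using w S(2)[of i] by (metis cend_apply_simps(5) cend_simps(5,6) cvs.scale_zero_left)

text \<open>
  The element \<open>T\<close> of \<open>V \<otimes> V\<^sup>*\<close> obtained by applying an element of top degree to the
  tensor of a lowest weight vector with a lowest weight functional is invariant, hence it is the
  coevaluation, i.e. the identity of \<open>V\<close>.
\<close>

lemma equivariant_value_at_identity:
  fixes G :: "'v cend \<Rightarrow> 'v"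
  assumes \<phi>: "top_functional \<phi>" and G: "clinear G" "\<And>i A. E i \<bullet> G A = s i *\<^sub>C G (ad i \<bullet> A)"
    and \<gamma>: "G (rank_one u \<phi>) = \<gamma> *\<^sub>C u"
  shows "(s N1 ^ l * s N2 ^ 2) *\<^sub>C G 1 = \<gamma> *\<^sub>C w"
proof -
  let ?A = "rank_one u \<phi>"
  let ?top = "\<lambda>ns. count_list ns N1 = l \<and> count_list ns N2 = 2"
  have top: "wt ns i = \<epsilon> * (of_nat l * of_int (cartan i N1) + 2 * of_int (cartan i N2))" if "?top ns" for ns i
    using that by (simp add: wt_def)
  \<comment> \<open>Each letter passes through \<open>G\<close> at the price of one factor
    \<open>s\<close>; at top degree these collect to the factor in the conclusion.\<close>
  have Gw: "(s N1 ^ count_list ns N1 * s N2 ^ count_list ns N2) *\<^sub>C G (word ad ns \<bullet> ?A) = word E ns \<bullet> G ?A" for ns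
  proof (induction ns)
    case (Cons n ns)
    have "word E (n # ns) \<bullet> G ?A
        = (s N1 ^ count_list ns N1 * s N2 ^ count_list ns N2 * s n) *\<^sub>C G (ad n \<bullet> word ad ns \<bullet> ?A)"
      using Cons[symmetric] by (simp add: G(2) scaleC_scaleC)
    then show ?case by (cases n) (simp_all add: mult_ac)
  qed (simp add: scaleC_one)
  have HA: "H i * ?A = ?A * H i + (- (\<epsilon> * (of_nat l * of_int (cartan i N1) + 2 * of_int (cartan i N2)))) *\<^sub>C ?A" for i
  proof (rule cend_eqI)
    fix v
    let ?m = "\<epsilon> * (of_nat l * of_int (cartan i N1) + 2 * of_int (cartan i N2))"
    have "(?A * H i + (- ?m) *\<^sub>C ?A) \<bullet> v = ((lam i + ?m) * dual_apply \<phi> v + - ?m * dual_apply \<phi> v) *\<^sub>C u"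
      using \<phi> by (simp only: scaleC_add_left) (simp add: top_functional_def scaleC_scaleC)
    also have "(lam i + ?m) * dual_apply \<phi> v + - ?m * dual_apply \<phi> v = dual_apply \<phi> v * lam i"
      by (simp add: algebra_simps)
    finally show "(H i * ?A) \<bullet> v = (?A * H i + (- ?m) *\<^sub>C ?A) \<bullet> v"
      by (simp add: Hu scaleC_scaleC)
  qed
  \<comment> \<open>By \<open>Hw\<close>, the weight of \<open>w\<close> exceeds that of
    \<open>u\<close> by the weight of the degree (l, 2).\<close>
  have wspan: "w \<in> cvs.span {word E ns \<bullet> u | ns. ?top ns}"
  proof -
    have "count_list (replicate n x) y = (if x = y then n else 0)" for n and x y :: node
      by (induction n) auto
    then show ?thesis
      using weight_vector_in_span[of w "replicate l N1 @ replicate 2 N2"] Hw by (simp add: wt_def numeral_2_eq_2)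
  qed
  \<comment> \<open>Comparing the \<open>S\<close>-eigenvalues of \<open>w\<close> and of the words
    that span it; this makes the total \<open>S\<close>-weight of the invariant trivial.\<close>
  have s: "s i = qtwist q i N1 ^ l * qtwist q i N2 ^ 2 * su i" for i
  proof -
    have "S i \<bullet> w = (qtwist q i N1 ^ l * qtwist q i N2 ^ 2 * su i) *\<^sub>C w"
      by (rule cend_scalar_on_span[OF wspan]) (auto simp: S_word)
    then show ?thesis using w by simp
  qed
  have SA: "S i * ?A = (su i / s i) *\<^sub>C (?A * S i)" for i
    using \<phi> s_nz[of i] by (intro cend_eqI) (simp add: top_functional_def Su scaleC_scaleC)
  \<comment> \<open>The conditions are linear in the pair \<open>(v, T)\<close>, so span induction
    yields one \<open>T\<close> for \<open>w\<close> even though \<open>w\<close> is only known as a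
    combination of words. The vector of a word \<open>ns\<close> is matched with
    \<open>word ad ns \<bullet> ?A\<close>.\<close>
  let ?P = "\<lambda>v T. (\<forall>i. ad i \<bullet> T = 0 \<and> H i * T = T * H i \<and> S i * T = T * S i) \<and> T \<bullet> w = v
      \<and> (s N1 ^ l * s N2 ^ 2) *\<^sub>C G T = \<gamma> *\<^sub>C v"
  have G0: "G (x + y) = G x + G y" "G (c *\<^sub>C x) = c *\<^sub>C G x" "G 0 = 0" for x y c
    using G(1) cvs_pair.linear_0[OF G(1)] by (simp_all add: clinear_iff)
  have "\<exists>T. ?P v T" if "v \<in> cvs.span {word E ns \<bullet> u | ns. ?top ns}" for v
    using that
  proof (induction rule: cvs.span_induct_alt)
    case base
    show ?case by (rule exI[of _ 0]) (simp add: G0)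
  next
    case (step c x y)
    obtain T where T: "?P y T" using step by blast
    obtain ns where ns: "x = word E ns \<bullet> u" "?top ns" using step by blast
    \<comment> \<open>One more letter leaves the range of nonzero degrees, hence the
      invariance.\<close>
    have "word ad (i # ns) = 0" for i
      using ns by (intro word_eq_0[OF ad_serre q(1,2)]) (cases i; simp)
    then have "(ad i * word ad ns) \<bullet> ?A = 0" for i by simp
    moreover have "H i * (word ad ns \<bullet> ?A) = (word ad ns \<bullet> ?A) * H i" for i
      using ad_word_H[OF HA] top[OF ns(2)] by simp
    moreover have "S i * (word ad ns \<bullet> ?A) = (word ad ns \<bullet> ?A) * S i" for i
    proof -
      have "qtwist q i N1 ^ l * qtwist q i N2 ^ 2 * (su i / s i) = 1"
        using s[of i] s_nz[of i] by simp
      then show ?thesis using ad_word_S[OF SA, of i ns] ns(2) by (simp add: scaleC_one)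
    qed
    moreover have "(word ad ns \<bullet> ?A) \<bullet> w = x"
      using \<phi> by (simp add: ad_word_w ns top_functional_def scaleC_one)
    moreover have "(s N1 ^ l * s N2 ^ 2) *\<^sub>C G (word ad ns \<bullet> ?A) = \<gamma> *\<^sub>C x"
      using Gw[of ns] ns \<gamma> by simp
    ultimately obtain T' where T': "?P x T'" by fastforce
    have "(s N1 ^ l * s N2 ^ 2) *\<^sub>C G (c *\<^sub>C T' + T)
        = c *\<^sub>C (s N1 ^ l * s N2 ^ 2) *\<^sub>C G T' + (s N1 ^ l * s N2 ^ 2) *\<^sub>C G T"
      by (simp add: G0 scaleC_add_right mult.commute[of c])
    also have "\<dots> = \<gamma> *\<^sub>C (c *\<^sub>C x + y)"
      using T T' by (simp add: scaleC_add_right mult.commute[of c])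
    finally have "?P (c *\<^sub>C x + y) (c *\<^sub>C T' + T)"
      using T T' by (simp add: distrib_left distrib_right scaleC_mult_left scaleC_mult_right)
    then show ?case by blast
  qed
  from this[OF wspan] obtain T where T: "?P w T" by blast
  \<comment> \<open>For a \<open>T\<close> commuting with \<open>S i\<close>, the vanishing of
    \<open>ad i \<bullet> T\<close> amounts to commuting with \<open>E i\<close>.\<close>
  have TE: "T * E i = E i * T" for i
  proof -
    have "E i * T = S i * T * S' i * E i" using T ad_apply[of i T] by simp
    also have "S i * T = T * S i" using T by blast
    also have "T * S i * S' i * E i = T * E i" by (simp add: mult.assoc S(1) flip: mult.assoc[of "S i"])
    finally show ?thesis ..
  qed
  obtain c where c: "\<And>v. T \<bullet> v = c *\<^sub>C v"
    using commuting_endomorphism_scalar[of T] TE T by metis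
  have "c = 1" using c[of w] T w(1) by (simp add: cvs.scale_right_imp_eq scaleC_one cvs.scale_cancel_right)
  then have "T = 1" using c by (intro cend_eqI) (simp add: scaleC_one)
  with T show ?thesis by blast
qed

end

section \<open>Partial traces\<close>

lift_definition dual_comp :: "'v::complex_vspace dual \<Rightarrow> 'v cend \<Rightarrow> 'v dual" is "\<lambda>\<phi> A v. \<phi> (A v)"
  by (simp add: clinear_iff)

lemma dual_comp_apply [simp]: "dual_apply (dual_comp \<phi> A) v = dual_apply \<phi> (A \<bullet> v)"
  by transfer simp

lemma dual_eqI: "(\<And>x. dual_apply \<phi> x = dual_apply \<psi> x) \<Longrightarrow> \<phi> = \<psi>"
  by (simp add: dual_apply_inject[symmetric] fun_eq_iff)

lemma dual_comp_mult: "dual_comp \<phi> (A * B) = dual_comp (dual_comp \<phi> A) B"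
  by (rule dual_eqI) simp

definition contract :: "'w::complex_vspace dual \<Rightarrow> ('v::complex_vspace, 'w) tensor \<Rightarrow> 'v" where
  "contract \<psi> = tensor_lift (\<lambda>x y. dual_apply \<psi> y *\<^sub>C x)"

lemma
  fixes \<psi> :: "'w::complex_vspace dual" and x :: "'v::complex_vspace"
  shows clinear_contract: "clinear (contract \<psi> :: ('v, 'w) tensor \<Rightarrow> 'v)"
    and contract_pure [simp]: "contract \<psi> (x \<otimes>\<^sub>C y) = dual_apply \<psi> y *\<^sub>C x"
proof -
  have "cbilinear (\<lambda>(x::'v) y. dual_apply \<psi> y *\<^sub>C x)"
    by (simp add: cbilinear_def clinear_iff scaleC_add_left scaleC_add_right scaleC_scaleC mult.commute)
  from tensor_lift[OF this] show "clinear (contract \<psi> :: ('v, 'w) tensor \<Rightarrow> 'v)" "contract \<psi> (x \<otimes>\<^sub>C y) = dual_apply \<psi> y *\<^sub>C x"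
    by (simp_all add: contract_def)
qed

lemma contract_simps [simp]:
  "contract \<psi> (s + t) = contract \<psi> s + contract \<psi> t" "contract \<psi> (c *\<^sub>C t) = c *\<^sub>C contract \<psi> t"
  by (simp_all add: cvs_pair.linear_add[OF clinear_contract] cvs_pair.linear_scale[OF clinear_contract])

lemma contract_add:
  fixes t :: "('v::complex_vspace, 'w::complex_vspace) tensor"
  shows "contract (\<phi> + \<psi>) t = contract \<phi> t + contract \<psi> t"
proof -
  have "(contract (\<phi> + \<psi>) :: ('v, 'w) tensor \<Rightarrow> 'v) = (\<lambda>t. contract \<phi> t + contract \<psi> t)"
    by (rule tensor_lift_unique)
      (simp_all add: clinear_contract clinear_iff plus_dual.rep_eq scaleC_add_left scaleC_add_right)
  then show ?thesis by simp
qed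

lemma contract_scaleC:
  fixes t :: "('v::complex_vspace, 'w::complex_vspace) tensor"
  shows "contract (c *\<^sub>C \<psi>) t = c *\<^sub>C contract \<psi> t"
proof -
  have "(contract (c *\<^sub>C \<psi>) :: ('v, 'w) tensor \<Rightarrow> 'v) = (\<lambda>t. c *\<^sub>C contract \<psi> t)"
    by (rule tensor_lift_unique)
      (simp_all add: clinear_contract clinear_iff scaleC_dual.rep_eq scaleC_scaleC scaleC_add_right mult.commute)
  then show ?thesis by simp
qed

definition tmap :: "'v::complex_vspace cend \<Rightarrow> 'w::complex_vspace cend \<Rightarrow> ('v, 'w) tensor cend" where
  "tmap A B = Cend (tensor_map (cend_apply A) (cend_apply B))"

lemma tmap_apply: "tmap A B \<bullet> t = tensor_map (cend_apply A) (cend_apply B) t"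
  by (simp add: tmap_def Cend_apply clinear_tensor_map clinear_cend_apply)

lemma tmap_pure [simp]: "tmap A B \<bullet> (x \<otimes>\<^sub>C y) = (A \<bullet> x) \<otimes>\<^sub>C (B \<bullet> y)"
  by (simp add: tmap_apply tensor_map_pure clinear_cend_apply)

lemma contract_tmap: "contract \<psi> (tmap A B \<bullet> t) = A \<bullet> contract (dual_comp \<psi> B) t"
proof -
  have "(\<lambda>t. contract \<psi> (tmap A B \<bullet> t)) = (\<lambda>t. A \<bullet> contract (dual_comp \<psi> B) t)"
    by (rule tensor_lift_unique) (simp_all add: clinear_iff)
  then show ?thesis by (rule fun_cong)
qed

lemma tensor_cend_eqI:
  fixes F G :: "('v::complex_vspace, 'w::complex_vspace) tensor cend"
  assumes "\<And>x y. F \<bullet> (x \<otimes>\<^sub>C y) = G \<bullet> (x \<otimes>\<^sub>C y)"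
  shows "F = G"
  using tensor_lift_unique[OF clinear_cend_apply clinear_cend_apply assms] by (simp add: cend_apply_inject)

section \<open>Dual bases and cyclicity of the trace\<close>

lemma dual_apply_dual_basis:
  "cvs.independent B \<Longrightarrow> cvs.span B = UNIV \<Longrightarrow> dual_apply (dual_basis B b) v = cvs.representation B v b"
  using clinear_representation[of B b] by (simp add: dual_basis_def Dual_inverse)

lemma basis_expansion:
  assumes "finite B" "cvs.independent B" "cvs.span B = UNIV"
  shows "(\<Sum>b\<in>B. dual_apply (dual_basis B b) v *\<^sub>C b) = v"
  using cvs.sum_representation_eq[OF assms(2) _ assms(1) subset_refl, of v] assms
  by (simp add: dual_apply_dual_basis)

lemma dual_basis_expansion:
  assumes "finite B" "cvs.independent B" "cvs.span B = UNIV"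
  shows "(\<Sum>b\<in>B. dual_apply \<phi> b *\<^sub>C dual_basis B b) = \<phi>"
proof (rule dual_eqI)
  fix v
  have sum: "dual_apply (\<Sum>b\<in>I. g b) v = (\<Sum>b\<in>I. dual_apply (g b) v)" for I and g :: "_ \<Rightarrow> 'a dual"
    by (induction I rule: infinite_finite_induct) (simp_all add: plus_dual.rep_eq zero_dual.rep_eq)
  have "dual_apply (\<Sum>b\<in>B. dual_apply \<phi> b *\<^sub>C dual_basis B b) v
      = (\<Sum>b\<in>B. dual_apply \<phi> (dual_apply (dual_basis B b) v *\<^sub>C b))"
    by (simp add: sum scaleC_dual.rep_eq mult.commute)
  also have "\<dots> = dual_apply \<phi> (\<Sum>b\<in>B. dual_apply (dual_basis B b) v *\<^sub>C b)"
    using dual_apply[of \<phi>] by (subst cvs_pair.linear_sum[of "dual_apply \<phi>"]) auto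
  finally show "dual_apply (\<Sum>b\<in>B. dual_apply \<phi> b *\<^sub>C dual_basis B b) v = dual_apply \<phi> v"
    by (simp add: basis_expansion[OF assms])
qed

text \<open>Both sides expand to one double sum over the matrix of \<open>A\<close>. The lemma moves
  an operator between the functional leg and the vector leg of the coevaluation.\<close>

lemma dual_sum_cyclic:
  fixes g :: "'v::complex_vspace dual \<Rightarrow> 'v \<Rightarrow> 'w::complex_vspace"
  assumes B: "finite B" "cvs.independent B" "cvs.span B = UNIV" and g: "cbilinear g"
  shows "(\<Sum>b\<in>B. g (dual_comp (dual_basis B b) A) b) = (\<Sum>b\<in>B. g (dual_basis B b) (A \<bullet> b))"
proof -
  have g1: "clinear (\<lambda>\<phi>. g \<phi> y)" and g2: "clinear (g \<phi>)" for y \<phi>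
    using g by (auto simp: cbilinear_def)
  have 1: "g (dual_comp (dual_basis B b) A) b
      = (\<Sum>c\<in>B. dual_apply (dual_basis B b) (A \<bullet> c) *\<^sub>C g (dual_basis B c) b)" for b
    by (subst dual_basis_expansion[OF B, symmetric])
      (simp add: cvs_pair.linear_sum[OF g1] cvs_pair.linear_scale[OF g1])
  have 2: "g (dual_basis B c) (A \<bullet> c)
      = (\<Sum>b\<in>B. dual_apply (dual_basis B b) (A \<bullet> c) *\<^sub>C g (dual_basis B c) b)" for c
    by (subst basis_expansion[OF B, of "A \<bullet> c", symmetric])
      (simp add: cvs_pair.linear_sum[OF g2] cvs_pair.linear_scale[OF g2])
  show ?thesis unfolding 1 2 by (rule sum.swap)
qed

lemma rank_one_contract:
  fixes g :: "'v::complex_vspace dual \<Rightarrow> 'v \<Rightarrow> 'w::complex_vspace"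
  assumes B: "finite B" "cvs.independent B" "cvs.span B = UNIV" and g: "cbilinear g"
  shows "(\<Sum>b\<in>B. g (dual_basis B b) (rank_one u \<phi> \<bullet> b)) = g \<phi> u"
proof -
  have g1: "clinear (\<lambda>\<phi>. g \<phi> y)" and g2: "clinear (g \<phi>)" for y \<phi>
    using g by (auto simp: cbilinear_def)
  show ?thesis
    by (subst (2) dual_basis_expansion[OF B, symmetric])
      (simp add: cvs_pair.linear_sum[OF g1] cvs_pair.linear_scale[OF g1] cvs_pair.linear_scale[OF g2])
qed

section \<open>Equivariance of the partial trace under one Borel half\<close>

context borel_action
begin

text \<open>The right partial trace of \<open>F\<close> at \<open>v\<close> with the coevaluation
  replaced by an arbitrary element \<open>A\<close> of End(V): \<open>A = 1\<close> is the trace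
  proper, and \<open>A = rank_one u \<phi>\<close> is where it can be computed.\<close>

definition partial_trace :: "'v set \<Rightarrow> ('v, 'v) tensor cend \<Rightarrow> 'v \<Rightarrow> 'v cend \<Rightarrow> 'v" where
  "partial_trace B F v A = (\<Sum>b\<in>B. contract (dual_comp (dual_basis B b) Z) (F \<bullet> (v \<otimes>\<^sub>C (A \<bullet> b))))"

context
  fixes B :: "'v set" and F :: "('v, 'v) tensor cend"
  assumes B: "finite B" "cvs.independent B" "cvs.span B = UNIV"
    and FE: "\<And>i. F * (tmap (E i) 1 + tmap (S i) (E i)) = (tmap (E i) 1 + tmap (S i) (E i)) * F"
    and FS: "\<And>i. F * tmap (S i) (S i) = tmap (S i) (S i) * F"
    and FH: "\<And>i. F * (tmap (H i) 1 + tmap 1 (H i)) = (tmap (H i) 1 + tmap 1 (H i)) * F"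
begin

abbreviation "N \<equiv> partial_trace B F"
abbreviation "\<beta> b \<equiv> dual_comp (dual_basis B b) Z"

lemma cbilinear_contract: "cbilinear (\<lambda>\<phi> x. contract (dual_comp \<phi> A) (F \<bullet> (v \<otimes>\<^sub>C (X \<bullet> x))))"
proof -
  have "dual_comp (\<phi> + \<psi>) A = dual_comp \<phi> A + dual_comp \<psi> A" "dual_comp (c *\<^sub>C \<phi>) A = c *\<^sub>C dual_comp \<phi> A"
    for \<phi> \<psi> :: "'v dual" and c by (rule dual_eqI; simp add: plus_dual.rep_eq scaleC_dual.rep_eq)+
  then show ?thesis
    by (simp add: cbilinear_def clinear_iff tensor_pure_simps contract_add contract_scaleC)
qed

lemma partial_trace_linear:
  "clinear (N v)" "clinear (\<lambda>v. N v A)"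
  by (simp_all add: partial_trace_def clinear_iff tensor_pure_simps sum.distrib cvs.scale_sum_right)

text \<open>\<open>F\<close> and the evaluation are equivariant, so \<open>E i\<close> acts through
  the coproduct on \<open>v\<close> and \<open>A\<close>, and its action on \<open>A\<close> is the
  adjoint one.\<close>

lemma partial_trace_E: "E i \<bullet> N v A = N (E i \<bullet> v) A + N (S i \<bullet> v) (ad i \<bullet> A)"
proof -
  let ?t = "\<lambda>b. v \<otimes>\<^sub>C (A \<bullet> b)"
  have S1: "S' i \<bullet> S i \<bullet> x = x" for x
    using arg_cong[OF S(2)[of i], of "\<lambda>A. A \<bullet> x"] by simp
  have tr: "E i \<bullet> contract (\<beta> b) (F \<bullet> ?t b)
      = contract (\<beta> b) (F \<bullet> ((E i \<bullet> v) \<otimes>\<^sub>C (A \<bullet> b))) + contract (\<beta> b) (F \<bullet> ((S i \<bullet> v) \<otimes>\<^sub>C (E i \<bullet> A \<bullet> b)))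
        - contract (dual_comp (dual_comp (dual_basis B b) (S' i * E i)) Z) (F \<bullet> ((S i \<bullet> v) \<otimes>\<^sub>C (S i \<bullet> A \<bullet> b)))" for b
  proof -
    have "dual_comp (\<beta> b) (E i) = dual_comp (dual_comp (dual_comp (dual_basis B b) (S' i * E i)) Z) (S i)"
    proof -
      \<comment> \<open>\<open>Z\<close> implements the square of the antipode on
        \<open>E i\<close>; this is the invariance of the pivotal evaluation.\<close>
      have "S' i * E i * Z * S i = Z * E i"
      proof -
        have "S' i * E i * Z * S i = qtwist q i i *\<^sub>C (Z * S' i * (E i * S i))"
          by (simp add: ZE scaleC_mult mult.assoc) (simp add: ZS flip: mult.assoc)
        also have "\<dots> = Z * S' i * (S i * E i)"
          by (simp add: SE scaleC_mult)
        also have "\<dots> = Z * E i"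
          using S(2)[of i] by (metis mult.assoc mult_1_left)
        finally show ?thesis .
      qed
      then show ?thesis by (metis dual_comp_mult)
    qed
    then have "S i \<bullet> contract (dual_comp (\<beta> b) (E i)) (F \<bullet> ?t b)
        = contract (dual_comp (dual_comp (dual_basis B b) (S' i * E i)) Z) ((tmap (S i) (S i) * F) \<bullet> ?t b)"
      by (simp add: contract_tmap)
    also have "(tmap (S i) (S i) * F) \<bullet> ?t b = F \<bullet> ((S i \<bullet> v) \<otimes>\<^sub>C (S i \<bullet> A \<bullet> b))"
      by (simp add: FS[symmetric])
    finally have 1: "S i \<bullet> contract (dual_comp (\<beta> b) (E i)) (F \<bullet> ?t b)
        = contract (dual_comp (dual_comp (dual_basis B b) (S' i * E i)) Z) (F \<bullet> ((S i \<bullet> v) \<otimes>\<^sub>C (S i \<bullet> A \<bullet> b)))" .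
    have FE': "tmap (E i) 1 \<bullet> F \<bullet> ?t b + tmap (S i) (E i) \<bullet> F \<bullet> ?t b
        = F \<bullet> ((E i \<bullet> v) \<otimes>\<^sub>C (A \<bullet> b)) + F \<bullet> ((S i \<bullet> v) \<otimes>\<^sub>C (E i \<bullet> A \<bullet> b))"
      using arg_cong[OF FE[of i], of "\<lambda>X. X \<bullet> ?t b"] by simp
    have 2: "dual_comp (\<beta> b) 1 = \<beta> b" by (rule dual_eqI) simp
    have "contract (\<beta> b) (tmap (E i) 1 \<bullet> F \<bullet> ?t b + tmap (S i) (E i) \<bullet> F \<bullet> ?t b)
        = E i \<bullet> contract (dual_comp (\<beta> b) 1) (F \<bullet> ?t b) + S i \<bullet> contract (dual_comp (\<beta> b) (E i)) (F \<bullet> ?t b)"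
      by (simp add: contract_tmap)
    then show ?thesis unfolding FE' by (simp add: 1 2 algebra_simps)
  qed
  \<comment> \<open>Cyclicity carries \<open>S' i * E i\<close> from the functional to the right of
    \<open>A\<close>, which completes the second term of \<open>ad i\<close>.\<close>
  have "(\<Sum>b\<in>B. contract (dual_comp (dual_comp (dual_basis B b) (S' i * E i)) Z) (F \<bullet> ((S i \<bullet> v) \<otimes>\<^sub>C ((S i * A) \<bullet> b))))
      = N (S i \<bullet> v) (S i * A * S' i * E i)"
    unfolding dual_sum_cyclic[OF B cbilinear_contract] by (simp add: partial_trace_def mult.assoc)
  then have "E i \<bullet> N v A = N (E i \<bullet> v) A + N (S i \<bullet> v) (E i * A) - N (S i \<bullet> v) (S i * A * S' i * E i)"
    unfolding partial_trace_def[of B F v A]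
    by (simp add: cend_apply_sum tr sum.distrib sum_subtractf) (simp add: partial_trace_def)
  then show ?thesis
    by (simp add: ad_apply cvs_pair.linear_diff[OF partial_trace_linear(1)])
qed

lemma partial_trace_H: "H i \<bullet> N v 1 = N (H i \<bullet> v) 1"
proof -
  have tr: "H i \<bullet> contract (\<beta> b) (F \<bullet> (v \<otimes>\<^sub>C b))
      = contract (\<beta> b) (F \<bullet> ((H i \<bullet> v) \<otimes>\<^sub>C b)) + contract (\<beta> b) (F \<bullet> (v \<otimes>\<^sub>C (H i \<bullet> b)))
        - contract (dual_comp (dual_comp (dual_basis B b) (H i)) Z) (F \<bullet> (v \<otimes>\<^sub>C b))" for b
  proof -
    have FH': "tmap (H i) 1 \<bullet> F \<bullet> (v \<otimes>\<^sub>C b) + tmap 1 (H i) \<bullet> F \<bullet> (v \<otimes>\<^sub>C b)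
        = F \<bullet> ((H i \<bullet> v) \<otimes>\<^sub>C b) + F \<bullet> (v \<otimes>\<^sub>C (H i \<bullet> b))"
      using arg_cong[OF FH[of i], of "\<lambda>X. X \<bullet> (v \<otimes>\<^sub>C b)"] by simp
    have 1: "dual_comp (\<beta> b) 1 = \<beta> b" by (rule dual_eqI) simp
    have 2: "dual_comp (\<beta> b) (H i) = dual_comp (dual_comp (dual_basis B b) (H i)) Z"
      by (simp add: ZH flip: dual_comp_mult)
    have "contract (\<beta> b) (tmap (H i) 1 \<bullet> F \<bullet> (v \<otimes>\<^sub>C b) + tmap 1 (H i) \<bullet> F \<bullet> (v \<otimes>\<^sub>C b))
        = H i \<bullet> contract (dual_comp (\<beta> b) 1) (F \<bullet> (v \<otimes>\<^sub>C b)) + contract (dual_comp (\<beta> b) (H i)) (F \<bullet> (v \<otimes>\<^sub>C b))"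
      by (simp add: contract_tmap)
    then show ?thesis unfolding FH' by (simp add: 1 2 algebra_simps)
  qed
  show ?thesis
    using dual_sum_cyclic[OF B cbilinear_contract[of Z v 1], of "H i"]
    by (simp add: partial_trace_def cend_apply_sum tr sum.distrib sum_subtractf)
qed

text \<open>Equivariance gives the value at \<open>w\<close>. As a function of \<open>v\<close>, the
  trace \<open>N v 1\<close> commutes with the Borel half, so the Schur lemma extends the scalar to
  all of V.\<close>

theorem partial_trace_scalar:
  assumes \<phi>: "top_functional \<phi>"
  obtains \<gamma> where "contract \<phi> (F \<bullet> (w \<otimes>\<^sub>C u)) = \<gamma> *\<^sub>C u" "\<And>v. N v 1 = \<gamma> *\<^sub>C v"
proof -
  let ?m = "\<lambda>i. \<epsilon> * (of_nat l * of_int (cartan i N1) + 2 * of_int (cartan i N2))"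
  let ?z = "s N1 ^ l * s N2 ^ 2"
  let ?t = "F \<bullet> (w \<otimes>\<^sub>C u)"
  have "H i \<bullet> contract \<phi> ?t = lam i *\<^sub>C contract \<phi> ?t" for i
  proof -
    have FH': "tmap (H i) 1 \<bullet> ?t + tmap 1 (H i) \<bullet> ?t = (lam i + ?m i) *\<^sub>C ?t + lam i *\<^sub>C ?t"
      using arg_cong[OF FH[of i], of "\<lambda>X. X \<bullet> (w \<otimes>\<^sub>C u)"] by (simp add: Hw Hu tensor_pure_simps)
    have 1: "dual_comp \<phi> 1 = \<phi>" by (rule dual_eqI) simp
    have 2: "dual_comp \<phi> (H i) = (lam i + ?m i) *\<^sub>C \<phi>"
      using \<phi> by (intro dual_eqI) (simp add: top_functional_def scaleC_dual.rep_eq)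
    have "contract \<phi> (tmap (H i) 1 \<bullet> ?t + tmap 1 (H i) \<bullet> ?t)
        = H i \<bullet> contract (dual_comp \<phi> 1) ?t + contract (dual_comp \<phi> (H i)) ?t"
      by (simp add: contract_tmap)
    then show ?thesis unfolding FH' 1 2 contract_scaleC contract_simps by (simp add: add.commute)
  qed
  then obtain \<gamma> where \<gamma>: "contract \<phi> ?t = \<gamma> *\<^sub>C u" using lowest_weight_vector by blast
  \<comment> \<open>The pivotal element contributes \<open>?z\<close> on \<open>\<phi>\<close>, the
    same factor that \<open>equivariant_value_at_identity\<close> puts on the other side; the two
    cancel below.\<close>
  have "dual_comp \<phi> Z = ?z *\<^sub>C \<phi>"
    using \<phi> by (intro dual_eqI) (simp add: top_functional_def scaleC_dual.rep_eq)
  then have A: "N w (rank_one u \<phi>) = (?z * \<gamma>) *\<^sub>C u"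
    using rank_one_contract[OF B cbilinear_contract[of Z w 1], of u \<phi>] \<gamma>
    by (simp add: partial_trace_def contract_scaleC scaleC_scaleC)
  have "E i \<bullet> N w A = s i *\<^sub>C N w (ad i \<bullet> A)" for i A
    using partial_trace_E[of i w A]
    by (simp add: w cvs_pair.linear_scale[OF partial_trace_linear(2)] cvs_pair.linear_0[OF partial_trace_linear(2)])
  from equivariant_value_at_identity[OF \<phi> partial_trace_linear(1) this A]
  have "?z *\<^sub>C N w 1 = ?z *\<^sub>C (\<gamma> *\<^sub>C w)" by (simp add: scaleC_scaleC)
  moreover have "?z \<noteq> 0" using s_nz by simp
  ultimately have Nw: "N w 1 = \<gamma> *\<^sub>C w" using cvs.scale_left_imp_eq by blast
  define T where "T = Cend (\<lambda>v. N v 1)"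
  have T: "T \<bullet> v = N v 1" for v by (simp add: T_def Cend_apply partial_trace_linear(2))
  have "ad i \<bullet> 1 = 0" for i by (simp add: ad_apply S(1))
  then have "T * E i = E i * T" for i
    by (intro cend_eqI) (simp add: T partial_trace_E cvs_pair.linear_0[OF partial_trace_linear(1)])
  moreover have "T * H i = H i * T" for i
    by (intro cend_eqI) (simp add: T partial_trace_H)
  ultimately obtain c where c: "\<And>v. T \<bullet> v = c *\<^sub>C v" using commuting_endomorphism_scalar by blast
  have "c = \<gamma>" using c[of w] Nw w(1) by (simp add: T)
  with c T \<gamma> that show thesis by metis
qed

end

end

section \<open>The categorical partial traces as sums of contractions\<close>

lemma clinear_coev_right: "clinear (coev_right B)"
  by (simp add: coev_right_def clinear_iff scaleC_add_left scaleC_scaleC)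

lemma clinear_coev_left: "clinear (coev_left l M B)"
  by (simp add: coev_left_def clinear_iff scaleC_add_left scaleC_scaleC)

lemma clinear_compose: "clinear f \<Longrightarrow> clinear g \<Longrightarrow> clinear (\<lambda>x. f (g x))"
  by (simp add: clinear_iff)

lemma clinear_id: "clinear id"
  by (simp add: clinear_iff)

text \<open>The family \<open>\<psi>\<close> is left abstract so that each functional can be
  supplied in the \<open>dual_comp\<close> shape of \<open>partial_trace\<close>.\<close>

lemma ptr_R_eq:
  fixes M :: "'v::complex_vspace smodule"
  assumes M: "UH_module l M" and f: "clinear f"
    and \<psi>: "\<And>b v. b \<in> B \<Longrightarrow> dual_apply (\<psi> b) v = dual_apply (dual_basis B b) (phi0 l M (parity_twist (gr M) 1 v))"
  shows "ptr_R l M B f v = (\<Sum>b\<in>B. contract (\<psi> b) (f (v \<otimes>\<^sub>C b)))"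
proof -
  have G: "grading (gr M)" using M by (simp add: UH_module_def)
  have lin: "clinear (\<lambda>x. phi0 l M (parity_twist (gr M) 1 x))"
    unfolding phi0_def by (rule clinear_compose[OF clinear_act_word[OF M] clinear_parity_twist[OF G]])
  have d: "clinear (dual_apply \<phi>)" for \<phi> :: "'v dual" using dual_apply[of \<phi>] by simp
  have bil: "cbilinear (\<lambda>x \<phi>. dual_apply \<phi> (phi0 l M (parity_twist (gr M) 1 x)))"
    using lin d by (simp add: cbilinear_def clinear_iff plus_dual.rep_eq scaleC_dual.rep_eq)
  have ev: "clinear (ev_left l M)"
    "ev_left l M (x \<otimes>\<^sub>C \<phi>) = dual_apply \<phi> (phi0 l M (parity_twist (gr M) 1 x))" for x \<phi>
    using tensor_lift[OF bil] by (simp_all add: ev_left_def)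
  have c: "clinear (\<lambda>t. (t :: ('v, 'v) tensor) \<otimes>\<^sub>C \<phi>)" for \<phi> :: "'v dual"
    by (simp add: clinear_iff tensor_pure_simps)
  define R :: "(('v, 'v) tensor, 'v dual) tensor \<Rightarrow> 'v" where
    "R t = tensor_runit (tensor_map id (ev_left l M) (tensor_assoc t))" for t
  have R: "clinear R"
    unfolding R_def
    by (rule clinear_compose[OF clinear_tensor_runit clinear_compose[OF clinear_tensor_map[OF clinear_id ev(1)] clinear_tensor_assoc]])
  have R_contract: "R (t \<otimes>\<^sub>C dual_basis B b) = contract (\<psi> b) t" if "b \<in> B" for t b
  proof -
    have "(\<lambda>t. R (t \<otimes>\<^sub>C dual_basis B b)) = contract (\<psi> b)"
    proof (rule tensor_lift_unique[OF clinear_compose[OF R c] clinear_contract])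
      show "R ((x \<otimes>\<^sub>C y) \<otimes>\<^sub>C dual_basis B b) = contract (\<psi> b) (x \<otimes>\<^sub>C y)" for x y
        by (simp add: R_def tensor_assoc_pure tensor_map_pure[OF clinear_id ev(1)] tensor_runit_pure ev \<psi>[OF that])
    qed
    then show ?thesis by (rule fun_cong)
  qed
  have "ptr_R l M B f v = R (tensor_map f id (tensor_assoc_inv (tensor_map id (coev_right B) (v \<otimes>\<^sub>C 1))))"
    by (simp add: ptr_R_def R_def tensor_runit_inv_def)
  also have "tensor_map id (coev_right B) (v \<otimes>\<^sub>C 1) = v \<otimes>\<^sub>C (\<Sum>b\<in>B. b \<otimes>\<^sub>C dual_basis B b)"
    by (simp add: tensor_map_pure[OF clinear_id clinear_coev_right] coev_right_def scaleC_one)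
  also have "v \<otimes>\<^sub>C (\<Sum>b\<in>B. b \<otimes>\<^sub>C dual_basis B b) = (\<Sum>b\<in>B. v \<otimes>\<^sub>C (b \<otimes>\<^sub>C dual_basis B b))"
    by (rule cvs_pair.linear_sum) (simp add: clinear_iff tensor_pure_simps)
  finally have "ptr_R l M B f v = R (tensor_map f id (tensor_assoc_inv (\<Sum>b\<in>B. v \<otimes>\<^sub>C (b \<otimes>\<^sub>C dual_basis B b))))" .
  also have "\<dots> = (\<Sum>b\<in>B. R (f (v \<otimes>\<^sub>C b) \<otimes>\<^sub>C dual_basis B b))"
    by (simp only: cvs_pair.linear_sum[OF clinear_tensor_assoc_inv] tensor_assoc_inv_pure
        cvs_pair.linear_sum[OF clinear_tensor_map[OF f clinear_id]] tensor_map_pure[OF f clinear_id]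
        cvs_pair.linear_sum[OF R] id_apply)
  also have "\<dots> = (\<Sum>b\<in>B. contract (\<psi> b) (f (v \<otimes>\<^sub>C b)))"
    by (rule sum.cong) (simp_all add: R_contract)
  finally show ?thesis .
qed

definition tensor_swap :: "('v::complex_vspace, 'w::complex_vspace) tensor \<Rightarrow> ('w, 'v) tensor" where
  "tensor_swap = tensor_lift (\<lambda>x y. y \<otimes>\<^sub>C x)"

lemma
  fixes x :: "'v::complex_vspace" and y :: "'w::complex_vspace"
  shows clinear_tensor_swap: "clinear (tensor_swap :: ('v, 'w) tensor \<Rightarrow> ('w, 'v) tensor)"
    and tensor_swap_pure [simp]: "tensor_swap (x \<otimes>\<^sub>C y) = y \<otimes>\<^sub>C x"
proof -
  have "cbilinear (\<lambda>(x::'v) (y::'w). y \<otimes>\<^sub>C x)"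
    by (simp add: cbilinear_def clinear_iff tensor_pure_simps)
  from tensor_lift[OF this]
  show "clinear (tensor_swap :: ('v, 'w) tensor \<Rightarrow> ('w, 'v) tensor)" "tensor_swap (x \<otimes>\<^sub>C y) = y \<otimes>\<^sub>C x"
    by (simp_all add: tensor_swap_def)
qed

text \<open>The left trace evaluates the first tensor factor while \<open>contract\<close> evaluates
  the second, hence the swap.\<close>

lemma ptr_L_eq:
  fixes M :: "'v::complex_vspace smodule"
  assumes f: "clinear f"
  shows "ptr_L l M B f v = (\<Sum>b\<in>B. contract (dual_basis B b)
    (tensor_swap (f (phi0_inv l M (parity_twist (gr M) 1 b) \<otimes>\<^sub>C v))))"
proof -
  have d: "clinear (dual_apply \<phi>)" for \<phi> :: "'v dual" using dual_apply[of \<phi>] by simp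
  have bil: "cbilinear (dual_apply :: 'v dual \<Rightarrow> 'v \<Rightarrow> complex)"
    using d by (simp add: cbilinear_def clinear_iff plus_dual.rep_eq scaleC_dual.rep_eq)
  have ev: "clinear (ev_right :: ('v dual, 'v) tensor \<Rightarrow> complex)"
    using tensor_lift[OF bil] by (simp add: ev_right_def)
  have c: "clinear (\<lambda>t. \<phi> \<otimes>\<^sub>C (t :: ('v, 'v) tensor))" for \<phi> :: "'v dual"
    by (simp add: clinear_iff tensor_pure_simps)
  let ?d = "\<lambda>b. phi0_inv l M (parity_twist (gr M) 1 b)"
  define R :: "('v dual, ('v, 'v) tensor) tensor \<Rightarrow> 'v" where
    "R t = tensor_lunit (tensor_map ev_right id (tensor_assoc_inv t))" for t
  have R: "clinear R"
    unfolding R_def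
    by (rule clinear_compose[OF clinear_tensor_lunit clinear_compose[OF clinear_tensor_map[OF ev clinear_id] clinear_tensor_assoc_inv]])
  have R_contract: "R (\<phi> \<otimes>\<^sub>C t) = contract \<phi> (tensor_swap t)" for t \<phi>
  proof -
    have "(\<lambda>t. R (\<phi> \<otimes>\<^sub>C t)) = (\<lambda>t. contract \<phi> (tensor_swap t))"
    proof (rule tensor_lift_unique[OF clinear_compose[OF R c] clinear_compose[OF clinear_contract clinear_tensor_swap]])
      show "R (\<phi> \<otimes>\<^sub>C (x \<otimes>\<^sub>C y)) = contract \<phi> (tensor_swap (x \<otimes>\<^sub>C y))" for x y
        by (simp add: R_def tensor_assoc_inv_pure tensor_map_pure[OF ev clinear_id] tensor_lunit_pure ev_right_pure)
    qed
    then show ?thesis by (rule fun_cong)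
  qed
  have "ptr_L l M B f v = R (tensor_map id f (tensor_assoc (tensor_map (coev_left l M B) id (1 \<otimes>\<^sub>C v))))"
    by (simp add: ptr_L_def R_def tensor_lunit_inv_def)
  also have "tensor_map (coev_left l M B) id (1 \<otimes>\<^sub>C v) = (\<Sum>b\<in>B. dual_basis B b \<otimes>\<^sub>C ?d b) \<otimes>\<^sub>C v"
    by (simp add: tensor_map_pure[OF clinear_coev_left clinear_id] coev_left_def scaleC_one)
  also have "\<dots> = (\<Sum>b\<in>B. (dual_basis B b \<otimes>\<^sub>C ?d b) \<otimes>\<^sub>C v)"
    by (rule cvs_pair.linear_sum[where f = "\<lambda>t. t \<otimes>\<^sub>C v"]) (simp add: clinear_iff tensor_pure_simps)
  finally have "ptr_L l M B f v = R (tensor_map id f (tensor_assoc (\<Sum>b\<in>B. (dual_basis B b \<otimes>\<^sub>C ?d b) \<otimes>\<^sub>C v)))" .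
  then show ?thesis
    by (simp only: cvs_pair.linear_sum[OF clinear_tensor_assoc] tensor_assoc_pure
        cvs_pair.linear_sum[OF clinear_tensor_map[OF clinear_id f]] tensor_map_pure[OF clinear_id f]
        cvs_pair.linear_sum[OF R] R_contract id_apply)
qed

section \<open>Roots of unity\<close>

lemma xi_eq_cis: "xi l = cis (2 * pi / real l)"
  by (simp add: xi_def cis_conv_exp mult_ac)

lemma xi_power_self: "0 < l \<Longrightarrow> xi l ^ l = 1"
  by (simp add: xi_eq_cis DeMoivre)

lemma xi_nonzero: "xi l \<noteq> 0"
  by (simp add: xi_def)

text \<open>Equality would give \<open>l dvd 2 * j\<close>, and \<open>l\<close> is odd: the square
  of \<open>xi l\<close> is again a primitive root of unity of order \<open>l\<close>.\<close>

lemma xi_sq_power_ne_1: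
  assumes "odd l" "0 < j" "j < l"
  shows "(xi l * xi l) ^ j \<noteq> 1"
proof
  assume "(xi l * xi l) ^ j = 1"
  then have "cis (2 * pi / real l) ^ (2 * j) = 1"
    by (simp add: xi_eq_cis power_mult power2_eq_square)
  then have "cis (real (2 * j) * (2 * pi / real l)) = 1" by (simp only: DeMoivre)
  then have "cos (real (2 * j) * (2 * pi / real l)) = 1" by (metis cis.sel(1) one_complex.sel(1))
  then obtain n :: int where "real (2 * j) * (2 * pi / real l) = of_int n * 2 * pi"
    by (auto simp: cos_one_2pi_int)
  then have "real (2 * j) = of_int n * real l" using assms by (simp add: field_simps)
  then have "int (2 * j) = n * int l" by (metis of_int_eq_iff of_int_mult of_int_of_nat_eq)
  then have "int l dvd int (2 * j)" by simp
  then have "l dvd 2 * j" by (simp only: int_dvd_int_iff)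
  then have "l dvd j" using assms(1) by (simp add: coprime_dvd_mult_right_iff)
  then show False using assms by (auto dest: dvd_imp_le)
qed

text \<open>Otherwise the square of \<open>xi l\<close> is -1, whose odd power \<open>l\<close> is
  not 1.\<close>

lemma xi_add_inverse_nonzero:
  assumes "odd l"
  shows "xi l + inverse (xi l) \<noteq> 0"
proof
  assume "xi l + inverse (xi l) = 0"
  then have "xi l * xi l = - 1" using xi_nonzero[of l] by (simp add: field_simps eq_neg_iff_add_eq_0)
  moreover have "(xi l * xi l) ^ l = 1"
    using assms xi_power_self[of l] by (simp add: power_mult_distrib odd_pos)
  ultimately show False using assms by simp
qed

lemma xi_pow_values:
  "xi_pow l 2 = xi l * xi l" "xi_pow l 1 = xi l" "xi_pow l 0 = 1"
  "xi_pow l (- 1) = inverse (xi l)" "xi_pow l (- 2) = inverse (xi l) * inverse (xi l)"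
  by (simp_all add: xi_pow_def xi_def mult.commute[of "complex_of_real pi"] flip: exp_add exp_minus)

section \<open>The two Borel halves of a module\<close>

fun parity_op :: "'a::complex_alg \<Rightarrow> node \<Rightarrow> 'a" where
  "parity_op P N1 = 1"
| "parity_op P N2 = P"

fun qcartan :: "complex \<Rightarrow> node \<Rightarrow> node \<Rightarrow> complex" where
  "qcartan q N1 N1 = q * q"
| "qcartan q N2 N2 = 1"
| "qcartan q _ _ = inverse q"

lemma inverse_qcommute:
  fixes A K K' :: "'a::complex_alg"
  assumes "K * K' = 1" "K' * K = 1" "A * K = c *\<^sub>C (K * A)"
  shows "K' * A = c *\<^sub>C (A * K')"
proof -
  have "K' * A = K' * (A * K) * K'" by (simp add: mult.assoc assms(1))
  also have "\<dots> = c *\<^sub>C ((K' * K) * A * K')"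
    by (simp only: assms(3) scaleC_mult_left scaleC_mult_right mult.assoc)
  finally show ?thesis by (simp add: assms(2))
qed

text \<open>A single passage from super signs to the sign-free setting, serving both halves:
  \<open>parity_op\<close> turns the group-like \<open>K i\<close> into an \<open>S i\<close> that
  carries the Koszul sign.\<close>

lemma borel_actionI:
  fixes E K K' H :: "node \<Rightarrow> 'v::complex_vspace cend" and P :: "'v cend"
  assumes q: "q \<noteq> 0" "q + inverse q \<noteq> 0" "q ^ l = 1" "\<And>j. 0 < j \<Longrightarrow> j < l \<Longrightarrow> (q * q) ^ j \<noteq> 1" "0 < l"
    and E: "nilpotent_serre q l E"
    and K: "\<And>i. K i * K' i = 1" "\<And>i. K' i * K i = 1" "K N1 * K N2 = K N2 * K N1"
    and P: "P * P = 1" "\<And>i. P * K i = K i * P" "\<And>i. P * H i = H i * P"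
      "P * E N1 = E N1 * P" "P * E N2 = - (E N2 * P)"
    and EK: "\<And>i j. E j * K i = qcartan q i j *\<^sub>C (K i * E j)"
    and HE: "\<And>i j. H i * E j = E j * H i + (\<epsilon> * of_int (cartan i j)) *\<^sub>C E j" and eps: "\<epsilon> \<noteq> 0"
    and HK: "\<And>i j. H i * K j = K j * H i"
    and u: "\<And>i. H i \<bullet> u = lam i *\<^sub>C u" "\<And>i. K i \<bullet> u = ku i *\<^sub>C u" "P \<bullet> u = u"
    and gen: "cvs.span (range (\<lambda>ns. word E ns \<bullet> u)) = UNIV"
    and w: "w \<noteq> 0" "\<And>i. E i \<bullet> w = 0" "\<And>i. K i \<bullet> w = kw i *\<^sub>C w" "P \<bullet> w = w"
    and Hw: "\<And>i. H i \<bullet> w = (lam i + \<epsilon> * (of_nat l * of_int (cartan i N1) + 2 * of_int (cartan i N2))) *\<^sub>C w"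
  shows "borel_action q l E (\<lambda>i. K i * parity_op P i) (\<lambda>i. K' i * parity_op P i) H
    (K N1 ^ l * K N2 ^ 2 * P) \<epsilon> u w lam ku kw (ku N1 ^ l * ku N2 ^ 2)"
proof -
  have inv: "A * K' i = K' i * A" if "A * K i = K i * A" for A i
    using inverse_qcommute[OF K(1,2), of A i 1] that by (simp add: scaleC_one)
  have PK': "P * K' i = K' i * P" and HK': "H i * K' j = K' j * H i" for i j
    using inv P HK by auto
  have K1K: "K i * K j = K j * K i" for i j using K(3) by (cases i; cases j) auto
  have K1K': "K i * K' j = K' j * K i" for i j by (rule inv[OF K1K])
  have Kpow: "A * K i ^ n = K i ^ n * A" if "A * K i = K i * A" for A i n
    using power_qcommute[of A "K i" 1 n] that by (simp add: scaleC_one)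
  have PA: "P * (P * z) = z" "P * (K i * z) = K i * (P * z)" "P * (K' i * z) = K' i * (P * z)"
     "P * (E N1 * z) = E N1 * (P * z)" "P * (E N2 * z) = - (E N2 * (P * z))" "P * (H i * z) = H i * (P * z)" for z i
    using P PK'[of i] by (metis mult.assoc mult_1_left mult_minus_left)+
  have KA: "K i * (K' i * z) = z" "K' i * (K i * z) = z" for z i
    using K by (metis mult.assoc mult_1_left)+
  have HA: "H i * (K j * z) = K j * (H i * z)" "H i * (K' j * z) = K' j * (H i * z)" for i j z
    using HK HK' by (metis mult.assoc)+
  have KE: "K i * E j = inverse (qcartan q i j) *\<^sub>C (E j * K i)" for i j
  proof -
    have "qcartan q i j \<noteq> 0" using q(1) by (cases i; cases j) auto
    then show ?thesis by (simp add: EK scaleC_scaleC scaleC_one)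
  qed
  have EKn: "E j * (K i ^ n * z) = qcartan q i j ^ n *\<^sub>C (K i ^ n * (E j * z))" for i j n z
    by (simp add: power_qcommute[OF EK] scaleC_mult_left flip: mult.assoc)
  let ?\<pi> = "parity_op P"
  let ?Z = "K N1 ^ l * K N2 ^ 2 * P"
  show ?thesis
  proof
    show "K i * ?\<pi> i * (K' i * ?\<pi> i) = 1" for i
      by (cases i) (simp_all add: mult.assoc PA K P(1) KA)
    show "K' i * ?\<pi> i * (K i * ?\<pi> i) = 1" for i
      by (cases i) (simp_all add: mult.assoc PA K P(1) KA)
    show "K N1 * ?\<pi> N1 * (K N2 * ?\<pi> N2) = K N2 * ?\<pi> N2 * (K N1 * ?\<pi> N1)"
      by (simp add: mult.assoc P(2)) (simp add: K(3) flip: mult.assoc)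
    show "K i * ?\<pi> i * E j = qtwist q i j *\<^sub>C (E j * (K i * ?\<pi> i))" for i j
    proof -
      have "K i * (E j * z) = inverse (qcartan q i j) *\<^sub>C (E j * (K i * z))" for z
        using KE by (metis mult.assoc scaleC_mult_left)
      then show ?thesis
        by (cases i; cases j) (simp_all add: mult.assoc P KE scaleC_one)
    qed
    show "H i * (K j * ?\<pi> j) = K j * ?\<pi> j * H i" "H i * (K' j * ?\<pi> j) = K' j * ?\<pi> j * H i" for i j
      by (cases j; simp add: mult.assoc HA P HK HK')+
    \<comment> \<open>For node 1 the exponents give q^(2 l - 2) = q^(-2); for node 2 they give
      q^(-l) = 1, and the sign comes from \<open>P\<close>. Here \<open>q ^ l = 1\<close> ties the
      exponents \<open>l\<close> and 2 to the square of the antipode.\<close>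
    have "qtwist q i i *\<^sub>C (P * E i) = (qcartan q N1 i ^ l * qcartan q N2 i ^ 2) *\<^sub>C (E i * P)" for i
      using q(1,3) P by (cases i) (simp_all add: power_mult_distrib power_inverse power2_eq_square scaleC_one)
    then show "E i * ?Z = qtwist q i i *\<^sub>C (?Z * E i)" for i
      by (simp add: mult.assoc EKn scaleC_mult_right scaleC_scaleC flip: scaleC_mult_right)
    have Zcomm: "?Z * A = A * ?Z" if "\<And>i. A * K i = K i * A" "P * A = A * P" for A
    proof -
      have "A * (K i ^ n * z) = K i ^ n * (A * z)" for i n z
        using Kpow[OF that(1)] by (metis mult.assoc)
      then show ?thesis by (simp add: mult.assoc that(2))
    qed
    show "?Z * (K' i * ?\<pi> i) = K' i * ?\<pi> i * ?Z" for i
      by (rule Zcomm) (cases i; simp add: mult.assoc P PK' PA; simp add: K1K' flip: mult.assoc)+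
    show "?Z * H i = H i * ?Z" for i
      by (rule Zcomm) (simp_all add: HK P)
    have pw: "K i ^ n \<bullet> v = c ^ n *\<^sub>C v" if "K i \<bullet> v = c *\<^sub>C v" for i n v c
      by (induction n) (simp_all add: that scaleC_scaleC scaleC_one mult.commute)
    show "?Z \<bullet> u = (ku N1 ^ l * ku N2 ^ 2) *\<^sub>C u"
      by (simp add: u pw[OF u(2)] scaleC_scaleC mult.commute)
    show "?Z \<bullet> w = (kw N1 ^ l * kw N2 ^ 2) *\<^sub>C w"
      by (simp add: w pw[OF w(3)] scaleC_scaleC mult.commute)
    show "(K i * ?\<pi> i) \<bullet> u = ku i *\<^sub>C u" "(K i * ?\<pi> i) \<bullet> w = kw i *\<^sub>C w" for i
      by (cases i; simp add: u w)+
  qed (use assms in auto)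
qed

section \<open>Cyclic modules\<close>

lemma span_words_closed:
  assumes "\<And>ns. A \<bullet> word E ns \<bullet> v \<in> cvs.span (range (\<lambda>ns. word E ns \<bullet> v))"
    and "x \<in> cvs.span (range (\<lambda>ns. word E ns \<bullet> v))"
  shows "A \<bullet> x \<in> cvs.span (range (\<lambda>ns. word E ns \<bullet> v))"
  using assms(2)
proof (induction rule: cvs.span_induct_alt)
  case (step c y z)
  then show ?case using assms(1) by (auto simp: cvs.span_add cvs.span_scale)
qed (simp add: cvs.span_zero)

lemma span_words_E: "x \<in> cvs.span (range (\<lambda>ns. word E ns \<bullet> v)) \<Longrightarrow> E i \<bullet> x \<in> cvs.span (range (\<lambda>ns. word E ns \<bullet> v))"
proof (rule span_words_closed)
  show "E i \<bullet> word E ns \<bullet> v \<in> cvs.span (range (\<lambda>ns. word E ns \<bullet> v))" for ns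
    by (rule cvs.span_base) (rule range_eqI[of _ _ "i # ns"], simp)
qed

lemma diagonal_on_words:
  fixes K :: "'v::complex_vspace cend"
  assumes "\<And>j. \<exists>a b. K * E j = a *\<^sub>C (E j * K) + b *\<^sub>C E j" "\<exists>c. K \<bullet> v = c *\<^sub>C v"
  shows "\<exists>c. K \<bullet> word E ns \<bullet> v = c *\<^sub>C (word E ns \<bullet> v)"
proof (induction ns)
  case (Cons n ns)
  obtain a b where "K * E n = a *\<^sub>C (E n * K) + b *\<^sub>C E n" using assms(1) by blast
  from arg_cong[OF this, of "\<lambda>A. A \<bullet> word E ns \<bullet> v"] Cons show ?case
    by (auto simp: scaleC_scaleC simp flip: scaleC_add_left)
qed (use assms in simp)

lemma span_words_diagonal:
  fixes K :: "'v::complex_vspace cend"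
  assumes "\<And>j. \<exists>a b. K * E j = a *\<^sub>C (E j * K) + b *\<^sub>C E j" "\<exists>c. K \<bullet> v = c *\<^sub>C v"
    and "x \<in> cvs.span (range (\<lambda>ns. word E ns \<bullet> v))"
  shows "K \<bullet> x \<in> cvs.span (range (\<lambda>ns. word E ns \<bullet> v))"
  using assms(3)
proof (rule span_words_closed[rotated])
  fix ns
  obtain c where "K \<bullet> word E ns \<bullet> v = c *\<^sub>C (word E ns \<bullet> v)"
    using diagonal_on_words[of K E v ns] assms by blast
  then show "K \<bullet> word E ns \<bullet> v \<in> cvs.span (range (\<lambda>ns. word E ns \<bullet> v))"
    by (simp add: cvs.span_base cvs.span_scale)
qed

text \<open>Moving \<open>D\<close> rightwards through a word leaves commutator terms in
  \<open>X\<close>, and the part that reaches \<open>v\<close> vanishes.\<close>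

lemma span_words_opposite:
  fixes D :: "'v::complex_vspace cend"
  assumes "\<And>j. D * E j = E j * D + X j" "D \<bullet> v = 0"
    and X: "\<And>j x. x \<in> cvs.span (range (\<lambda>ns. word E ns \<bullet> v)) \<Longrightarrow> X j \<bullet> x \<in> cvs.span (range (\<lambda>ns. word E ns \<bullet> v))"
    and "x \<in> cvs.span (range (\<lambda>ns. word E ns \<bullet> v))"
  shows "D \<bullet> x \<in> cvs.span (range (\<lambda>ns. word E ns \<bullet> v))"
  using assms(4)
proof (rule span_words_closed[rotated])
  fix ns
  show "D \<bullet> word E ns \<bullet> v \<in> cvs.span (range (\<lambda>ns. word E ns \<bullet> v))"
  proof (induction ns)
    case (Cons n ns)
    have "D \<bullet> word E (n # ns) \<bullet> v = E n \<bullet> D \<bullet> word E ns \<bullet> v + X n \<bullet> word E ns \<bullet> v"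
      using arg_cong[OF assms(1)[of n], of "\<lambda>A. A \<bullet> word E ns \<bullet> v"] by simp
    with Cons show ?case
      by (simp add: cvs.span_add span_words_E X cvs.span_base)
  qed (simp add: assms(2) cvs.span_zero)
qed

section \<open>Typical modules\<close>

lemma grading_split: "grading G \<Longrightarrow> v = hom_part G 0 v + hom_part G 1 v"
proof -
  assume G: "grading G"
  have "hom_part G 1 v = v - hom_part G 0 v"
    by (rule hom_part_unique[OF G]) (use hom_part(1,2)[OF G, where p = 0 and v = v] in simp_all)
  then show ?thesis by simp
qed

lemma parity_twist_0: "grading G \<Longrightarrow> parity_twist G 0 v = v"
  using grading_split[of G v] by (simp add: parity_twist_def koszul_sign_def scaleC_one)

section \<open>The generators as operators and their relations\<close>

locale UH_mod =
  fixes l :: nat and M :: "'v::complex_vspace smodule"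
  assumes odd: "odd l" and CH: "CH_object l M"
begin

abbreviation "q \<equiv> xi l"

lemma UH: "UH_module l M" and grading: "grading (gr M)"
  using CH by (auto simp: CH_object_def UH_module_def)

lemma rels: "UH_relations l M"
  using UH by (simp add: UH_module_def)

definition op :: "gen \<Rightarrow> 'v cend" where "op g = Cend (act M g)"
definition P :: "'v cend" where "P = Cend (parity_twist (gr M) 1)"

abbreviation "e i \<equiv> op (GE i)"
abbreviation "f i \<equiv> op (GF i)"
abbreviation "k i \<equiv> op (GK i)"
abbreviation "k' i \<equiv> op (GKinv i)"
abbreviation "h i \<equiv> op (GH i)"
abbreviation "\<pi> \<equiv> parity_op P"
abbreviation "F i \<equiv> f i * \<pi> i"

lemma op_apply: "op g \<bullet> v = act M g v"
  using UH by (simp add: op_def Cend_apply UH_module_def)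

lemma P_apply: "P \<bullet> v = parity_twist (gr M) 1 v"
  by (simp add: P_def Cend_apply clinear_parity_twist[OF grading])

lemma P_hom: "v \<in> gr M p \<Longrightarrow> P \<bullet> v = koszul_sign p *\<^sub>C v"
  by (simp add: P_apply parity_twist_homogeneous[OF grading])

lemma cend_eq_homogeneousI:
  fixes A B :: "'v cend"
  assumes "\<And>p v. v \<in> gr M p \<Longrightarrow> A \<bullet> v = B \<bullet> v"
  shows "A = B"
proof (rule cend_eqI)
  fix v
  have "A \<bullet> (hom_part (gr M) 0 v + hom_part (gr M) 1 v) = B \<bullet> (hom_part (gr M) 0 v + hom_part (gr M) 1 v)"
    using assms[OF hom_part(1)[OF grading]] by simp
  then show "A \<bullet> v = B \<bullet> v" by (simp flip: grading_split[OF grading])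
qed

lemma PP: "P * P = 1"
  by (rule cend_eq_homogeneousI) (simp add: P_hom scaleC_scaleC koszul_sign_def scaleC_one)

lemma P_op: "P * op g = koszul_sign (gen_parity g) *\<^sub>C (op g * P)"
proof (rule cend_eq_homogeneousI)
  fix p v assume v: "v \<in> gr M p"
  then have "act M g v \<in> gr M (p + gen_parity g)" using UH unfolding UH_module_def by blast
  then have "P \<bullet> op g \<bullet> v = koszul_sign (p + gen_parity g) *\<^sub>C (op g \<bullet> v)"
    by (simp add: P_hom op_apply)
  then show "(P * op g) \<bullet> v = (koszul_sign (gen_parity g) *\<^sub>C (op g * P)) \<bullet> v"
    by (cases p; cases "gen_parity g") (simp_all add: P_hom[OF v] koszul_sign_def scaleC_scaleC scaleC_one)
qed

lemma P_commute:
  "P * k i = k i * P" "P * k' i = k' i * P" "P * h i = h i * P" "P * e N1 = e N1 * P" "P * e N2 = - (e N2 * P)"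
  "P * f N1 = f N1 * P" "P * f N2 = - (f N2 * P)"
  by (simp_all add: P_op koszul_sign_def scaleC_one)

lemma q: "q \<noteq> 0" "q + inverse q \<noteq> 0" "q ^ l = 1" "\<And>j. 0 < j \<Longrightarrow> j < l \<Longrightarrow> (q * q) ^ j \<noteq> 1" "0 < l"
  using odd by (auto simp: xi_nonzero xi_add_inverse_nonzero xi_power_self xi_sq_power_ne_1 odd_pos)

lemma kk': "k i * k' i = 1" "k' i * k i = 1"
  and kk: "k N1 * k N2 = k N2 * k N1"
  and hk: "h i * k j = k j * h i"
  and he: "h i * e j = e j * h i + of_int (cartan i j) *\<^sub>C e j"
  and hf: "h i * f j = f j * h i - of_int (cartan i j) *\<^sub>C f j"
  and ef: "e N1 * f N1 = f N1 * e N1 + (1 / (q - inverse q)) *\<^sub>C (k N1 - k' N1)"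
    "e N2 * f N2 = - (f N2 * e N2) + (1 / (q - inverse q)) *\<^sub>C (k N2 - k' N2)"
    "e N1 * f N2 = f N2 * e N1" "e N2 * f N1 = f N1 * e N2"
  using rels
  by (intro cend_eqI; simp add: UH_relations_def Let_def op_apply algebra_simps eq_diff_eq diff_eq_eq)+

lemma serre: "nilpotent_serre q l e" "nilpotent_serre q l f"
proof -
  have pow: "op g ^ n \<bullet> v = (act M g ^^ n) v" for g n v
    by (induction n) (simp_all add: op_apply)
  have "e N1 ^ l = 0" "f N1 ^ l = 0"
    using CH by (intro cend_eqI; simp add: pow CH_object_def)+
  moreover have "e N2 * e N2 = 0" "f N2 * f N2 = 0"
    "e N1 * e N1 * e N2 - (q + inverse q) *\<^sub>C (e N1 * e N2 * e N1) + e N2 * e N1 * e N1 = 0"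
    "f N1 * f N1 * f N2 - (q + inverse q) *\<^sub>C (f N1 * f N2 * f N1) + f N2 * f N1 * f N1 = 0"
    using rels by (intro cend_eqI; simp add: UH_relations_def Let_def op_apply)+
  ultimately show "nilpotent_serre q l e" "nilpotent_serre q l f"
    by (simp_all add: nilpotent_serre_def)
qed

lemma qcartan_eq: "qcartan q i j = xi_pow l (of_int (cartan i j))"
  by (cases i; cases j) (simp_all add: xi_pow_values)

lemma ke: "k i * e j = qcartan q i j *\<^sub>C (e j * k i)" and fk: "f j * k i = qcartan q i j *\<^sub>C (k i * f j)"
proof -
  have "k i * e j * k' i = qcartan q i j *\<^sub>C e j" "k i * f j * k' i = inverse (qcartan q i j) *\<^sub>C f j"
    using rels by (intro cend_eqI; simp add: UH_relations_def Let_def op_apply qcartan_eq; simp add: xi_pow_def exp_minus)+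
  from arg_cong[OF this(1), of "\<lambda>A. A * k i"] arg_cong[OF this(2), of "\<lambda>A. A * k i"]
  have "k i * e j = qcartan q i j *\<^sub>C (e j * k i)" "k i * f j = inverse (qcartan q i j) *\<^sub>C (f j * k i)"
    by (simp_all add: mult.assoc kk' scaleC_mult_left)
  moreover have "qcartan q i j \<noteq> 0" by (simp add: qcartan_eq xi_pow_def)
  ultimately show "k i * e j = qcartan q i j *\<^sub>C (e j * k i)" "f j * k i = qcartan q i j *\<^sub>C (k i * f j)"
    by (simp_all add: scaleC_scaleC scaleC_one)
qed

lemma k'e: "e j * k' i = qcartan q i j *\<^sub>C (k' i * e j)"
proof -
  have "e j * k' i = k' i * (k i * e j) * k' i" using kk'(2)[of i] by (metis mult.assoc mult_1_left)
  then show ?thesis by (simp add: ke scaleC_mult mult.assoc kk')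
qed

lemma Fk: "F j * k i = qcartan q i j *\<^sub>C (k i * F j)"
  by (cases j) (simp_all add: mult.assoc P_commute; simp add: fk scaleC_mult flip: mult.assoc)+

lemma hF: "h i * F j = F j * h i + (- 1 * of_int (cartan i j)) *\<^sub>C F j"
proof -
  have "\<pi> j * h i = h i * \<pi> j" by (cases j) (simp_all add: P_commute)
  then have "F j * h i = f j * h i * \<pi> j" by (simp add: mult.assoc)
  then show ?thesis by (simp add: hf left_diff_distrib scaleC_mult_left flip: mult.assoc)
qed

lemma PF: "P * F N1 = F N1 * P" "P * F N2 = - (F N2 * P)"
  by (simp_all add: P_commute flip: mult.assoc)

text \<open>Each Serre term contains \<open>f N2\<close> once, so \<open>P\<close> can be pulled out
  to the right; in the square of \<open>F N2\<close> the two parities cancel up to sign.\<close>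

lemma serre_F: "nilpotent_serre q l F"
proof -
  have S: "f N1 ^ l = 0" "f N2 * f N2 = 0"
    "f N1 * f N1 * f N2 - (q + inverse q) *\<^sub>C (f N1 * f N2 * f N1) + f N2 * f N1 * f N1 = 0"
    using serre(2) by (simp_all add: nilpotent_serre_def)
  have "F N2 * F N2 = - (f N2 * f N2 * (P * P))" by (simp add: mult.assoc P_commute) (simp add: P_commute flip: mult.assoc)
  moreover have "F N1 * F N1 * F N2 - (q + inverse q) *\<^sub>C (F N1 * F N2 * F N1) + F N2 * F N1 * F N1
    = (f N1 * f N1 * f N2 - (q + inverse q) *\<^sub>C (f N1 * f N2 * f N1) + f N2 * f N1 * f N1) * P"
  proof -
    have "P * (f N1 * z) = f N1 * (P * z)" for z using P_commute(6) by (metis mult.assoc)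
    then show ?thesis
      by (simp add: distrib_right left_diff_distrib mult.assoc P_commute scaleC_mult_left)
  qed
  ultimately show ?thesis using S by (simp add: nilpotent_serre_def)
qed

lemma h_k_eigen:
  assumes "h i \<bullet> v = x *\<^sub>C v"
  shows "k i \<bullet> v = xi_pow l x *\<^sub>C v" "k' i \<bullet> v = inverse (xi_pow l x) *\<^sub>C v"
proof -
  show 1: "k i \<bullet> v = xi_pow l x *\<^sub>C v"
    using CH assms unfolding op_apply CH_object_def by blast
  have "k' i \<bullet> k i \<bullet> v = v" using arg_cong[OF kk'(2)[of i], of "\<lambda>A. A \<bullet> v"] by simp
  then have "inverse (xi_pow l x) *\<^sub>C v = inverse (xi_pow l x) *\<^sub>C (xi_pow l x *\<^sub>C (k' i \<bullet> v))"
    unfolding 1 by simp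
  then show "k' i \<bullet> v = inverse (xi_pow l x) *\<^sub>C v"
    by (simp add: scaleC_scaleC xi_pow_def scaleC_one)
qed

definition Q :: "node \<Rightarrow> 'v cend" where
  "Q i = (1 / (q - inverse q)) *\<^sub>C (k i - k' i) * \<pi> i"

text \<open>The parity in \<open>F N2\<close> turns the anticommutator of the odd node into a
  commutator, so both nodes obey one rule.\<close>

lemma eF: "e i * F j = F j * e i + (if i = j then Q i else 0)"
proof -
  have "e i * F j = (e i * f j) * \<pi> j" by (simp add: mult.assoc)
  also have "\<dots> = F j * e i + (if i = j then Q i else 0)"
    by (cases i; cases j)
      (simp_all add: ef Q_def distrib_right left_diff_distrib mult.assoc P_commute scaleC_mult_left)
  finally show ?thesis .
qed

lemma submoduleI:
  assumes "cvs.subspace W" and "\<And>i x. x \<in> W \<Longrightarrow> e i \<bullet> x \<in> W" "\<And>i x. x \<in> W \<Longrightarrow> F i \<bullet> x \<in> W"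
    "\<And>i x. x \<in> W \<Longrightarrow> k i \<bullet> x \<in> W" "\<And>i x. x \<in> W \<Longrightarrow> k' i \<bullet> x \<in> W" "\<And>i x. x \<in> W \<Longrightarrow> h i \<bullet> x \<in> W"
    "\<And>x. x \<in> W \<Longrightarrow> P \<bullet> x \<in> W"
  shows "submodule M W"
proof -
  have "f i * \<pi> i * \<pi> i = f i" for i by (cases i) (simp_all add: mult.assoc PP)
  then have ff: "f i \<bullet> x = F i \<bullet> \<pi> i \<bullet> x" for i x by (metis cend_simps(5))
  have "op g \<bullet> x \<in> W" if "x \<in> W" for g x
  proof (cases g)
    case (GF i)
    have "\<pi> i \<bullet> x \<in> W" using assms(7) that by (cases i) auto
    then show ?thesis unfolding GF ff by (rule assms(3))
  qed (use assms that in auto)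
  moreover have "hom_part (gr M) p x \<in> W" if "x \<in> W" for p x
  proof -
    define a b where "a = hom_part (gr M) 0 x" and "b = hom_part (gr M) 1 x"
    have x: "x = a + b" unfolding a_def b_def by (rule grading_split[OF grading])
    have Px: "P \<bullet> x = a - b"
      by (simp add: P_apply parity_twist_def koszul_sign_def a_def b_def)
    have two: "y + y = 2 *\<^sub>C y" for y :: 'v
      by (metis one_add_one scaleC_add_left scaleC_one)
    have "x + P \<bullet> x = a + a" "x - P \<bullet> x = b + b" unfolding Px by (simp_all add: x)
    \<comment> \<open>The homogeneous projections are (1 + P)/2 and (1 - P)/2, so a subspace stable
      under \<open>P\<close> is graded.\<close>
    then have "hom_part (gr M) 0 x = (1 / 2) *\<^sub>C (x + P \<bullet> x)" "hom_part (gr M) 1 x = (1 / 2) *\<^sub>C (x - P \<bullet> x)"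
      by (simp_all add: a_def[symmetric] b_def[symmetric] two)
    then show ?thesis
      using assms(1,7) that by (cases p) (simp_all add: cvs.subspace_scale cvs.subspace_add cvs.subspace_diff)
  qed
  ultimately show ?thesis using assms(1) by (auto simp: submodule_def op_apply)
qed

lemma qcartan_nz: "qcartan q i j \<noteq> 0"
  by (simp add: qcartan_eq xi_pow_def)

text \<open>One shape covers the group-like operators and \<open>P\<close>, where
  \<open>b = 0\<close>, and the derivations \<open>h i\<close>, where \<open>a = 1\<close>.\<close>

lemma diagonal_commutations:
  assumes "K \<in> range k \<union> range k' \<union> range h \<union> {P}"
  shows "\<exists>a b. K * e j = a *\<^sub>C (e j * K) + b *\<^sub>C e j" "\<exists>a b. K * F j = a *\<^sub>C (F j * K) + b *\<^sub>C F j"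
proof -
  have P1: "P * e j = (case j of N1 \<Rightarrow> 1 | N2 \<Rightarrow> - 1) *\<^sub>C (e j * P) + 0 *\<^sub>C e j"
    "P * F j = (case j of N1 \<Rightarrow> 1 | N2 \<Rightarrow> - 1) *\<^sub>C (F j * P) + 0 *\<^sub>C F j"
    using P_commute(4,5) PF by (cases j; simp add: scaleC_one)+
  have k1: "k i * e j = qcartan q i j *\<^sub>C (e j * k i) + 0 *\<^sub>C e j" for i by (simp add: ke)
  have k2: "k' i * e j = inverse (qcartan q i j) *\<^sub>C (e j * k' i) + 0 *\<^sub>C e j" for i
    using qcartan_nz[of i j] by (simp add: k'e scaleC_scaleC scaleC_one)
  have k3: "k i * F j = inverse (qcartan q i j) *\<^sub>C (F j * k i) + 0 *\<^sub>C F j" for i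
    using qcartan_nz[of i j] by (simp only: Fk scaleC_scaleC) (simp add: scaleC_one)
  have k4: "k' i * F j = qcartan q i j *\<^sub>C (F j * k' i) + 0 *\<^sub>C F j" for i
    using inverse_qcommute[OF kk' Fk, of i j] by simp
  have h1: "h i * e j = 1 *\<^sub>C (e j * h i) + of_int (cartan i j) *\<^sub>C e j" for i
    by (simp add: he scaleC_one)
  have h2: "h i * F j = 1 *\<^sub>C (F j * h i) + (- 1 * of_int (cartan i j)) *\<^sub>C F j" for i
    using hF[of i j] by (simp only: scaleC_one)
  show "\<exists>a b. K * e j = a *\<^sub>C (e j * K) + b *\<^sub>C e j" "\<exists>a b. K * F j = a *\<^sub>C (F j * K) + b *\<^sub>C F j"
    using assms P1 k1 k2 k3 k4 h1 h2 by blast+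
qed

text \<open>Here \<open>(E, D)\<close> is \<open>(e, F)\<close> or \<open>(F, e)\<close>.\<close>

lemma cyclic:
  assumes simple: "\<And>W. submodule M W \<Longrightarrow> W = {0} \<or> W = UNIV"
    and ED: "\<And>W. (\<And>i x. x \<in> W \<Longrightarrow> E i \<bullet> x \<in> W) \<Longrightarrow> (\<And>i x. x \<in> W \<Longrightarrow> D i \<bullet> x \<in> W)
      \<Longrightarrow> (\<forall>i. \<forall>x\<in>W. e i \<bullet> x \<in> W) \<and> (\<forall>i. \<forall>x\<in>W. F i \<bullet> x \<in> W)"
    and comm: "\<And>K j. K \<in> range k \<union> range k' \<union> range h \<union> {P} \<Longrightarrow> \<exists>a b. K * E j = a *\<^sub>C (E j * K) + b *\<^sub>C E j"
    and DE: "\<And>i j. D i * E j = E j * D i + (if i = j then c *\<^sub>C Q i else 0)"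
    and v: "v \<noteq> 0" "P \<bullet> v = v" "\<And>i. h i \<bullet> v = x i *\<^sub>C v" "\<And>i. D i \<bullet> v = 0"
  shows "cvs.span (range (\<lambda>ns. word E ns \<bullet> v)) = UNIV"
proof -
  let ?W = "cvs.span (range (\<lambda>ns. word E ns \<bullet> v))"
  have diag: "K \<bullet> y \<in> ?W" if "K \<in> range k \<union> range k' \<union> range h \<union> {P}" "y \<in> ?W" for K y
  proof (rule span_words_diagonal[OF comm[OF that(1)] _ that(2)])
    have "P \<bullet> v = 1 *\<^sub>C v" by (simp add: v scaleC_one)
    then show "\<exists>c. K \<bullet> v = c *\<^sub>C v" using that(1) v(3) h_k_eigen[OF v(3)] by blast
  qed
  have Q: "Q i \<bullet> y \<in> ?W" if "y \<in> ?W" for i y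
  proof -
    have "\<pi> i \<bullet> y \<in> ?W" using that diag[of P] by (cases i) auto
    then show ?thesis
      by (simp add: Q_def diag cvs.span_scale cvs.span_diff)
  qed
  have D: "D i \<bullet> y \<in> ?W" if "y \<in> ?W" for i y
    by (rule span_words_opposite[OF DE v(4) _ that])
      (simp add: Q cvs.span_scale cvs.span_zero)
  have "submodule M ?W"
    by (rule submoduleI) (use ED[of ?W] span_words_E D diag in \<open>auto intro: cvs.subspace_span\<close>)
  moreover have "v \<in> ?W" by (rule cvs.span_base) (rule range_eqI[of _ _ "[]"], simp)
  ultimately show ?thesis using simple v(1) by blast
qed

end

section \<open>Highest and lowest weight vectors of a typical module\<close>

locale typical_mod = UH_mod l M for l and M :: "'v::complex_vspace smodule" +
  fixes \<mu> :: "node \<Rightarrow> complex" and w :: 'v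
  assumes simple: "\<And>W. submodule M W \<Longrightarrow> W = {0} \<or> W = UNIV"
    and dim: "cvs.dim (UNIV :: 'v set) = 4 * l"
    and w: "w \<noteq> 0" "P \<bullet> w = w" "\<And>i. e i \<bullet> w = 0" "\<And>i. h i \<bullet> w = \<mu> i *\<^sub>C w"
begin

lemma gen_w: "cvs.span (range (\<lambda>ns. word F ns \<bullet> w)) = UNIV"
  by (rule cyclic[where D = e and c = 1, OF simple _ diagonal_commutations(2) _ w(1,2,4,3)])
    (simp_all add: eF scaleC_one)

text \<open>By the bounds in \<open>pbw_eq_0\<close>, this is the only monomial of degree (l, 2)
  that can act by a nonzero operator.\<close>

definition u :: 'v where "u = pbw q F 1 1 (l - 1) \<bullet> w"

definition lam :: "node \<Rightarrow> complex" where
  "lam i = \<mu> i - (of_nat l * of_int (cartan i N1) + 2 * of_int (cartan i N2))"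

text \<open>Each \<open>F i\<close> raises the degree beyond the maximum: in every resulting
  monomial one exponent reaches 2 or \<open>l\<close>.\<close>

lemma F_u: "F i \<bullet> u = 0"
proof -
  note pbw = pbw_eq_0[OF serre_F q(1,2)]
  have "F i * pbw q F 1 1 (l - 1) = 0"
  proof (cases i)
    case N1
    obtain c d where "F N1 * pbw q F 1 1 (l - 1)
        = c *\<^sub>C pbw q F 1 1 (Suc (l - 1)) + d *\<^sub>C pbw q F (1 - 1) (Suc 1) (l - 1)"
      using e1_pbw[OF serre_F q(1,2)] by blast
    then show ?thesis unfolding N1 by (simp add: pbw)
  next
    case N2
    have "F N2 * pbw q F 1 1 (l - 1) = pbw q F 2 1 (l - 1)"
      by (simp add: pbw_def mult.assoc power2_eq_square)
    then show ?thesis unfolding N2 by (simp add: pbw)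
  qed
  from arg_cong[OF this, of "\<lambda>A. A \<bullet> w"] show ?thesis by (simp add: u_def)
qed

lemma h_u: "h i \<bullet> u = lam i *\<^sub>C u"
proof -
  have mult: "h i * (A * B) = (A * B) * h i + (a + b) *\<^sub>C (A * B)"
    if "h i * A = A * h i + a *\<^sub>C A" "h i * B = B * h i + b *\<^sub>C B" for A B a b
  proof -
    have "h i * (A * B) = A * (h i * B) + a *\<^sub>C (A * B)"
      by (simp add: that(1) distrib_right scaleC_mult_left mult.assoc flip: mult.assoc[of "h i"])
    then show ?thesis by (simp add: that(2) distrib_left scaleC_mult_right scaleC_add_left mult.assoc)
  qed
  have pow: "h i * A ^ n = A ^ n * h i + (of_nat n * a) *\<^sub>C A ^ n" if "h i * A = A * h i + a *\<^sub>C A" for A a n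
  proof (induction n)
    case (Suc n)
    from mult[OF that Suc] show ?case by (simp add: algebra_simps)
  qed simp
  let ?c = "\<lambda>j. - 1 * of_int (cartan i j) :: complex"
  have "h i * root_e3 q F = root_e3 q F * h i + (?c N1 + ?c N2) *\<^sub>C root_e3 q F"
    using mult[OF hF hF, of N1 N2] mult[OF hF hF, of N2 N1]
    by (simp only: root_e3_def right_diff_distrib left_diff_distrib scaleC_mult_right scaleC_mult_left
        scaleC_add_right add.commute[of "?c N2"] cvs.scale_right_diff_distrib)
      (simp add: mult.commute)
  from mult[OF mult[OF hF[of i N2] this] pow[OF hF[of i N1], of "l - 1"]]
  have "h i * pbw q F 1 1 (l - 1) = pbw q F 1 1 (l - 1) * h i
      + (?c N2 + (?c N1 + ?c N2) + of_nat (l - 1) * ?c N1) *\<^sub>C pbw q F 1 1 (l - 1)"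
    by (simp add: pbw_def)
  moreover have "?c N2 + (?c N1 + ?c N2) + of_nat (l - 1) * ?c N1 = lam i - \<mu> i"
    using q(5) by (simp add: lam_def of_nat_diff algebra_simps)
  ultimately have "h i * pbw q F 1 1 (l - 1) = pbw q F 1 1 (l - 1) * h i + (lam i - \<mu> i) *\<^sub>C pbw q F 1 1 (l - 1)"
    by (simp only:)
  from arg_cong[OF this, of "\<lambda>A. A \<bullet> w"] show ?thesis
    by (simp add: u_def w flip: scaleC_add_left)
qed

text \<open>The two odd factors \<open>F N2\<close> and \<open>root_e3 q F\<close> contribute
  cancelling signs.\<close>

lemma P_u: "P \<bullet> u = u"
proof -
  have c: "P * (X * z) = X * (P * z)" if "P * X = X * P" for X z :: "'v cend"
    using that by (simp flip: mult.assoc)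
  have a: "P * (X * z) = - (X * (P * z))" if "P * X = - (X * P)" for X z :: "'v cend"
    using that by (simp flip: mult.assoc)
  note PF' = c[OF PF(1)] a[OF PF(2)]
  have e3: "P * (root_e3 q F * z) = - (root_e3 q F * (P * z))" for z
    unfolding root_e3_def
    by (simp only: left_diff_distrib right_diff_distrib scaleC_mult_left scaleC_mult_right mult.assoc[of "F N1" "F N2"]
        mult.assoc[of "F N2" "F N1"] PF') simp
  have pow: "P * F N1 ^ n = F N1 ^ n * P" for n
    using power_qcommute[of P "F N1" 1 n] PF(1) by (simp only: scaleC_one power_one)
  have "P * pbw q F 1 1 (l - 1) = pbw q F 1 1 (l - 1) * P"
    by (simp only: pbw_def power_one_right mult.assoc[of "F N2"] mult.assoc[of "root_e3 q F"] PF' e3 pow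
        mult_minus_right minus_minus)
  from arg_cong[OF this, of "\<lambda>A. A \<bullet> w"] show ?thesis by (simp add: u_def w)
qed

text \<open>If \<open>u\<close> vanished, \<open>V\<close> would be spanned by the other \<open>4 * l - 1\<close> monomials.\<close>

lemma u_nonzero: "u \<noteq> 0"
proof
  assume "u = 0"
  let ?I = "{0, 1} \<times> {0, 1} \<times> {..<l} :: (nat \<times> nat \<times> nat) set"
  let ?m = "\<lambda>(a, b, i). pbw q F a b i \<bullet> w"
  let ?S = "?m ` (?I - {(1, 1, l - 1)})"
  have m: "pbw q F a b i \<bullet> w \<in> cvs.span ?S" for a b i
  proof (cases "(a, b, i) \<in> ?I - {(1, 1, l - 1)}")
    case True
    then have "?m (a, b, i) \<in> ?S" by (rule imageI)
    then show ?thesis by (simp add: cvs.span_base)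
  next
    case False
    then have "(a, b, i) = (1, 1, l - 1) \<or> 2 \<le> a \<or> 2 \<le> b \<or> l \<le> i" by auto
    then have "pbw q F a b i \<bullet> w = 0"
      using \<open>u = 0\<close> pbw_eq_0[OF serre_F q(1,2), of a b i] by (auto simp: u_def)
    then show ?thesis by (simp add: cvs.span_zero)
  qed
  have "A \<bullet> w \<in> cvs.span ?S" if "A \<in> cvs.span (pbw_set q F n m)" for A n m
    using that
  proof (induction rule: cvs.span_induct_alt)
    case (step c x y)
    then show ?case using m by (auto simp: pbw_set_def cvs.span_add cvs.span_scale)
  qed (simp add: cvs.span_zero)
  from this[OF word_in_span_pbw[OF serre_F q(1,2)]]
  have "cvs.span (range (\<lambda>ns. word F ns \<bullet> w)) \<subseteq> cvs.span ?S"
    by (intro cvs.span_minimal) auto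
  then have "cvs.dim (UNIV :: 'v set) \<le> card ?S"
    unfolding gen_w by (intro cvs.dim_le_card) auto
  also have "\<dots> \<le> card (?I - {(1, 1, l - 1)})" by (rule card_image_le) simp
  also have "\<dots> < card ?I" using q(5) by (intro card_Diff1_less) simp_all
  also have "card ?I = 4 * l" by (simp add: card_cartesian_product)
  finally show False using dim by simp
qed

lemma gen_u: "cvs.span (range (\<lambda>ns. word e ns \<bullet> u)) = UNIV"
  by (rule cyclic[where D = F and c = "- 1", OF simple _ diagonal_commutations(1) _ u_nonzero P_u h_u F_u])
    (auto simp: eF scaleC_one)

text \<open>The inverse \<open>k'\<close> appears because the coproduct of \<open>e i\<close>
  carries k_i^(-1) in its second term.\<close>

sublocale R: borel_action q l e "\<lambda>i. k' i * \<pi> i" "\<lambda>i. k i * \<pi> i" h "k' N1 ^ l * k' N2 ^ 2 * P" 1 u w lam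
  "\<lambda>i. inverse (xi_pow l (lam i))" "\<lambda>i. inverse (xi_pow l (\<mu> i))"
  "inverse (xi_pow l (lam N1)) ^ l * inverse (xi_pow l (lam N2)) ^ 2"
proof (rule borel_actionI)
  have "k' N2 * k N1 = k N1 * k' N2"
    using inverse_qcommute[OF kk', of "k N1" N2 1] by (simp add: kk scaleC_one)
  then show "k' N1 * k' N2 = k' N2 * k' N1"
    using inverse_qcommute[OF kk', of "k' N2" N1 1] by (simp add: scaleC_one)
  show "h i * k' j = k' j * h i" for i j
    using inverse_qcommute[OF kk', of "h i" j 1] by (simp add: hk scaleC_one)
qed (use q serre(1) kk' PP P_commute k'e he h_u h_k_eigen[OF h_u] P_u gen_u w h_k_eigen[OF w(4)] in \<open>simp_all add: lam_def\<close>)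

text \<open>The value \<open>- 1\<close> of \<open>\<epsilon>\<close> records that \<open>F\<close>
  lowers weights; now \<open>w\<close> generates and \<open>u\<close> is the vector that is
  killed.\<close>

sublocale L: borel_action q l F "\<lambda>i. k i * \<pi> i" "\<lambda>i. k' i * \<pi> i" h "k N1 ^ l * k N2 ^ 2 * P" "- 1" w u \<mu>
  "\<lambda>i. xi_pow l (\<mu> i)" "\<lambda>i. xi_pow l (lam i)" "xi_pow l (\<mu> N1) ^ l * xi_pow l (\<mu> N2) ^ 2"
proof (rule borel_actionI)
  show "P * F N1 = F N1 * P" "P * F N2 = - (F N2 * P)" by (fact PF)+
  show "F j * k i = qcartan q i j *\<^sub>C (k i * F j)" for i j by (fact Fk)
  show "h i * F j = F j * h i + (- 1 * of_int (cartan i j)) *\<^sub>C F j" for i j by (fact hF)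
qed (use q serre_F kk' kk hk PP P_commute h_u h_k_eigen[OF h_u] F_u P_u u_nonzero gen_w w h_k_eigen[OF w(4)] in \<open>simp_all add: lam_def\<close>)

end

section \<open>Endomorphisms of the tensor square\<close>

lemma commutes_mult:
  fixes C :: "'a::complex_alg"
  assumes "C * X = X * C" "C * Y = Y * C"
  shows "C * (X * Y) = X * Y * C"
proof -
  have "C * (X * Y) = X * (C * Y)" by (simp add: assms(1) flip: mult.assoc)
  then show ?thesis by (simp add: assms(2) mult.assoc)
qed

context UH_mod
begin

lemma act_word_simps:
  "act_word M [] = (\<lambda>v. v)" "act_word M [g] = cend_apply (op g)"
  by (auto simp: act_word_def op_apply fun_eq_iff)

lemma tmap_eqI:
  assumes "\<And>x. A' x = A \<bullet> x" "\<And>x. B' x = B \<bullet> x"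
  shows "tensor_map A' B' t = tmap A B \<bullet> t"
proof -
  have "A' = cend_apply A" "B' = cend_apply B" using assms by auto
  then show ?thesis by (simp add: tmap_apply)
qed

lemma act_tensor:
  "act (tensor_module M M) (GE i) t = (tmap (e i) 1 + tmap (k' i * \<pi> i) (e i)) \<bullet> t"
  "act (tensor_module M M) (GF i) t = (tmap (f i) (k i) + tmap (\<pi> i) (f i)) \<bullet> t"
  "act (tensor_module M M) (GK i) t = tmap (k i) (k i) \<bullet> t"
  "act (tensor_module M M) (GKinv i) t = tmap (k' i) (k' i) \<bullet> t"
  "act (tensor_module M M) (GH i) t = (tmap (h i) 1 + tmap 1 (h i)) \<bullet> t"
proof -
  have p0: "parity_twist (gr M) 0 x = x" for x by (rule parity_twist_0[OF grading])
  have pp: "parity_twist (gr M) (gen_parity (GE i)) x = \<pi> i \<bullet> x"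
    "parity_twist (gr M) (gen_parity (GF i)) x = \<pi> i \<bullet> x" for x
    by (cases i; simp add: p0 P_apply)+
  have wp: "word_parity [] = 0" "word_parity [g] = gen_parity g" for g
    by (simp_all add: word_parity_def)
  have pk: "gen_parity (GK i) = 0" "gen_parity (GKinv i) = 0" "gen_parity (GH i) = 0"
    by simp_all
  let ?t = "\<lambda>a b. tensor_map (\<lambda>x. act_word M a (parity_twist (gr M) (word_parity b) x)) (act_word M b) t"
  have 1: "?t [g] [] = tmap (op g) 1 \<bullet> t" for g
    by (rule tmap_eqI) (simp_all add: wp p0 act_word_simps)
  have 2: "?t [GKinv i] [GE i] = tmap (k' i * \<pi> i) (e i) \<bullet> t"
    by (rule tmap_eqI) (simp_all add: wp pp act_word_simps del: gen_parity.simps)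
  have 3: "?t [GF i] [GK i] = tmap (f i) (k i) \<bullet> t"
    by (rule tmap_eqI) (simp_all add: wp pk p0 act_word_simps)
  have 4: "?t [] [GF i] = tmap (\<pi> i) (f i) \<bullet> t"
    by (rule tmap_eqI) (simp_all add: wp pp act_word_simps del: gen_parity.simps)
  have 5: "?t [GK i] [GK i] = tmap (k i) (k i) \<bullet> t" "?t [GKinv i] [GKinv i] = tmap (k' i) (k' i) \<bullet> t"
    by (rule tmap_eqI; simp add: wp pk p0 act_word_simps)+
  have 6: "?t [] [GH i] = tmap 1 (h i) \<bullet> t"
    by (rule tmap_eqI) (simp_all add: wp pk p0 act_word_simps)
  show
    "act (tensor_module M M) (GE i) t = (tmap (e i) 1 + tmap (k' i * \<pi> i) (e i)) \<bullet> t"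
    "act (tensor_module M M) (GF i) t = (tmap (f i) (k i) + tmap (\<pi> i) (f i)) \<bullet> t"
    "act (tensor_module M M) (GK i) t = tmap (k i) (k i) \<bullet> t"
    "act (tensor_module M M) (GKinv i) t = tmap (k' i) (k' i) \<bullet> t"
    "act (tensor_module M M) (GH i) t = (tmap (h i) 1 + tmap 1 (h i)) \<bullet> t"
    by (simp_all add: tensor_module_def 1 2 3 4 5 6)
qed

lemma tmap_mult: "tmap A B * tmap C D = tmap (A * C) (B * D)"
  by (rule tensor_cend_eqI) simp

lemma tmap_PP_hom: "t \<in> gr (tensor_module M M) p \<Longrightarrow> tmap P P \<bullet> t = koszul_sign p *\<^sub>C t"
  unfolding tensor_module_def smodule.simps
proof (rule cend_scalar_on_span, assumption)
  fix b assume "b \<in> {x \<otimes>\<^sub>C y |x y r s. x \<in> gr M r \<and> y \<in> gr M s \<and> r + s = p}"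
  then obtain x y r s where b: "b = x \<otimes>\<^sub>C y" "x \<in> gr M r" "y \<in> gr M s" "p = r + s" by blast
  show "tmap P P \<bullet> b = koszul_sign p *\<^sub>C b"
    unfolding b(1,4) tmap_pure P_hom[OF b(2)] P_hom[OF b(3)]
    by (cases r; cases s) (simp_all add: koszul_sign_def tensor_pure_simps del: cvs.scale_minus_left)
qed

lemma hom_commutes:
  assumes F: "\<phi> \<in> CH_hom (tensor_module M M) (tensor_module M M)"
  shows "clinear \<phi>"
    and "Cend \<phi> * (tmap (e i) 1 + tmap (k' i * \<pi> i) (e i)) = (tmap (e i) 1 + tmap (k' i * \<pi> i) (e i)) * Cend \<phi>"
    and "Cend \<phi> * (tmap (f i) (k i) + tmap (\<pi> i) (f i)) = (tmap (f i) (k i) + tmap (\<pi> i) (f i)) * Cend \<phi>"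
    and "Cend \<phi> * tmap (k i) (k i) = tmap (k i) (k i) * Cend \<phi>"
    and "Cend \<phi> * tmap (k' i) (k' i) = tmap (k' i) (k' i) * Cend \<phi>"
    and "Cend \<phi> * (tmap (h i) 1 + tmap 1 (h i)) = (tmap (h i) 1 + tmap 1 (h i)) * Cend \<phi>"
    and "Cend \<phi> * tmap P P = tmap P P * Cend \<phi>"
proof -
  show lin: "clinear \<phi>" using F by (simp add: CH_hom_def)
  have act: "\<phi> (act (tensor_module M M) g t) = act (tensor_module M M) g (\<phi> t)" for g t
    using F by (simp add: CH_hom_def)
  have *: "Cend \<phi> * A = A * Cend \<phi>" if "\<And>t. act (tensor_module M M) g t = A \<bullet> t" for g A
    using act[of g] that by (intro cend_eqI) (simp add: Cend_apply[OF lin])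
  show "Cend \<phi> * (tmap (e i) 1 + tmap (k' i * \<pi> i) (e i)) = (tmap (e i) 1 + tmap (k' i * \<pi> i) (e i)) * Cend \<phi>"
    "Cend \<phi> * (tmap (f i) (k i) + tmap (\<pi> i) (f i)) = (tmap (f i) (k i) + tmap (\<pi> i) (f i)) * Cend \<phi>"
    "Cend \<phi> * tmap (k i) (k i) = tmap (k i) (k i) * Cend \<phi>"
    "Cend \<phi> * tmap (k' i) (k' i) = tmap (k' i) (k' i) * Cend \<phi>"
    "Cend \<phi> * (tmap (h i) 1 + tmap 1 (h i)) = (tmap (h i) 1 + tmap 1 (h i)) * Cend \<phi>"
    by (rule *, rule act_tensor)+
  show "Cend \<phi> * tmap P P = tmap P P * Cend \<phi>"
  proof (rule tensor_cend_eqI)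
    fix x y
    let ?D = "Cend \<phi> * tmap P P - tmap P P * Cend \<phi>"
    have hom: "?D \<bullet> (a \<otimes>\<^sub>C b) = 0" if "a \<in> gr M r" "b \<in> gr M s" for a b r s
    proof -
      have ab: "a \<otimes>\<^sub>C b \<in> gr (tensor_module M M) (r + s)"
        using that by (auto simp: tensor_module_def intro!: cvs.span_base)
      then have "\<phi> (a \<otimes>\<^sub>C b) \<in> gr (tensor_module M M) (r + s)"
        using F unfolding CH_hom_def by blast
      then show ?thesis using tmap_PP_hom[OF ab] by (simp add: Cend_apply[OF lin] tmap_PP_hom cvs_pair.linear_scale[OF lin])
    qed
    let ?p = "\<lambda>p. hom_part (gr M) p"
    have "x \<otimes>\<^sub>C y = (?p 0 x + ?p 1 x) \<otimes>\<^sub>C (?p 0 y + ?p 1 y)"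
      by (simp flip: grading_split[OF grading])
    also have "\<dots> = ?p 0 x \<otimes>\<^sub>C ?p 0 y + ?p 1 x \<otimes>\<^sub>C ?p 0 y + (?p 0 x \<otimes>\<^sub>C ?p 1 y + ?p 1 x \<otimes>\<^sub>C ?p 1 y)"
      by (simp only: tensor_pure_simps)
    finally have "?D \<bullet> (x \<otimes>\<^sub>C y) = 0"
      by (simp only: cend_apply_simps hom[OF hom_part(1)[OF grading] hom_part(1)[OF grading]]) simp
    then show "(Cend \<phi> * tmap P P) \<bullet> (x \<otimes>\<^sub>C y) = (tmap P P * Cend \<phi>) \<bullet> (x \<otimes>\<^sub>C y)" by simp
  qed
qed

lemma hom_commutes_parity_op:
  assumes "\<phi> \<in> CH_hom (tensor_module M M) (tensor_module M M)"
  shows "Cend \<phi> * tmap (\<pi> i) (\<pi> i) = tmap (\<pi> i) (\<pi> i) * Cend \<phi>"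
proof -
  have "tmap 1 1 = (1 :: ('v, 'v) tensor cend)" by (rule tensor_cend_eqI) simp
  then show ?thesis using hom_commutes(7)[OF assms] by (cases i) simp_all
qed

text \<open>A morphism is even, hence commutes with \<pi> \<otimes> \<pi>. Multiplying the coproduct
  of \<open>f i\<close> by this on the right replaces \<open>f i\<close> with \<open>F i\<close> and
  moves the parity onto the leg with \<open>k i\<close>.\<close>

lemma hom_commutes_F:
  assumes "\<phi> \<in> CH_hom (tensor_module M M) (tensor_module M M)"
  shows "Cend \<phi> * (tmap 1 (F i) + tmap (F i) (k i * \<pi> i)) = (tmap 1 (F i) + tmap (F i) (k i * \<pi> i)) * Cend \<phi>"
proof -
  let ?X = "tmap (f i) (k i) + tmap (\<pi> i) (f i)" and ?Y = "tmap (\<pi> i) (\<pi> i) :: ('v, 'v) tensor cend"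
  have "\<pi> i * \<pi> i = 1" by (cases i) (simp_all add: PP)
  then have "tmap 1 (F i) + tmap (F i) (k i * \<pi> i) = ?X * ?Y"
    by (simp add: distrib_right tmap_mult)
  moreover have "Cend \<phi> * (?X * ?Y) = (?X * ?Y) * Cend \<phi>"
    by (rule commutes_mult[OF hom_commutes(3)[OF assms] hom_commutes_parity_op[OF assms]])
  ultimately show ?thesis by simp
qed

lemma phi0_eq: "phi0 l M v = (k' N1 ^ l * k' N2 ^ 2) \<bullet> v"
  and phi0_inv_eq: "phi0_inv l M v = (k N2 ^ 2 * k N1 ^ l) \<bullet> v"
proof -
  have "act_word M (replicate n g @ gs) v = op g ^ n \<bullet> act_word M gs v" for n g gs v
    by (induction n) (simp_all add: act_word_def op_apply)
  note a = this[of _ _ "[]", simplified] this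
  show "phi0 l M v = (k' N1 ^ l * k' N2 ^ 2) \<bullet> v" "phi0_inv l M v = (k N2 ^ 2 * k N1 ^ l) \<bullet> v"
    unfolding phi0_def phi0_inv_def a by (simp_all add: act_word_simps)
qed

end

section \<open>The tensor flip and the comparison of the two traces\<close>

lemma contract_swap: "dual_apply \<chi> (contract \<phi> t) = dual_apply \<phi> (contract \<chi> (tensor_swap t))"
proof -
  have "(\<lambda>t. dual_apply \<chi> (contract \<phi> t)) = (\<lambda>t. dual_apply \<phi> (contract \<chi> (tensor_swap t)))"
    by (rule tensor_lift_unique)
      (simp_all add: clinear_iff cvs_pair.linear_add[OF clinear_tensor_swap] cvs_pair.linear_scale[OF clinear_tensor_swap])
  then show ?thesis by (rule fun_cong)
qed

definition tensor_flip :: "('v::complex_vspace, 'v) tensor cend" where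
  "tensor_flip = Cend tensor_swap"

lemma tensor_flip_apply: "tensor_flip \<bullet> t = tensor_swap t"
  by (simp add: tensor_flip_def Cend_apply clinear_tensor_swap)

lemma tensor_flip_flip: "tensor_flip * tensor_flip = 1"
  by (rule tensor_cend_eqI) (simp add: tensor_flip_apply)

lemma tensor_flip_tmap: "tensor_flip * tmap A B = tmap B A * tensor_flip"
  by (rule tensor_cend_eqI) (simp add: tensor_flip_apply)

text \<open>Transports equivariance to the flipped endomorphism, whose trace over the second factor
  is the trace of the original over the first.\<close>

lemma tensor_flip_conjugate_commutes:
  assumes "\<Phi> * X = X * \<Phi>" "tensor_flip * Y = X * tensor_flip"
  shows "(tensor_flip * \<Phi> * tensor_flip) * Y = Y * (tensor_flip * \<Phi> * tensor_flip)"
proof -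
  have "Y * tensor_flip = tensor_flip * (tensor_flip * Y) * tensor_flip" by (simp add: tensor_flip_flip flip: mult.assoc)
  also have "\<dots> = tensor_flip * X" by (simp add: assms(2) mult.assoc tensor_flip_flip)
  finally have Y: "Y * tensor_flip = tensor_flip * X" .
  have "(tensor_flip * \<Phi> * tensor_flip) * Y = tensor_flip * (\<Phi> * X) * tensor_flip" by (simp add: mult.assoc assms(2))
  also have "\<dots> = Y * tensor_flip * \<Phi> * tensor_flip" unfolding assms(1) by (simp only: Y flip: mult.assoc)
  finally show ?thesis by (simp add: mult.assoc)
qed

context typical_mod
begin

theorem ptr_L_eq_ptr_R:
  assumes \<phi>: "\<phi> \<in> CH_hom (tensor_module M M) (tensor_module M M)" and B: "homogeneous_basis (gr M) B"
  shows "ptr_L l M B \<phi> = ptr_R l M B \<phi>"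
proof
  fix v
  let ?\<Phi> = "Cend \<phi>"
  let ?ZR = "k' N1 ^ l * k' N2 ^ 2 * P" and ?ZL = "k N1 ^ l * k N2 ^ 2 * P"
  note comm = hom_commutes[OF \<phi>]
  have \<Phi>: "?\<Phi> \<bullet> t = \<phi> t" for t by (simp add: Cend_apply[OF comm(1)])
  have B1: "cvs.independent B" "cvs.span B = UNIV" using B by (auto simp: homogeneous_basis_def)
  have finB: "finite B"
  proof -
    obtain C where "finite C" "cvs.span C = (UNIV :: 'v set)" using CH by (auto simp: CH_object_def)
    then show ?thesis using cvs.independent_span_bound[of C B] B1 by auto
  qed
  note B2 = finB B1
  obtain \<omega> where \<omega>: "R.top_functional \<omega>" using R.ex_top_functional by blast
  obtain \<upsilon> where \<upsilon>: "L.top_functional \<upsilon>" using L.ex_top_functional by blast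
  have R1: "?\<Phi> * tmap (k' i * \<pi> i) (k' i * \<pi> i) = tmap (k' i * \<pi> i) (k' i * \<pi> i) * ?\<Phi>" for i
    using commutes_mult[OF comm(5) hom_commutes_parity_op[OF \<phi>], of i i] by (simp only: tmap_mult)
  obtain \<gamma> where \<gamma>: "contract \<omega> (\<phi> (w \<otimes>\<^sub>C u)) = \<gamma> *\<^sub>C u" "R.partial_trace B ?\<Phi> v 1 = \<gamma> *\<^sub>C v"
    using R.partial_trace_scalar[OF B2 comm(2) R1 comm(6) \<omega>] unfolding \<Phi> by metis
  have "ptr_R l M B \<phi> v = (\<Sum>b\<in>B. contract (dual_comp (dual_basis B b) ?ZR) (\<phi> (v \<otimes>\<^sub>C b)))"
    by (rule ptr_R_eq[OF UH comm(1)]) (simp add: phi0_eq P_apply)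
  also have "\<dots> = \<gamma> *\<^sub>C v"
    unfolding \<gamma>(2)[symmetric] R.partial_trace_def by (simp add: \<Phi>)
  finally have R: "ptr_R l M B \<phi> v = \<gamma> *\<^sub>C v" .
  let ?\<Psi> = "tensor_flip * ?\<Phi> * tensor_flip"
  have \<Psi>: "?\<Psi> \<bullet> (x \<otimes>\<^sub>C y) = tensor_swap (\<phi> (y \<otimes>\<^sub>C x))" for x y
    by (simp add: tensor_flip_apply \<Phi>)
  have L1: "?\<Psi> * (tmap (F i) 1 + tmap (k i * \<pi> i) (F i)) = (tmap (F i) 1 + tmap (k i * \<pi> i) (F i)) * ?\<Psi>" for i
    by (rule tensor_flip_conjugate_commutes[OF hom_commutes_F[OF \<phi>]]) (simp add: distrib_left distrib_right tensor_flip_tmap)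
  have L2: "?\<Psi> * tmap (k i * \<pi> i) (k i * \<pi> i) = tmap (k i * \<pi> i) (k i * \<pi> i) * ?\<Psi>" for i
  proof (rule tensor_flip_conjugate_commutes)
    show "?\<Phi> * tmap (k i * \<pi> i) (k i * \<pi> i) = tmap (k i * \<pi> i) (k i * \<pi> i) * ?\<Phi>"
      using commutes_mult[OF comm(4) hom_commutes_parity_op[OF \<phi>], of i i] by (simp only: tmap_mult)
  qed (rule tensor_flip_tmap)
  have L3: "?\<Psi> * (tmap (h i) 1 + tmap 1 (h i)) = (tmap (h i) 1 + tmap 1 (h i)) * ?\<Psi>" for i
    by (rule tensor_flip_conjugate_commutes[OF comm(6)]) (simp add: distrib_left distrib_right tensor_flip_tmap add.commute)
  obtain \<gamma>' where \<gamma>': "contract \<upsilon> (tensor_swap (\<phi> (w \<otimes>\<^sub>C u))) = \<gamma>' *\<^sub>C w" "L.partial_trace B ?\<Psi> v 1 = \<gamma>' *\<^sub>C v"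
    using L.partial_trace_scalar[OF B2 L1 L2 L3 \<upsilon>] unfolding \<Psi> by metis
  have Z: "phi0_inv l M (parity_twist (gr M) 1 b) = ?ZL \<bullet> b" for b
  proof -
    have "k N2 ^ 2 * k N1 ^ l = k N1 ^ l * k N2 ^ 2"
      by (rule power_commuting_commutes[symmetric])
        (metis kk power_commuting_commutes)
    then show ?thesis by (simp only: phi0_inv_eq cend_simps(5) P_apply)
  qed
  \<comment> \<open>Cyclicity moves the inverse pivotal element from the vector, where the left
    coevaluation puts it, to the functional, where \<open>partial_trace\<close> expects
    \<open>Z\<close>.\<close>
  have "cbilinear (\<lambda>\<psi> x. contract \<psi> (?\<Psi> \<bullet> (v \<otimes>\<^sub>C x)))"
    by (simp add: cbilinear_def clinear_iff tensor_pure_simps contract_add contract_scaleC)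
  from dual_sum_cyclic[OF B2 this, of ?ZL]
  have "ptr_L l M B \<phi> v = L.partial_trace B ?\<Psi> v 1"
    unfolding ptr_L_eq[OF comm(1)] L.partial_trace_def Z \<Psi> by simp
  then have L: "ptr_L l M B \<phi> v = \<gamma>' *\<^sub>C v" by (simp add: \<gamma>')
  \<comment> \<open>Both are the value of \<upsilon> \<otimes> \<omega> on
    \<open>\<phi> (w \<otimes>\<^sub>C u)\<close>, the two factors being contracted in either
    order.\<close>
  have "\<gamma> = \<gamma>'"
    using contract_swap[of \<upsilon> \<omega> "\<phi> (w \<otimes>\<^sub>C u)"] \<omega> \<upsilon>
    by (simp add: \<gamma>(1) \<gamma>'(1) R.top_functional_def L.top_functional_def)
  with R L show "ptr_L l M B \<phi> v = ptr_R l M B \<phi> v" by simp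
qed

end

theorem theorem4p1:
  fixes l :: nat and \<mu> :: "complex \<times> complex" and M :: "('v::complex_vspace) smodule"
  assumes "odd l" and "l \<ge> 3"
    and "is_V l \<mu> M" and "typical l M"
  shows "ambidextrous l M"
proof -
  have CH_simple: "CH_simple l M" using assms(3) by (simp add: is_V_def)
  obtain w where w: "w \<noteq> 0" "w \<in> gr M 0" "act M (GE N1) w = 0" "act M (GE N2) w = 0"
    "act M (GH N1) w = fst \<mu> *\<^sub>C w" "act M (GH N2) w = snd \<mu> *\<^sub>C w"
    using assms(3) by (auto simp: is_V_def)
  interpret UH_mod l M
    by unfold_locales (use assms(1) CH_simple in \<open>auto simp: CH_simple_def\<close>)
  interpret typical_mod l M "case_node (fst \<mu>) (snd \<mu>)" w
  proof
    show "W = {0} \<or> W = UNIV" if "submodule M W" for W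
      using CH_simple that by (simp add: CH_simple_def)
    show "cvs.dim (UNIV :: 'v set) = 4 * l" using assms(4) by (simp add: typical_def)
    show "P \<bullet> w = w" using P_hom[OF w(2)] by (simp add: koszul_sign_def scaleC_one)
    show "e i \<bullet> w = 0" "h i \<bullet> w = (case i of N1 \<Rightarrow> fst \<mu> | N2 \<Rightarrow> snd \<mu>) *\<^sub>C w" for i
      using w by (cases i; simp add: op_apply)+
  qed (fact w(1))
  show ?thesis using CH_simple ptr_L_eq_ptr_R by (simp add: ambidextrous_def)
qed

end
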